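(* Let $(X_1,Y_1),\dots,(X_n,Y_n)$ be i.i.d. from $N_{p+m}(0,\Sigma)$, and let $\mathcal F_q=\mathcal F_q(s_u,s_v,p,m,r,\lambda;\kappa,M)$, $k_q^u,k_q^v$, $\varepsilon_n^2$ and the truncated estimator $\widehat{U_1V_1'}$ be as defined in the context. For any constant $C_1>0$ there exist a sufficiently small constant $c\in(0,1)$ and a constant $C_2>0$, depending only on $M,q,\kappa$ and $C_1$, such that if $\varepsilon_n^2\le c$, $$\exp\bigl(C_1(k_q^u+\log(ep/k_q^u))\bigr)>n\lambda^2\quad\text{and}\quad \exp\bigl(C_1(k_q^v+\log(em/k_q^v))\bigr)>n\lambda^2,$$ then $$\sup_{\Sigma\in\mathcal F_q:\ \lambda_{r+1}\le c\lambda}\mathbb E_\Sigma\bigl\|\widehat{U_1V_1'}-U_1V_1'\bigr\|_{\mathrm F}^2\le C_2\varepsilon_n^2 .$$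
   Context: Notation: $'$ is transpose, $A_{i*}$ the $i$th row of $A$, $\|\cdot\|_{\mathrm F}$ and $\|\cdot\|_{\mathrm{op}}$ the Frobenius and operator norms, $a\vee b=\max(a,b)$, $e$ is Euler's number. $n,p,m,r$ are positive integers, $\bar r=\min(p,m)$, $r\le\bar r$; $q\in[0,2)$, $s_u,s_v,\lambda>0$, $\kappa,M>1$. For a matrix $A$ with ordered row norms $\|A_{(1)*}\|\ge\|A_{(2)*}\|\ge\cdots$, put $\|A\|_{q,w}=\max_j j\|A_{(j)*}\|^q$ with $0^q=0$ (so $\|A\|_{0,w}$ is the number of nonzero rows). Parameter space. $\mathcal F_q$ is the set of covariance matrices $\Sigma=\begin{pmatrix}\Sigma_x&\Sigma_{xy}\\ \Sigma_{yx}&\Sigma_y\end{pmatrix}$ ($\Sigma_x$ is $p\times p$, $\Sigma_y$ is $m\times m$) with $\Sigma_{xy}=\Sigma_x(U\Lambda V')\Sigma_y$, $U'\Sigma_xU=V'\Sigma_yV=I_{\bar r}$, $\Lambda=\mathrm{diag}(\lambda_1,\dots,\lambda_{\bar r})$, $1>\lambda_1\ge\cdots\ge\lambda_{\bar r}\ge0$, split as $U\Lambda V'=U_1\Lambda_1V_1'+U_2\Lambda_2V_2'$ where $\Lambda_1=\mathrm{diag}(\lambda_1,\dots,\lambda_r)$, $\Lambda_2=\mathrm{diag}(\lambda_{r+1},\dots,\lambda_{\bar r})$, and $U_1,V_1$ (resp. $U_2,V_2$) are the first $r$ (resp. last $\bar r-r$) columns of $U,V$, such that: (1) $\|U_1\|_{q,w}\le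 s_u$, $\|V_1\|_{q,w}\le s_v$; (2) $\|\Sigma_x^l\|_{\mathrm{op}}\vee\|\Sigma_y^l\|_{\mathrm{op}}\le M$ for $l=\pm1$; (3) $1>\kappa\lambda\ge\lambda_1\ge\cdots\ge\lambda_r\ge\lambda>0$. By convention $\lambda_{r+1}=0$ if $r=\bar r$. Standing assumption: $\kappa\lambda\le1-c_*$ for a fixed absolute constant $c_*\in(0,1)$. Effective sparsity. $x_q^u=\max\{0\le x\le p: x\le s_u(\frac{n\lambda^2}{r+\log(ep/x)})^{q/2}\}$, $x_q^v=\max\{0\le x\le m: x\le s_v(\frac{n\lambda^2}{r+\log(em/x)})^{q/2}\}$, $k_q^u=\lceil x_q^u\rceil$, $k_q^v=\lceil x_q^v\rceil$, and $$\varepsilon_n^2=\frac1{n\lambda^2}\Bigl(r(k_q^u+k_q^v)+k_q^u\log\frac{ep}{k_q^u}+k_q^v\log\frac{em}{k_q^v}\Bigr).$$ Estimator. Let $\widehat\Sigma=\begin{pmatrix}\widehat\Sigma_x&\widehat\Sigma_{xy}\\ \widehat\Sigma_{yx}&\widehat\Sigma_y\end{pmatrix}$ be the sample covariance matrix $\frac1n\sum_i Z_iZ_i'$ with $Z_i=(X_i',Y_i')'$. $(\widehat U_1,\widehat V_1)$ is a solution of: maximize $\mathrm{Tr}(A'\widehat\Sigma_{xy}B)$ over $A\in\mathbb R^{p\times r}$, $B\in\mathbb R^{m\times r}$ subject to $A'\widehat\Sigma_xA=B'\widehat\Sigma_yB=I_r$, $\|A\|_{0,w}=k_q^u$, $\|B\|_{0,w}=k_q^v$.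 The truncated estimator is $\widehat{U_1V_1'}=\widehat U_1\widehat V_1'\,\mathbf 1_{\{\|\widehat U_1\widehat V_1'\|_{\mathrm F}\le 2M\sqrt r\}}$. $\mathbb E_\Sigma$ is expectation when the sample is drawn from $N_{p+m}(0,\Sigma)$. *)

theory Defs
  imports "HOL-Probability.Probability" "Jordan_Normal_Form.Determinant"
    "Jordan_Normal_Form.Gauss_Jordan_Elimination"
begin

section \<open>Matrix norms, trace and blocks\<close>

definition vec_l2 :: "real Matrix.vec \<Rightarrow> real" where
  "vec_l2 v = L2_set (\<lambda>i. vec_index v i) {..<dim_vec v}"

definition frob_norm :: "real mat \<Rightarrow> real" where
  "frob_norm A = L2_set (\<lambda>ij. A $$ ij) ({..<dim_row A} \<times> {..<dim_col A})"

definition op_norm :: "real mat \<Rightarrow> real" where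
  "op_norm A = Sup {vec_l2 (A *\<^sub>v v) | v. v \<in> carrier_vec (dim_col A) \<and> vec_l2 v \<le> 1}"

definition mat_trace :: "real mat \<Rightarrow> real" where
  "mat_trace A = (\<Sum>i<dim_row A. A $$ (i, i))"

definition first_cols :: "nat \<Rightarrow> real mat \<Rightarrow> real mat" where
  "first_cols r A = Matrix.mat (dim_row A) r (\<lambda>(i, j). A $$ (i, j))"

definition sorted_row_norms :: "real mat \<Rightarrow> real list" where
  "sorted_row_norms A = rev (sort (map (\<lambda>i. vec_l2 (Matrix.row A i)) [0..<dim_row A]))"

text \<open>
  The convention that \<open>0\<close> to the power \<open>q\<close> is \<open>0\<close>, also for \<open>q = 0\<close>, is built into \<open>powr\<close>
  (\<open>0 powr q = 0\<close> for every \<open>q\<close>), so \<open>weak_norm 0 A\<close> is the number of nonzero rows of \<open>A\<close>.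
  List positions start at \<open>0\<close>, whence the factor \<open>Suc j\<close>.
\<close>
definition weak_norm :: "real \<Rightarrow> real mat \<Rightarrow> real" where
  "weak_norm q A = Max ((\<lambda>j. real (Suc j) * (sorted_row_norms A ! j) powr q) ` {..<dim_row A})"

text \<open>The blocks of a \<open>(p + m) \<times> (p + m)\<close> matrix whose upper left block is \<open>p \<times> p\<close>.\<close>

definition block_x :: "nat \<Rightarrow> real mat \<Rightarrow> real mat" where
  "block_x p S = (case split_block S p p of (Sx, Sxy, Syx, Sy) \<Rightarrow> Sx)"

definition block_xy :: "nat \<Rightarrow> real mat \<Rightarrow> real mat" where
  "block_xy p S = (case split_block S p p of (Sx, Sxy, Syx, Sy) \<Rightarrow> Sxy)"

definition block_y :: "nat \<Rightarrow> real mat \<Rightarrow> real mat" where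
  "block_y p S = (case split_block S p p of (Sx, Sxy, Syx, Sy) \<Rightarrow> Sy)"


section \<open>Parameter space\<close>

definition covariance_matrix :: "nat \<Rightarrow> real mat \<Rightarrow> bool" where
  "covariance_matrix d S \<longleftrightarrow> S \<in> carrier_mat d d \<and> S\<^sup>T = S
     \<and> (\<forall>v \<in> carrier_vec d. 0 \<le> scalar_prod v (S *\<^sub>v v))"

text \<open>\<open>S\<close> is invertible and both \<open>S\<close> and its inverse have operator norm at most \<open>M\<close>.\<close>
definition well_conditioned :: "real \<Rightarrow> real mat \<Rightarrow> bool" where
  "well_conditioned M S \<longleftrightarrow>
     op_norm S \<le> M \<and> (\<exists>T. mat_inverse S = Some T \<and> op_norm T \<le> M)"

text \<open>
  Canonical correlation decomposition of \<open>S\<close>. The canonical correlations are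
  \<open>l 0 \<ge> l 1 \<ge> \<dots> \<ge> l (min p m - 1)\<close>, so \<open>l i\<close> is the one usually written with index \<open>i + 1\<close>;
  the values of \<open>l\<close> from \<open>min p m\<close> on are irrelevant.
\<close>
definition cca_decomposition ::
    "nat \<Rightarrow> nat \<Rightarrow> real mat \<Rightarrow> real mat \<Rightarrow> real mat \<Rightarrow> (nat \<Rightarrow> real) \<Rightarrow> bool" where
  "cca_decomposition p m S U V l \<longleftrightarrow>
     (let d = min p m in
        U \<in> carrier_mat p d \<and> V \<in> carrier_mat m d
      \<and> block_xy p S = block_x p S * (U * mat_diag d l * V\<^sup>T) * block_y p S
      \<and> U\<^sup>T * block_x p S * U = 1\<^sub>m d
      \<and> V\<^sup>T * block_y p S * V = 1\<^sub>m d
      \<and> (\<forall>i<d. 0 \<le> l i \<and> l i < 1)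
      \<and> (\<forall>i j. i \<le> j \<and> j < d \<longrightarrow> l j \<le> l i))"

text \<open>
  A covariance matrix \<open>S\<close> is listed together with each decomposition \<open>(U, V, l)\<close> that witnesses
  its membership in the class, because the estimand (the product of the first \<open>r\<close> columns of
  \<open>U\<close> and of \<open>V\<close>) and the canonical correlations are read off from the decomposition.
\<close>
definition param_space ::
    "real \<Rightarrow> real \<Rightarrow> real \<Rightarrow> nat \<Rightarrow> nat \<Rightarrow> nat \<Rightarrow> real \<Rightarrow> real \<Rightarrow> real
      \<Rightarrow> (real mat \<times> real mat \<times> real mat \<times> (nat \<Rightarrow> real)) set" where
  "param_space q s_u s_v p m r lam \<kappa> M =
     {(S, U, V, l). covariance_matrix (p + m) S \<and> cca_decomposition p m S U V l
        \<and> weak_norm q (first_cols r U) \<le> s_u \<and> weak_norm q (first_cols r V) \<le> s_v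
        \<and> well_conditioned M (block_x p S) \<and> well_conditioned M (block_y p S)
        \<and> \<kappa> * lam < 1 \<and> 0 < lam \<and> (\<forall>i<r. lam \<le> l i \<and> l i \<le> \<kappa> * lam)}"

text \<open>The canonical correlation following the first \<open>r\<close> ones, and \<open>0\<close> if there is none.\<close>
definition next_corr :: "nat \<Rightarrow> nat \<Rightarrow> nat \<Rightarrow> (nat \<Rightarrow> real) \<Rightarrow> real" where
  "next_corr p m r l = (if r < min p m then l r else 0)"


section \<open>Effective sparsity\<close>

text \<open>
  Used with \<open>(d, s) = (p, s_u)\<close> and \<open>(d, s) = (m, s_v)\<close>. The point \<open>x = 0\<close> always satisfies the
  condition, whatever value is given to the logarithm there.
\<close>
definition eff_x :: "real \<Rightarrow> real \<Rightarrow> nat \<Rightarrow> nat \<Rightarrow> nat \<Rightarrow> real \<Rightarrow> real" where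
  "eff_x q s n d r lam =
     (GREATEST x. 0 \<le> x \<and> x \<le> real d \<and>
        x \<le> s * (real n * lam\<^sup>2 / (real r + ln (exp 1 * real d / x))) powr (q / 2))"

definition eff_k :: "real \<Rightarrow> real \<Rightarrow> nat \<Rightarrow> nat \<Rightarrow> nat \<Rightarrow> real \<Rightarrow> nat" where
  "eff_k q s n d r lam = nat \<lceil>eff_x q s n d r lam\<rceil>"

definition eps_sq ::
    "real \<Rightarrow> real \<Rightarrow> real \<Rightarrow> nat \<Rightarrow> nat \<Rightarrow> nat \<Rightarrow> nat \<Rightarrow> real \<Rightarrow> real" where
  "eps_sq q s_u s_v n p m r lam =
     (let k_u = real (eff_k q s_u n p r lam); k_v = real (eff_k q s_v n m r lam) in
        1 / (real n * lam\<^sup>2) *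
          (real r * (k_u + k_v) + k_u * ln (exp 1 * real p / k_u)
             + k_v * ln (exp 1 * real m / k_v)))"


section \<open>Gaussian samples\<close>

text \<open>
  The centred normal law with nonsingular covariance matrix \<open>S\<close> on the functions on \<open>{..<d}\<close>,
  by its Lebesgue density. Nonsingularity holds for every \<open>S\<close> in the parameter space: both
  diagonal blocks are invertible and all canonical correlations are below \<open>1\<close>.
\<close>
definition mvn :: "nat \<Rightarrow> real mat \<Rightarrow> (nat \<Rightarrow> real) measure" where
  "mvn d S = density (PiM {..<d} (\<lambda>_. lborel))
     (\<lambda>z. ennreal (exp (- (1 / 2) *
              scalar_prod (Matrix.vec d z) (the (mat_inverse S) *\<^sub>v Matrix.vec d z))
            / sqrt ((2 * pi) ^ d * Determinant.det S)))"

text \<open>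
  Law of the i.i.d. sample: \<open>Z i\<close> is the \<open>i\<close>-th observation, whose coordinates below \<open>p\<close> form the
  \<open>X\<close> part and whose coordinates from \<open>p\<close> on form the \<open>Y\<close> part.
\<close>
definition sample_law :: "nat \<Rightarrow> nat \<Rightarrow> real mat \<Rightarrow> (nat \<Rightarrow> nat \<Rightarrow> real) measure" where
  "sample_law n d S = PiM {..<n} (\<lambda>_. mvn d S)"

definition sample_cov :: "nat \<Rightarrow> nat \<Rightarrow> (nat \<Rightarrow> nat \<Rightarrow> real) \<Rightarrow> real mat" where
  "sample_cov n d Z = Matrix.mat d d (\<lambda>(a, b). (\<Sum>i<n. Z i a * Z i b) / real n)"


section \<open>The estimator\<close>

definition cca_feasible ::
    "nat \<Rightarrow> nat \<Rightarrow> nat \<Rightarrow> nat \<Rightarrow> nat \<Rightarrow> real mat \<Rightarrow> real mat \<Rightarrow> real mat \<Rightarrow> bool" where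
  "cca_feasible p m r k_u k_v S A B \<longleftrightarrow>
     A \<in> carrier_mat p r \<and> B \<in> carrier_mat m r
   \<and> A\<^sup>T * block_x p S * A = 1\<^sub>m r \<and> B\<^sup>T * block_y p S * B = 1\<^sub>m r
   \<and> weak_norm 0 A = real k_u \<and> weak_norm 0 B = real k_v"

text \<open>
  Degenerate samples (such as the zero sample) admit no feasible pair, so an estimator can solve
  this problem only for almost every sample.
\<close>
definition cca_solution ::
    "nat \<Rightarrow> nat \<Rightarrow> nat \<Rightarrow> nat \<Rightarrow> nat \<Rightarrow> real mat \<Rightarrow> real mat \<Rightarrow> real mat \<Rightarrow> bool" where
  "cca_solution p m r k_u k_v S A B \<longleftrightarrow>
     cca_feasible p m r k_u k_v S A B
   \<and> (\<forall>A' B'. cca_feasible p m r k_u k_v S A' B' \<longrightarrow>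
        mat_trace (A'\<^sup>T * block_xy p S * B') \<le> mat_trace (A\<^sup>T * block_xy p S * B))"

text \<open>Matrix-valued statistics of the sample, measurable entry by entry.\<close>
definition mat_statistic ::
    "nat \<Rightarrow> nat \<Rightarrow> nat \<Rightarrow> nat \<Rightarrow> ((nat \<Rightarrow> nat \<Rightarrow> real) \<Rightarrow> real mat) \<Rightarrow> bool" where
  "mat_statistic n d a b T \<longleftrightarrow>
     (\<forall>Z. T Z \<in> carrier_mat a b) \<and>
     (\<forall>i<a. \<forall>j<b. (\<lambda>Z. T Z $$ (i, j))
        \<in> borel_measurable (PiM {..<n} (\<lambda>_. PiM {..<d} (\<lambda>_. lborel))))"

definition truncated_product :: "real \<Rightarrow> nat \<Rightarrow> real mat \<Rightarrow> real mat \<Rightarrow> real mat" where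
  "truncated_product M r A B =
     (if frob_norm (A * B\<^sup>T) \<le> 2 * M * sqrt (real r) then A * B\<^sup>T
      else 0\<^sub>m (dim_row A) (dim_row B))"

end

theory Submission
  imports Defs
begin

text \<open>
  Let \<open>\<tau>\<close> be a large multiple of \<open>\<epsilon>\<^sub>n\<close>. Keeping the largest rows of \<open>U\<^sub>1\<close>, \<open>V\<^sub>1\<close> and orthonormalising
  with respect to the sample covariance gives a feasible pair whose product is within \<open>O(\<tau>)\<close> of
  \<open>U\<^sub>1 V\<^sub>1'\<close>. Let \<open>K\<close> be the difference between that product and the estimator. Optimality of the
  estimator and the curvature of \<open>\<langle>p L q', p q' - K'\<rangle>\<close> over products \<open>K'\<close> of matrices with orthonormal
  columns give
  \<open>lam \<parallel>K\<parallel>\<^sup>2 \<lesssim> |\<langle>W, K\<rangle>| + lam \<tau> \<parallel>K\<parallel> + c lam (\<parallel>K\<parallel>\<^sup>2 + \<tau>\<^sup>2)\<close>,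
  where \<open>W\<close> is the error of the sample covariance. Since \<open>K\<close> has rank at most \<open>2 r\<close> and sparse rows
  and columns, \<open>|\<langle>W, K\<rangle>| \<le> lam \<tau> \<parallel>K\<parallel>\<close> with high probability, and \<open>\<parallel>K\<parallel> = O(\<tau>)\<close> follows.

  The probability bound comes from a Chernoff bound for Gaussian quadratic forms and a union bound over
  a lattice of factorisations \<open>A B'\<close>; a factorisation is moved to the lattice by rounding its entries
  one at a time so that the squared Frobenius error stays below its average over random rounding.
  This replaces nets of operator norm balls. On the exceptional event the truncated loss is at most
  \<open>9 M\<^sup>2 r\<close>, and the exponential condition on \<open>n lam\<^sup>2\<close> makes its contribution negligible.
\<close>

section \<open>Finitely supported infinite matrices\<close>

text \<open>Three obstacles shape the argument. The constraint asks for exactly \<open>k\<close>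
  nonzero rows, so a plainly truncated direction may fail it: vanishing rows among the kept ones are
  padded, and the orthonormalising factor must be so close to the identity that no row is lost. The
  curvature inequality wants exactly orthonormal columns, while both competing pairs are normalised
  for the sample covariance only; writing that covariance as \<open>tp D * D\<close> and multiplying
  every factor by \<open>D\<close> gives exact orthonormality, so the comparison takes place in the
  sample geometry and the population enters only through the gradient. Uniform lower bounds come
  from the two diagonal blocks of the covariance, hence coercivity is applied to the rows and to the
  columns of the error separately. The residual correlations enter through the overlap of the
  estimator with the remaining directions; that overlap is controlled by the error itself, and a
  small \<open>c\<close> lets the curvature absorb it.\<close>

text \<open>
  Matrices of all sizes live in one type, a normed algebra without unit under the Frobenius norm, so
  that products carry no dimension side conditions. The matrix \<open>proj {..<n}\<close> plays the role of the
  identity of size \<open>n\<close>.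
\<close>

typedef fmat = "{f :: nat \<Rightarrow> nat \<Rightarrow> real. \<exists>N. \<forall>i j. N \<le> i \<or> N \<le> j \<longrightarrow> f i j = 0}"
  morphisms ent Abs_fmat
  by (rule exI[of _ "\<lambda>_ _. 0"]) auto

definition corner :: "nat \<Rightarrow> fmat \<Rightarrow> bool" where
  "corner N A \<longleftrightarrow> (\<forall>i j. N \<le> i \<or> N \<le> j \<longrightarrow> ent A i j = 0)"

lemma corner_ex: "\<exists>N. corner N A"
  using ent[of A] by (auto simp: corner_def)

lemma corner_mono: "corner N A \<Longrightarrow> N \<le> N' \<Longrightarrow> corner N' A"
  by (auto simp: corner_def)

definition fdim :: "fmat \<Rightarrow> nat" where "fdim A = (LEAST N. corner N A)"

lemma corner_fdim: "corner (fdim A) A"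
  unfolding fdim_def using corner_ex by (rule LeastI_ex)

lemma fdim_le: "corner N A \<Longrightarrow> fdim A \<le> N"
  unfolding fdim_def by (rule Least_le)

lemma corner_iff: "corner N A \<longleftrightarrow> fdim A \<le> N"
  using corner_fdim corner_mono fdim_le by blast

lemma ent_zero: "corner N A \<Longrightarrow> N \<le> i \<or> N \<le> j \<Longrightarrow> ent A i j = 0"
  by (auto simp: corner_def)

lemma corner_nz1: "corner N A \<Longrightarrow> ent A i j \<noteq> 0 \<Longrightarrow> i < N"
  and corner_nz2: "corner N A \<Longrightarrow> ent A i j \<noteq> 0 \<Longrightarrow> j < N"
  using ent_zero[of N A i j] not_less by blast+

lemma fmat_eqI: "(\<And>i j. ent A i j = ent B i j) \<Longrightarrow> A = B"
  by (simp add: ent_inject[symmetric] fun_eq_iff)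

lemma fmat_eq_iff: "A = B \<longleftrightarrow> (\<forall>i j. ent A i j = ent B i j)"
  using fmat_eqI by blast

text \<open>Cutting \<open>f\<close> off outside a square keeps the result in the type whatever
  \<open>f\<close> is, so later definitions carry no proof of finite support.\<close>

definition mk :: "nat \<Rightarrow> (nat \<Rightarrow> nat \<Rightarrow> real) \<Rightarrow> fmat" where
  "mk N f = Abs_fmat (\<lambda>i j. if i < N \<and> j < N then f i j else 0)"

lemma ent_mk: "ent (mk N f) i j = (if i < N \<and> j < N then f i j else 0)"
proof -
  have "(\<lambda>i j. if i < N \<and> j < N then f i j else 0) \<in> {f :: nat \<Rightarrow> nat \<Rightarrow> real. \<exists>N. \<forall>i j. N \<le> i \<or> N \<le> j \<longrightarrow> f i j = 0}"
    by (auto intro!: exI[of _ N])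
  then show ?thesis unfolding mk_def by (simp add: Abs_fmat_inverse)
qed

lemma corner_mk: "corner N (mk N f)"
  by (auto simp: corner_def ent_mk)

lemma mk_eqI: "(\<And>i j. i < N \<Longrightarrow> j < N \<Longrightarrow> f i j = g i j) \<Longrightarrow> mk N f = mk N g"
  by (rule fmat_eqI) (auto simp: ent_mk)

instantiation fmat :: "{zero, plus, minus, uminus, times, scaleR}"
begin
definition "zero_fmat = mk 0 (\<lambda>_ _. 0)"
definition "plus_fmat A B = mk (max (fdim A) (fdim B)) (\<lambda>i j. ent A i j + ent B i j)"
definition "minus_fmat A B = mk (max (fdim A) (fdim B)) (\<lambda>i j. ent A i j - ent B i j)"
definition "uminus_fmat A = mk (fdim A) (\<lambda>i j. - ent A i j)"
definition "times_fmat A B = mk (max (fdim A) (fdim B))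
  (\<lambda>i j. \<Sum>l<max (fdim A) (fdim B). ent A i l * ent B l j)"
definition "scaleR_fmat c A = mk (fdim A) (\<lambda>i j. c * ent A i j)"
instance ..
end

lemma ent_add [simp]: "ent (A + B) i j = ent A i j + ent B i j"
  using corner_fdim[of A] corner_fdim[of B]
  by (auto simp: plus_fmat_def ent_mk corner_def)

lemma ent_diff [simp]: "ent (A - B) i j = ent A i j - ent B i j"
  using corner_fdim[of A] corner_fdim[of B]
  by (auto simp: minus_fmat_def ent_mk corner_def)

lemma ent_uminus [simp]: "ent (- A) i j = - ent A i j"
  using corner_fdim[of A] by (auto simp: uminus_fmat_def ent_mk corner_def)

lemma ent_scale [simp]: "ent (c *\<^sub>R A) i j = c * ent A i j"
  using corner_fdim[of A] by (auto simp: scaleR_fmat_def ent_mk corner_def)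

lemma ent_0 [simp]: "ent 0 i j = 0"
  by (simp add: zero_fmat_def ent_mk)

lemma sum_ent_left:
  assumes "corner N A"
  shows "(\<Sum>l<N. ent A i l * f l) = (\<Sum>l<fdim A. ent A i l * f l)"
  using fdim_le[OF assms] corner_fdim[of A]
  by (intro sum.mono_neutral_right) (auto simp: corner_def)

lemma sum_ent_right:
  assumes "corner N B"
  shows "(\<Sum>l<N. f l * ent B l j) = (\<Sum>l<fdim B. f l * ent B l j)"
  using fdim_le[OF assms] corner_fdim[of B]
  by (intro sum.mono_neutral_right) (auto simp: corner_def)

lemma ent_mult: "ent (A * B) i j = (\<Sum>l<fdim A. ent A i l * ent B l j)"
proof -
  let ?N = "max (fdim A) (fdim B)"
  have wA: "corner ?N A" and wB: "corner ?N B" by (auto simp: corner_iff)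
  have "ent (A * B) i j = (\<Sum>l<?N. ent A i l * ent B l j)"
    using ent_zero[OF wA] ent_zero[OF wB] by (auto simp: times_fmat_def ent_mk not_less)
  then show ?thesis using sum_ent_left[OF wA] by metis
qed

lemma ent_mult_corner:
  assumes "corner N A \<or> corner N B"
  shows "ent (A * B) i j = (\<Sum>l<N. ent A i l * ent B l j)"
proof -
  let ?M = "max N (max (fdim A) (fdim B))"
  have wA: "corner ?M A" and wB: "corner ?M B" by (auto simp: corner_iff)
  have "ent (A * B) i j = (\<Sum>l<?M. ent A i l * ent B l j)"
    unfolding ent_mult using sum_ent_left[OF wA] by metis
  also have "\<dots> = (\<Sum>l<N. ent A i l * ent B l j)"
    using assms sum_ent_left[OF wA] sum_ent_right[OF wB] sum_ent_left[of N A] sum_ent_right[of N B] by metis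
  finally show ?thesis .
qed

definition frob_inner :: "fmat \<Rightarrow> fmat \<Rightarrow> real" where
  "frob_inner A B = (\<Sum>i<fdim A. \<Sum>j<fdim A. ent A i j * ent B i j)"

lemma frob_inner_corner:
  assumes "corner N A \<or> corner N B"
  shows "frob_inner A B = (\<Sum>i<N. \<Sum>j<N. ent A i j * ent B i j)"
proof -
  have *: "frob_inner A B = (\<Sum>i<M. \<Sum>j<M. ent A i j * ent B i j)" if "corner M A" for M
  proof -
    have "i < fdim A" "j < fdim A" if "ent A i j \<noteq> 0" for i j
      using ent_zero[OF corner_fdim, of A i j] that not_less by blast+
    then show ?thesis
      unfolding frob_inner_def sum.cartesian_product using fdim_le[OF that]
      by (intro sum.mono_neutral_left) auto
  qed
  let ?M = "max N (max (fdim A) (fdim B))"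
  have wA: "corner ?M A" and wB: "corner ?M B" by (auto simp: corner_iff)
  have "(\<Sum>i<?M. \<Sum>j<?M. ent A i j * ent B i j) = (\<Sum>i<N. \<Sum>j<N. ent A i j * ent B i j)"
    unfolding sum.cartesian_product using assms
    by (intro sum.mono_neutral_right) (auto dest: corner_nz1 corner_nz2)
  with *[OF wA] show ?thesis by simp
qed

lemma corner_add: "corner N A \<Longrightarrow> corner N B \<Longrightarrow> corner N (A + B)"
  by (simp add: corner_def)
lemma corner_scale: "corner N A \<Longrightarrow> corner N (c *\<^sub>R A)"
  by (simp add: corner_def)
lemma corner_mult: "corner N A \<Longrightarrow> corner N B \<Longrightarrow> corner N (A * B)"
  unfolding corner_def ent_mult by (auto intro!: sum.neutral)

instantiation fmat :: real_inner
begin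
definition "inner_fmat = frob_inner"
definition norm_fmat :: "fmat \<Rightarrow> real" where "norm_fmat A = sqrt (inner A A)"
definition dist_fmat :: "fmat \<Rightarrow> fmat \<Rightarrow> real" where "dist_fmat A B = norm (A - B)"
definition sgn_fmat :: "fmat \<Rightarrow> fmat" where "sgn_fmat A = inverse (norm A) *\<^sub>R A"
definition uniformity_fmat :: "(fmat \<times> fmat) filter" where
  "uniformity_fmat = (INF e\<in>{0 <..}. principal {(x, y). dist x y < e})"
definition open_fmat :: "fmat set \<Rightarrow> bool" where
  "open_fmat U = (\<forall>x\<in>U. eventually (\<lambda>(x', y). x' = x \<longrightarrow> y \<in> U) uniformity)"
instance
proof
  fix x y z :: fmat and r s :: real
  show "dist x y = norm (x - y)" by (rule dist_fmat_def)
  show "sgn x = inverse (norm x) *\<^sub>R x" by (rule sgn_fmat_def)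
  show "(uniformity :: (fmat \<times> fmat) filter) = (INF e\<in>{0 <..}. principal {(x, y). dist x y < e})"
    by (rule uniformity_fmat_def)
  show "open U = (\<forall>x\<in>U. eventually (\<lambda>(x', y). x' = x \<longrightarrow> y \<in> U) uniformity)" for U :: "fmat set"
    by (rule open_fmat_def)
  show "norm x = sqrt (inner x x)" by (rule norm_fmat_def)
  let ?N = "max (fdim x) (max (fdim y) (fdim z))"
  have w: "corner ?N x" "corner ?N y" "corner ?N z" by (auto simp: corner_iff)
  show "inner x y = inner y x"
    using w by (simp add: inner_fmat_def frob_inner_corner[where N = ?N] mult.commute)
  show "inner (x + y) z = inner x z + inner y z"
    using w by (simp add: inner_fmat_def frob_inner_corner[where N = ?N] algebra_simps sum.distrib)
  show "inner (r *\<^sub>R x) y = r * inner x y"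
    using w by (simp add: inner_fmat_def frob_inner_corner[where N = ?N] algebra_simps sum_distrib_left)
  show "0 \<le> inner x x" unfolding inner_fmat_def frob_inner_def by (intro sum_nonneg) auto
  show "(inner x x = 0) = (x = 0)"
  proof
    assume "inner x x = 0"
    then have "(\<Sum>ij\<in>{..<?N}\<times>{..<?N}. ent x (fst ij) (snd ij) * ent x (fst ij) (snd ij)) = 0"
      using w by (simp add: inner_fmat_def frob_inner_corner[where N = ?N] sum.cartesian_product split_def)
    then have "\<forall>ij\<in>{..<?N}\<times>{..<?N}. ent x (fst ij) (snd ij) * ent x (fst ij) (snd ij) = 0"
      by (subst (asm) sum_nonneg_eq_0_iff) auto
    then have z: "ent x i j = 0" if "i < ?N" "j < ?N" for i j
      using that by force
    show "x = 0"
    proof (rule fmat_eqI)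
      fix i j show "ent x i j = ent 0 i j"
        using z[of i j] ent_zero[OF w(1), of i j] by (cases "i < ?N \<and> j < ?N") (auto simp: not_less)
    qed
  qed (simp add: inner_fmat_def frob_inner_def)
qed (rule fmat_eqI, simp add: algebra_simps)+
end

lemmas inner_corner = frob_inner_corner[folded inner_fmat_def]

lemma mult_assoc_fmat: "(A * B) * C = A * (B * (C :: fmat))"
proof (rule fmat_eqI)
  fix i j
  let ?N = "max (fdim A) (max (fdim B) (fdim C))"
  have w: "corner ?N A" "corner ?N B" "corner ?N C" by (auto simp: corner_iff)
  have wAB: "corner ?N (A * B)" by (intro corner_mult w)
  have "ent ((A * B) * C) i j = (\<Sum>l<?N. (\<Sum>k<?N. ent A i k * ent B k l) * ent C l j)"
    using w wAB by (simp add: ent_mult_corner[where N = ?N])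
  also have "\<dots> = (\<Sum>k<?N. ent A i k * (\<Sum>l<?N. ent B k l * ent C l j))"
    unfolding sum_distrib_left sum_distrib_right by (subst sum.swap) (simp add: mult.assoc)
  also have "\<dots> = ent (A * (B * C)) i j"
    using w by (simp add: ent_mult_corner[where N = ?N])
  finally show "ent ((A * B) * C) i j = ent (A * (B * C)) i j" .
qed

instance fmat :: real_normed_algebra
proof
  fix a b c :: fmat and r :: real
  show "(a * b) * c = a * (b * c)" by (rule mult_assoc_fmat)
  let ?N = "max (fdim a) (max (fdim b) (fdim c))"
  have w: "corner ?N a" "corner ?N b" "corner ?N c" by (auto simp: corner_iff)
  show "(a + b) * c = a * c + b * c"
    by (rule fmat_eqI) (use w in \<open>simp add: ent_mult_corner[where N = ?N] corner_add algebra_simps sum.distrib\<close>)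
  show "a * (b + c) = a * b + a * c"
    by (rule fmat_eqI) (use w in \<open>simp add: ent_mult_corner[where N = ?N] corner_add algebra_simps sum.distrib\<close>)
  show "(r *\<^sub>R a) * b = r *\<^sub>R (a * b)"
    by (rule fmat_eqI) (use w in \<open>simp add: ent_mult_corner[where N = ?N] corner_scale algebra_simps sum_distrib_left\<close>)
  show "a * (r *\<^sub>R b) = r *\<^sub>R (a * b)"
    by (rule fmat_eqI) (use w in \<open>simp add: ent_mult_corner[where N = ?N] corner_scale algebra_simps sum_distrib_left\<close>)
  have "inner (a * b) (a * b) = (\<Sum>i<?N. \<Sum>j<?N. (\<Sum>l<?N. ent a i l * ent b l j)\<^sup>2)"
    using w by (simp add: inner_corner[where N = ?N] corner_mult ent_mult_corner[where N = ?N] power2_eq_square)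
  also have "\<dots> \<le> (\<Sum>i<?N. \<Sum>j<?N. (\<Sum>l<?N. (ent a i l)\<^sup>2) * (\<Sum>l<?N. (ent b l j)\<^sup>2))"
    by (intro sum_mono Cauchy_Schwarz_ineq_sum)
  also have "\<dots> = (\<Sum>i<?N. \<Sum>l<?N. (ent a i l)\<^sup>2) * (\<Sum>j<?N. \<Sum>l<?N. (ent b l j)\<^sup>2)"
    by (simp add: sum_product)
  also have "(\<Sum>j<?N. \<Sum>l<?N. (ent b l j)\<^sup>2) = (\<Sum>l<?N. \<Sum>j<?N. (ent b l j)\<^sup>2)"
    by (rule sum.swap)
  finally have "inner (a * b) (a * b) \<le> inner a a * inner b b"
    using w by (simp add: inner_corner[where N = ?N] power2_eq_square)
  then show "norm (a * b) \<le> norm a * norm b"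
    unfolding norm_eq_sqrt_inner by (simp add: real_sqrt_mult[symmetric])
qed

section \<open>Transposition and adjoints\<close>

definition tp :: "fmat \<Rightarrow> fmat" where "tp A = mk (fdim A) (\<lambda>i j. ent A j i)"

lemma ent_tp [simp]: "ent (tp A) i j = ent A j i"
  using corner_fdim[of A] by (auto simp: tp_def ent_mk corner_def)

lemma corner_tp [simp]: "corner N (tp A) \<longleftrightarrow> corner N A"
  by (auto simp: corner_def)

lemma tp_tp [simp]: "tp (tp A) = A" by (rule fmat_eqI) simp
lemma tp_add [simp]: "tp (A + B) = tp A + tp B" by (rule fmat_eqI) simp
lemma tp_diff [simp]: "tp (A - B) = tp A - tp B" by (rule fmat_eqI) simp
lemma tp_scale [simp]: "tp (c *\<^sub>R A) = c *\<^sub>R tp A" by (rule fmat_eqI) simp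
lemma tp_0 [simp]: "tp 0 = 0" by (rule fmat_eqI) simp

lemma tp_mult [simp]: "tp (A * B) = tp B * tp A"
proof (rule fmat_eqI)
  fix i j
  let ?N = "max (fdim A) (fdim B)"
  have w: "corner ?N A" "corner ?N B" by (auto simp: corner_iff)
  show "ent (tp (A * B)) i j = ent (tp B * tp A) i j"
    using w by (simp add: ent_mult_corner[where N = ?N] mult.commute)
qed

lemma inner_tp: "inner (tp A) (tp B) = inner A B"
proof -
  let ?N = "max (fdim A) (fdim B)"
  have w: "corner ?N A" "corner ?N B" by (auto simp: corner_iff)
  then have "inner (tp A) (tp B) = (\<Sum>i<?N. \<Sum>j<?N. ent A j i * ent B j i)"
    by (simp add: inner_corner[where N = ?N])
  also have "\<dots> = (\<Sum>j<?N. \<Sum>i<?N. ent A j i * ent B j i)" by (rule sum.swap)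
  finally show ?thesis using w by (simp add: inner_corner[where N = ?N])
qed

lemma norm_tp [simp]: "norm (tp A) = norm A"
  by (simp add: norm_eq_sqrt_inner inner_tp)

text \<open>The inner product is the trace of \<open>tp A * B\<close>; moving a factor across it as
  its transpose takes the place of the cyclic property of the trace throughout.\<close>

lemma inner_mult_left: "inner (A * B) C = inner B (tp A * C)"
proof -
  let ?N = "max (fdim A) (max (fdim B) (fdim C))"
  have w: "corner ?N A" "corner ?N B" "corner ?N C" by (auto simp: corner_iff)
  have "inner (A * B) C = (\<Sum>i<?N. \<Sum>j<?N. \<Sum>l<?N. ent A i l * ent B l j * ent C i j)"
    using w by (simp add: inner_corner[where N = ?N] ent_mult_corner[where N = ?N] sum_distrib_right)
  also have "\<dots> = (\<Sum>i<?N. \<Sum>l<?N. \<Sum>j<?N. ent A i l * ent B l j * ent C i j)"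
    by (intro sum.cong refl sum.swap)
  also have "\<dots> = (\<Sum>l<?N. \<Sum>i<?N. \<Sum>j<?N. ent A i l * ent B l j * ent C i j)"
    by (rule sum.swap)
  also have "\<dots> = (\<Sum>l<?N. \<Sum>j<?N. \<Sum>i<?N. ent A i l * ent B l j * ent C i j)"
    by (intro sum.cong refl sum.swap)
  also have "\<dots> = inner B (tp A * C)"
    using w by (simp add: inner_corner[where N = ?N] ent_mult_corner[where N = ?N] sum_distrib_left mult_ac)
  finally show ?thesis .
qed

lemma inner_mult_right: "inner (A * B) C = inner A (C * tp B)"
  by (metis inner_mult_left inner_tp tp_mult tp_tp)

lemma norm_power2_inner: "(norm A)\<^sup>2 = inner A (A :: fmat)"
  by (simp add: power2_norm_eq_inner)

section \<open>Diagonal matrices and coordinate projections\<close>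

definition diagm :: "nat \<Rightarrow> (nat \<Rightarrow> real) \<Rightarrow> fmat" where
  "diagm N d = mk N (\<lambda>i j. if i = j then d i else 0)"

lemma ent_diagm [simp]: "ent (diagm N d) i j = (if i = j \<and> i < N then d i else 0)"
  by (auto simp: diagm_def ent_mk)

lemma corner_diagm: "corner N (diagm N d)"
  by (auto simp: corner_def)

lemma tp_diagm [simp]: "tp (diagm N d) = diagm N d"
  by (rule fmat_eqI) auto

lemma ent_diagm_mult: "ent (diagm N d * A) i j = (if i < N then d i * ent A i j else 0)"
proof -
  have "ent (diagm N d * A) i j = (\<Sum>l<N. ent (diagm N d) i l * ent A l j)"
    by (rule ent_mult_corner) (simp add: corner_diagm)
  also have "\<dots> = (\<Sum>l<N. if i = l then (if i < N then d i * ent A i j else 0) else 0)"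
    by (intro sum.cong) auto
  finally show ?thesis by simp
qed

lemma diagm_mult_diagm: "diagm N d * diagm N e = diagm N (\<lambda>i. d i * e i)"
  by (rule fmat_eqI) (simp add: ent_diagm_mult)

text \<open>An infinite set yields the zero matrix, which keeps \<open>tp_proj\<close> free of a
  finiteness hypothesis.\<close>

definition proj :: "nat set \<Rightarrow> fmat" where
  "proj S = mk (if finite S then Suc (Max (insert 0 S)) else 0) (\<lambda>i j. if i = j \<and> i \<in> S then 1 else 0)"

lemma ent_proj [simp]: "finite S \<Longrightarrow> ent (proj S) i j = (if i = j \<and> i \<in> S then 1 else 0)"
  by (auto simp: proj_def ent_mk less_Suc_eq_le)

lemma proj_diagm:
  assumes "finite S" "\<And>i. i \<in> S \<Longrightarrow> i < N"
  shows "proj S = diagm N (\<lambda>i. if i \<in> S then 1 else 0)"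
  using assms by (intro fmat_eqI) auto

lemma ent_proj_mult: "finite S \<Longrightarrow> ent (proj S * A) i j = (if i \<in> S then ent A i j else 0)"
  by (subst proj_diagm[where N = "Suc (Max (insert 0 S))"])
    (auto simp: ent_diagm_mult less_Suc_eq_le)

lemma tp_proj [simp]: "tp (proj S) = proj S"
  by (rule fmat_eqI) (auto simp: proj_def ent_mk)

lemma ent_mult_proj: "finite S \<Longrightarrow> ent (A * proj S) i j = (if j \<in> S then ent A i j else 0)"
  using ent_proj_mult[of S "tp A" j i] ent_tp[of "A * proj S" j i] by (auto split: if_splits)

lemma proj_mult_proj: "finite S \<Longrightarrow> finite T \<Longrightarrow> proj S * proj T = proj (S \<inter> T)"
  by (rule fmat_eqI) (auto simp: ent_proj_mult)

lemma proj_idem [simp]: "finite S \<Longrightarrow> proj S * proj S = proj S"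
  by (simp add: proj_mult_proj)

lemma proj_idem_left [simp]: "finite S \<Longrightarrow> proj S * (proj S * A) = proj S * A"
  by (simp add: mult.assoc[symmetric])

lemma proj_fix_iff: "finite S \<Longrightarrow> proj S * A = A \<longleftrightarrow> (\<forall>i j. i \<notin> S \<longrightarrow> ent A i j = 0)"
  by (auto simp: fmat_eq_iff ent_proj_mult)

lemma fix_proj_iff: "finite S \<Longrightarrow> A * proj S = A \<longleftrightarrow> (\<forall>i j. j \<notin> S \<longrightarrow> ent A i j = 0)"
  by (auto simp: fmat_eq_iff ent_mult_proj)

lemma norm_proj_le: "finite S \<Longrightarrow> norm (proj S * A) \<le> norm A"
proof -
  assume fin: "finite S"
  have "(norm (proj S * A))\<^sup>2 = inner A (proj S * A)"
    using fin by (simp add: norm_power2_inner inner_mult_left)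
  also have "\<dots> \<le> norm A * norm (proj S * A)" by (rule norm_cauchy_schwarz)
  finally show ?thesis
    by (cases "norm (proj S * A) = 0") (auto simp: power2_eq_square mult_le_cancel_right)
qed

section \<open>Operator bounds\<close>

text \<open>An upper bound for the operator norm, tested on matrices under the Frobenius norm.
  Testing on vectors gives the same notion by \<open>opb_columns\<close>; this form chains through
  products and sums without a change of norm.\<close>

definition opb :: "fmat \<Rightarrow> real \<Rightarrow> bool" where
  "opb A c \<longleftrightarrow> 0 \<le> c \<and> (\<forall>X. norm (A * X) \<le> c * norm X)"

lemma opbD: "opb A c \<Longrightarrow> norm (A * X) \<le> c * norm X"
  by (simp add: opb_def)

lemma opb_nonneg: "opb A c \<Longrightarrow> 0 \<le> c"
  by (simp add: opb_def)

lemma opb_mono: "opb A c \<Longrightarrow> c \<le> d \<Longrightarrow> opb A d"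
  unfolding opb_def by (meson mult_right_mono norm_ge_zero order_trans)

lemma opb_norm: "opb A (norm A)"
  by (simp add: opb_def norm_mult_ineq)

lemma le_of_power2_le_mult: "a\<^sup>2 \<le> c * a \<Longrightarrow> 0 \<le> a \<Longrightarrow> 0 \<le> c \<Longrightarrow> a \<le> (c::real)"
  by (cases "a = 0") (auto simp: power2_eq_square)

text \<open>The squared norm of \<open>tp A * X\<close> is the inner product of \<open>X\<close>
  with \<open>A * (tp A * X)\<close>; Cauchy-Schwarz and the bound for \<open>A\<close> leave a
  common factor that cancels.\<close>

lemma opb_tp: assumes "opb A c" shows "opb (tp A) c"
proof -
  have "norm (tp A * X) \<le> c * norm X" for X
  proof -
    have "(norm (tp A * X))\<^sup>2 = inner X (A * (tp A * X))"
      using inner_mult_left[of "tp A" X "tp A * X"] by (simp add: norm_power2_inner)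
    also have "\<dots> \<le> norm X * norm (A * (tp A * X))" by (rule norm_cauchy_schwarz)
    also have "\<dots> \<le> norm X * (c * norm (tp A * X))"
      by (intro mult_left_mono opbD assms norm_ge_zero)
    also have "\<dots> = (c * norm X) * norm (tp A * X)" by (simp only: mult_ac)
    finally show ?thesis
      by (rule le_of_power2_le_mult) (simp_all add: opb_nonneg[OF assms])
  qed
  then show ?thesis using assms by (simp add: opb_def)
qed

lemma opbD2: "opb A c \<Longrightarrow> norm (X * A) \<le> c * norm X"
  using opbD[OF opb_tp, of A c "tp X"] norm_tp[of "X * A"] by simp

lemma opb_mult: "opb A c \<Longrightarrow> opb B d \<Longrightarrow> opb (A * B) (c * d)"
proof -
  assume A: "opb A c" and B: "opb B d"
  have "norm (A * B * X) \<le> c * d * norm X" for X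
  proof -
    have "norm (A * B * X) \<le> c * norm (B * X)" using opbD[OF A] by (simp add: mult.assoc)
    also have "\<dots> \<le> c * (d * norm X)" by (intro mult_left_mono opbD B opb_nonneg[OF A])
    finally show ?thesis by (simp add: mult.assoc)
  qed
  then show ?thesis using opb_nonneg[OF A] opb_nonneg[OF B] by (simp add: opb_def)
qed

lemma opb_add: "opb A c \<Longrightarrow> opb B d \<Longrightarrow> opb (A + B) (c + d)"
proof -
  assume A: "opb A c" and B: "opb B d"
  have "norm ((A + B) * X) \<le> (c + d) * norm X" for X
    using norm_triangle_ineq[of "A * X" "B * X"] opbD[OF A, of X] opbD[OF B, of X]
    by (simp add: distrib_right)
  then show ?thesis using opb_nonneg[OF A] opb_nonneg[OF B] by (simp add: opb_def)
qed

lemma opb_proj: "finite S \<Longrightarrow> opb (proj S) 1"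
  by (simp add: opb_def norm_proj_le)

lemma opb_diagm:
  assumes "\<And>i. i < N \<Longrightarrow> \<bar>d i\<bar> \<le> c" "0 \<le> c"
  shows "opb (diagm N d) c"
proof -
  have "norm (diagm N d * X) \<le> c * norm X" for X
  proof -
    let ?M = "max N (fdim X)"
    have w: "corner ?M X" "corner ?M (diagm N d)"
      using corner_mono[OF corner_fdim, of X ?M] corner_mono[OF corner_diagm, of N ?M d] by auto
    have sq: "(d i)\<^sup>2 \<le> c\<^sup>2" if "i < N" for i
      using assms that by (simp add: abs_le_square_iff[symmetric])
    have "(norm (diagm N d * X))\<^sup>2 = (\<Sum>i<?M. \<Sum>j<?M. (ent (diagm N d * X) i j)\<^sup>2)"
      unfolding norm_power2_inner by (subst inner_corner[where N = ?M]) (auto simp: power2_eq_square corner_mult w)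
    also have "\<dots> \<le> (\<Sum>i<?M. \<Sum>j<?M. c\<^sup>2 * (ent X i j)\<^sup>2)"
      by (intro sum_mono) (auto simp: ent_diagm_mult power_mult_distrib intro!: mult_right_mono sq)
    also have "\<dots> = c\<^sup>2 * (norm X)\<^sup>2"
      unfolding norm_power2_inner sum_distrib_left[symmetric] using w
      by (simp add: inner_corner[where N = ?M] power2_eq_square)
    finally show ?thesis using assms(2)
      by (simp add: power_mult_distrib[symmetric] abs_le_square_iff[symmetric])
  qed
  then show ?thesis using assms(2) by (simp add: opb_def)
qed

lemma opb_gram:
  assumes "c \<ge> 0" "\<And>X. inner (tp A * (A * X)) X \<le> c\<^sup>2 * (norm X)\<^sup>2"
  shows "opb A c"
proof -
  have "(norm (A * X))\<^sup>2 \<le> (c * norm X)\<^sup>2" for X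
    using assms(2)[of X] inner_mult_left[of "A" X "A * X"]
    by (simp add: norm_power2_inner power_mult_distrib inner_commute)
  then show ?thesis using assms(1) unfolding opb_def
    by (meson mult_nonneg_nonneg norm_ge_zero power2_le_imp_le)
qed

lemma opb_orthonormal:
  assumes "finite S" "tp P * P = proj S"
  shows "opb P 1"
proof (rule opb_gram)
  fix X
  have "inner (tp P * (P * X)) X = inner (proj S * X) X"
    using assms(2) by (simp add: mult.assoc[symmetric])
  also have "\<dots> \<le> norm (proj S * X) * norm X" by (rule norm_cauchy_schwarz)
  also have "\<dots> \<le> norm X * norm X" by (intro mult_right_mono norm_proj_le assms norm_ge_zero)
  finally show "inner (tp P * (P * X)) X \<le> 1\<^sup>2 * (norm X)\<^sup>2" by (simp add: power2_eq_square)
qed simp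

text \<open>Splitting \<open>L = lam J + N N\<close>, the first part gives exactly the lower bound, and the second
  contributes a nonnegative amount by Cauchy-Schwarz.\<close>
lemma curvature:
  assumes J: "finite S" "J = proj S"
    and p: "tp p * p = J" and q: "tp q * q = J" and p': "tp p' * p' = J" and q': "tp q' * q' = J"
    and pJ: "p * J = p" and N: "tp N = N" and L: "L = lam *\<^sub>R J + N * N" and lam: "0 \<le> lam"
    and JN: "J * N = N"
  shows "lam / 2 * (norm (p * tp q - p' * tp q'))\<^sup>2 \<le> inner (p * L * tp q) (p * tp q - p' * tp q')"
proof -
  have ob: "opb p 1" "opb q 1" "opb p' 1" "opb q' 1"
    using opb_orthonormal[OF J(1)] p q p' q' J(2) by auto
  have nJ: "norm (a * tp b) = norm J" if "tp a * a = J" "tp b * b = J" for a b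
  proof -
    have "inner (a * tp b) (a * tp b) = inner (tp b) (J * tp b)"
      using that by (simp add: inner_mult_left mult.assoc[symmetric])
    also have "\<dots> = inner (tp b * b) J"
      using inner_mult_right[of J "tp b" "tp b"] by (simp add: inner_commute)
    also have "\<dots> = inner J J" using that by simp
    finally show ?thesis by (simp add: norm_eq_sqrt_inner)
  qed
  have pr: "p * L * tp q = lam *\<^sub>R (p * tp q) + p * N * N * tp q"
    unfolding L using pJ by (simp add: algebra_simps)
  let ?a = "p * tp q" and ?b = "p' * tp q'"
  \<comment> \<open>Both products have the norm of \<open>J\<close>, so
    \<open>inner ?a (?a - ?b)\<close> is exactly half the squared distance.\<close>
  have first: "lam * inner ?a (?a - ?b) = lam / 2 * (norm (?a - ?b))\<^sup>2"
  proof -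
    have "inner ?a ?a = inner ?b ?b"
      using nJ[OF p q] nJ[OF p' q'] by (simp add: norm_eq_sqrt_inner)
    then have "(norm (?a - ?b))\<^sup>2 = 2 * inner ?a (?a - ?b)"
      by (simp add: norm_power2_inner inner_diff inner_commute)
    then show ?thesis by simp
  qed
  have a1: "inner (p * N * N * tp q) ?a = inner N N"
  proof -
    have "inner (p * N * N * tp q) ?a = inner (N * N * tp q) (J * tp q)"
      using inner_mult_left[of p "N * N * tp q" ?a] p by (simp add: mult.assoc[symmetric])
    also have "\<dots> = inner (N * N * J) J"
      using inner_mult_right[of J "tp q" "N * N * tp q"] q by (simp add: inner_commute mult.assoc)
    also have "N * N * J = N * N"
    proof -
      have "N * J = tp (J * N)" using N J by simp
      then show ?thesis using JN N by (simp add: mult.assoc)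
    qed
    also have "inner (N * N) J = inner N (N * J)" using inner_mult_left[of N N J] N by simp
    also have "N * J = tp (J * N)" using N J by simp
    finally show ?thesis using JN N by simp
  qed
  \<comment> \<open>Multiplying \<open>N\<close> by the contractions \<open>tp p' * p\<close> and
    \<open>tp q * q'\<close> does not increase its norm.\<close>
  have a2: "inner (p * N * N * tp q) ?b \<le> inner N N"
  proof -
    have "inner (p * N * N * tp q) ?b = inner ((tp p' * p * N) * (N * tp q)) (tp q')"
      using inner_mult_left[of "p'" "tp q'" "p * N * N * tp q"] by (simp add: inner_commute mult.assoc)
    also have "\<dots> = inner (N * tp q) (tp (tp p' * p * N) * tp q')"
      by (rule inner_mult_left)
    also have "\<dots> = inner (N * tp q * q') (tp (tp p' * p * N))"
      using inner_mult_right[of "tp (tp p' * p * N)" "tp q'" "N * tp q"] by (simp add: inner_commute)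
    also have "\<dots> \<le> norm (N * tp q * q') * norm (tp (tp p' * p * N))" by (rule norm_cauchy_schwarz)
    also have "\<dots> \<le> norm N * norm N"
    proof (intro mult_mono)
      show "norm (N * tp q * q') \<le> norm N"
        using opbD2[OF ob(4), of "N * tp q"] opbD2[OF opb_tp[OF ob(2)], of N] by simp
      have "norm (tp p' * (p * N)) \<le> norm N"
        using opbD[OF opb_tp[OF ob(3)], of "p * N"] opbD[OF ob(1), of N] by simp
      then show "norm (tp (tp p' * p * N)) \<le> norm N" unfolding norm_tp by (simp add: mult.assoc)
    qed auto
    finally show ?thesis by (simp add: norm_power2_inner[symmetric] power2_eq_square)
  qed
  have "inner (p * L * tp q) (?a - ?b) = lam * inner ?a (?a - ?b) + (inner (p * N * N * tp q) ?a - inner (p * N * N * tp q) ?b)"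
    unfolding pr by (simp add: inner_add_left inner_diff_right right_diff_distrib)
  with first a1 a2 show ?thesis by linarith
qed

section \<open>Unit matrices and reduction to columns\<close>

definition unitm :: "nat \<Rightarrow> nat \<Rightarrow> fmat" where
  "unitm a b = mk (Suc (max a b)) (\<lambda>i j. if i = a \<and> j = b then 1 else 0)"

lemma ent_unitm [simp]: "ent (unitm a b) i j = (if i = a \<and> j = b then 1 else 0)"
  by (auto simp: unitm_def ent_mk)

lemma tp_unitm [simp]: "tp (unitm a b) = unitm b a"
  by (rule fmat_eqI) auto

lemma ent_mult_unitm: "ent (A * unitm a b) i j = (if j = b then ent A i a else 0)"
proof -
  have "corner (Suc (max a b)) (unitm a b)" by (auto simp: corner_def)
  then have "ent (A * unitm a b) i j = (\<Sum>l<Suc (max a b). ent A i l * ent (unitm a b) l j)"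
    by (intro ent_mult_corner) simp
  also have "\<dots> = (\<Sum>l<Suc (max a b). if l = a then (if j = b then ent A i a else 0) else 0)"
    by (intro sum.cong) auto
  finally show ?thesis by simp
qed

lemma ent_unitm_mult: "ent (unitm a b * A) i j = (if i = a then ent A b j else 0)"
  using ent_mult_unitm[of "tp A" b a j i] ent_tp[of "unitm a b * A" j i] by (auto split: if_splits)

lemma norm_power2_ent: "corner N A \<Longrightarrow> (norm A)\<^sup>2 = (\<Sum>i<N. \<Sum>j<N. (ent A i j)\<^sup>2)"
  by (subst norm_power2_inner, subst inner_corner[where N = N]) (auto simp: power2_eq_square)

lemma norm_le_ent:
  assumes "\<And>i j. \<bar>ent A i j\<bar> \<le> \<bar>ent B i j\<bar>"
  shows "norm A \<le> norm B"
proof -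
  have w: "corner (fdim B) A"
    using assms ent_zero[OF corner_fdim, of B] unfolding corner_def by (metis abs_le_zero_iff abs_zero)
  have "(norm A)\<^sup>2 \<le> (norm B)\<^sup>2"
    unfolding norm_power2_ent[OF w] norm_power2_ent[OF corner_fdim[of B]]
    by (intro sum_mono) (use assms in \<open>simp add: abs_le_square_iff[symmetric]\<close>)
  then show ?thesis by simp
qed

text \<open>Each column is moved to column 0, the place where vectors live.\<close>

lemma norm_columns:
  assumes "corner N X"
  shows "(norm X)\<^sup>2 = (\<Sum>j<N. (norm (X * unitm j 0))\<^sup>2)"
proof -
  let ?M = "Suc N"
  have w: "corner ?M X" using assms corner_mono by (meson le_SucI order_refl)
  have "(norm (X * unitm j 0))\<^sup>2 = (\<Sum>i<?M. (ent X i j)\<^sup>2)" for j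
  proof -
    have "corner ?M (X * unitm j 0)" using w by (auto simp: corner_def ent_mult_unitm)
    then have "(norm (X * unitm j 0))\<^sup>2 = (\<Sum>i<?M. \<Sum>l<?M. (ent (X * unitm j 0) i l)\<^sup>2)"
      by (rule norm_power2_ent)
    also have "\<dots> = (\<Sum>i<?M. \<Sum>l<?M. if l = 0 then (ent X i j)\<^sup>2 else 0)"
      by (intro sum.cong) (auto simp: ent_mult_unitm)
    finally show ?thesis by simp
  qed
  then have "(\<Sum>j<N. (norm (X * unitm j 0))\<^sup>2) = (\<Sum>j<?M. \<Sum>i<?M. (ent X i j)\<^sup>2)"
    using ent_zero[OF assms] by simp
  also have "\<dots> = (\<Sum>i<?M. \<Sum>j<?M. (ent X i j)\<^sup>2)" by (rule sum.swap)
  finally show ?thesis using norm_power2_ent[OF w] by simp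
qed

lemma opb_columns:
  assumes c: "0 \<le> c" and col: "\<And>x. x * proj {0} = x \<Longrightarrow> norm (A * x) \<le> c * norm x"
  shows "opb A c"
proof -
  have "norm (A * X) \<le> c * norm X" for X
  proof -
    let ?N = "max (fdim A) (fdim X)"
    have "corner ?N A" and w0: "corner ?N X" by (auto simp: corner_iff)
    note w = w0 corner_mult[OF this]
    have 0: "X * unitm j 0 * proj {0} = X * unitm j 0" for j
      by (auto simp: fix_proj_iff ent_mult_unitm)
    have "(norm (A * X))\<^sup>2 = (\<Sum>j<?N. (norm (A * (X * unitm j 0)))\<^sup>2)"
      using norm_columns[OF w(2)] by (simp add: mult.assoc)
    also have "\<dots> \<le> (\<Sum>j<?N. c\<^sup>2 * (norm (X * unitm j 0))\<^sup>2)"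
      unfolding power_mult_distrib[symmetric] by (intro sum_mono power_mono col 0 norm_ge_zero)
    also have "\<dots> = (c * norm X)\<^sup>2"
      by (simp add: sum_distrib_left[symmetric] norm_columns[OF w(1)] power_mult_distrib)
    finally show ?thesis using c by (simp add: abs_le_square_iff[symmetric])
  qed
  then show ?thesis using c by (simp add: opb_def)
qed

text \<open>The products \<open>A * tp B\<close> are the matrices of rank at most \<open>R\<close> with rows and columns in \<open>T\<close>.\<close>
definition sparse_small :: "nat set \<Rightarrow> nat \<Rightarrow> real \<Rightarrow> fmat \<Rightarrow> bool" where
  "sparse_small T R \<delta> W \<longleftrightarrow> (\<forall>A B. proj T * A = A \<longrightarrow> A * proj {..<R} = A \<longrightarrow>
     proj T * B = B \<longrightarrow> B * proj {..<R} = B \<longrightarrow> inner W (A * tp B) \<le> \<delta> * norm (A * tp B))"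

text \<open>\<open>W\<close> is tested against \<open>?X * tp A\<close>, which is admissible because
  \<open>A\<close> has \<open>R\<close> columns and whose inner product with \<open>W\<close> is the
  squared norm of \<open>?X\<close>. Only the operator bound of \<open>A\<close> enters, so the
  Frobenius norm picks up no factor \<open>sqrt R\<close>.\<close>

lemma sparse_small_frob:
  assumes T: "finite T" and g: "sparse_small T R \<delta> W" and d: "0 \<le> \<delta>"
    and A: "proj T * A = A" "A * proj {..<R} = A" "opb A a"
  shows "norm (proj T * W * A) \<le> \<delta> * a"
proof -
  let ?X = "proj T * W * A"
  have s: "proj T * ?X = ?X" "?X * proj {..<R} = ?X" using T A by (auto simp: mult.assoc)
  have "(norm ?X)\<^sup>2 = inner (W * A) ?X"
    using inner_mult_left[of "proj T" "W * A" ?X] s T by (simp add: norm_power2_inner mult.assoc)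
  also have "\<dots> = inner W (?X * tp A)" by (rule inner_mult_right)
  also have "\<dots> \<le> \<delta> * norm (?X * tp A)"
    using g s A unfolding sparse_small_def by blast
  also have "\<dots> \<le> \<delta> * (a * norm ?X)"
    by (intro mult_left_mono d opbD2 opb_tp A)
  also have "\<dots> = (\<delta> * a) * norm ?X" by (simp only: mult.assoc)
  finally show ?thesis
    by (rule le_of_power2_le_mult) (simp_all only: opb_nonneg[OF A(3)] d mult_nonneg_nonneg norm_ge_zero)
qed

lemma proj_subset_fix:
  "finite T \<Longrightarrow> S \<subseteq> T \<Longrightarrow> proj S * A = A \<Longrightarrow> proj T * A = A"
  by (subst (asm) proj_fix_iff) (auto simp: proj_fix_iff finite_subset)

lemma fix_proj_subset:
  "finite T \<Longrightarrow> S \<subseteq> T \<Longrightarrow> A * proj S = A \<Longrightarrow> A * proj T = A"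
  by (subst (asm) fix_proj_iff) (auto simp: fix_proj_iff finite_subset)

text \<open>A single column has rank one, which \<open>0 < R\<close> admits, so the Frobenius
  estimate taken column by column is an operator estimate.\<close>

lemma sparse_small_op:
  assumes T: "finite T" and g: "sparse_small T R \<delta> W" and d: "0 \<le> \<delta>" and R: "0 < R"
  shows "opb (proj T * W * proj T) \<delta>"
proof (rule opb_columns[OF d])
  fix x assume x: "x * proj {0} = x"
  let ?y = "proj T * x"
  have "?y * proj {0} = ?y" using x by (simp add: mult.assoc)
  then have "?y * proj {..<R} = ?y" by (rule fix_proj_subset[rotated 2]) (use R in auto)
  then have "norm (proj T * W * ?y) \<le> \<delta> * norm ?y"
    using T by (intro sparse_small_frob[OF T g d _ _ opb_norm]) auto
  also have "\<dots> \<le> \<delta> * norm x" by (intro mult_left_mono norm_proj_le T d)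
  finally show "norm (proj T * W * proj T * x) \<le> \<delta> * norm x" by (simp add: mult.assoc)
qed

lemma sparse_small_quad:
  assumes T: "finite T" and g: "sparse_small T R \<delta> W" and d: "0 \<le> \<delta>" and R: "0 < R"
    and X: "proj T * X = X"
  shows "\<bar>inner (W * X) X\<bar> \<le> \<delta> * (norm X)\<^sup>2"
proof -
  have "inner (W * X) X = inner (proj T * W * proj T * X) X"
    using X inner_mult_left[of "proj T" "W * X" X] by (simp add: mult.assoc)
  also have "\<bar>\<dots>\<bar> \<le> norm (proj T * W * proj T * X) * norm X" by (rule Cauchy_Schwarz_ineq2)
  also have "\<dots> \<le> \<delta> * norm X * norm X"
    by (intro mult_right_mono opbD sparse_small_op[OF T g d R] norm_ge_zero)
  finally show ?thesis by (simp add: power2_eq_square mult.assoc)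
qed

text \<open>The difference of two products of rank \<open>r\<close> is one product of rank
  \<open>2 * r\<close>, whose factors concatenate \<open>A\<close> with \<open>- A'\<close> and
  \<open>B\<close> with \<open>B'\<close>.\<close>

lemma sparse_small_diff:
  assumes T: "finite T" and g: "sparse_small T (2 * r) \<delta> W"
    and A: "proj T * A = A" "A * proj {..<r} = A" and B: "proj T * B = B" "B * proj {..<r} = B"
    and A': "proj T * A' = A'" "A' * proj {..<r} = A'" and B': "proj T * B' = B'" "B' * proj {..<r} = B'"
  shows "inner W (A * tp B - A' * tp B') \<le> \<delta> * norm (A * tp B - A' * tp B')"
proof -
  \<comment> \<open>\<open>s\<close> moves the first \<open>r\<close> columns to the positions from
    \<open>r\<close> to \<open>2 * r - 1\<close>.\<close>
  define s where "s = mk (2 * r) (\<lambda>i j. if i < r \<and> j = i + r then 1 else 0)"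
  let ?J = "proj {..<r}"
  have es: "ent s i j = (if i < r \<and> j = i + r then 1 else 0)" for i j
    by (auto simp: s_def ent_mk)
  have ws: "corner (2 * r) s" by (simp add: s_def corner_mk)
  have ss: "s * tp s = ?J"
  proof (rule fmat_eqI)
    fix i j
    have "ent (s * tp s) i j = (\<Sum>l<2*r. if l = i + r then (if i = j \<and> i < r then 1 else 0) else 0)"
      unfolding ent_mult_corner[OF disjI1[OF ws]] by (intro sum.cong) (auto simp: es)
    then show "ent (s * tp s) i j = ent ?J i j" by auto
  qed
  have Js: "?J * tp s = 0"
    by (rule fmat_eqI) (auto simp: ent_proj_mult es)
  have "s * ?J = tp (?J * tp s)" by simp
  with Js have sJ: "s * ?J = 0" by simp
  have s2: "s * proj {..<2*r} = s"
    by (auto simp: fix_proj_iff es)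
  have J2: "?J * proj {..<2*r} = ?J"
    by (auto simp: fix_proj_iff)
  let ?a = "A - A' * s" and ?b = "B + B' * s"
  have fix1: "A * proj {..<2*r} = A" "B * proj {..<2*r} = B"
    using fix_proj_subset[of "{..<2*r}" "{..<r}"] A B by auto
  have AJ: "A * (?J * X) = A * X" "A' * (?J * X) = A' * X" for X
    using A A' by (simp_all add: mult.assoc[symmetric])
  have Bs: "s * tp B = 0"
    using sJ B(2) by (metis mult.assoc mult_zero_left tp_mult tp_proj)
  have As: "A * tp s = 0" using Js A(2) by (metis mult.assoc mult_zero_right)
  have e: "?a * tp ?b = A * tp B - A' * tp B'"
  proof -
    have "?a * tp ?b = A * tp B + A * tp s * tp B' - A' * (s * tp B) - A' * (s * tp s) * tp B'"
      by (simp add: algebra_simps)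
    also have "\<dots> = A * tp B - A' * tp B'" unfolding Bs As ss using A'(2) by simp
    finally show ?thesis .
  qed
  have "inner W (?a * tp ?b) \<le> \<delta> * norm (?a * tp ?b)"
  proof (rule g[unfolded sparse_small_def, rule_format])
    show "proj T * ?a = ?a" using A A' by (simp add: algebra_simps mult.assoc[symmetric])
    show "proj T * ?b = ?b" using B B' by (simp add: algebra_simps mult.assoc[symmetric])
    show "?a * proj {..<2*r} = ?a" using fix1 s2 by (simp add: algebra_simps)
    show "?b * proj {..<2*r} = ?b" using fix1 s2 by (simp add: algebra_simps)
  qed
  then show ?thesis unfolding e .
qed

section \<open>Gram-Schmidt\<close>

lemma inner_unitm: "inner (unitm a b) X = ent X a b"
proof -
  let ?N = "Suc (max a b)"
  have "corner ?N (unitm a b)" by (auto simp: corner_def)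
  then have "inner (unitm a b) X = (\<Sum>i<?N. \<Sum>j<?N. ent (unitm a b) i j * ent X i j)"
    by (intro inner_corner) simp
  also have "\<dots> = (\<Sum>i<?N. \<Sum>j<?N. if j = b then (if i = a then ent X a b else 0) else 0)"
    by (intro sum.cong) auto
  also have "\<dots> = ent X a b" by simp
  finally show ?thesis .
qed

lemma proj_Suc: "proj {..<Suc d} = proj {..<d} + unitm d d"
  by (rule fmat_eqI) (auto simp: less_Suc_eq)

lemma col_gram:
  assumes "x * proj {0} = x" "y * proj {0} = y"
  shows "tp x * y = inner x y *\<^sub>R unitm 0 0"
proof (rule fmat_eqI)
  fix i j
  have "ent (tp x * y) i j = inner (unitm i j) (tp x * y)" by (simp add: inner_unitm)
  also have "\<dots> = inner (x * unitm i j) y" by (simp only: inner_mult_left)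
  finally have e: "ent (tp x * y) i j = inner (x * unitm i j) y" .
  have z: "tp x * y = proj {0} * (tp x * y) * proj {0}"
  proof -
    have a: "proj {0} * tp x = tp x" using assms(1) by (metis tp_mult tp_proj)
    have "proj {0} * (tp x * y) * proj {0} = (proj {0} * tp x) * (y * proj {0})" by (simp only: mult.assoc)
    then show ?thesis unfolding a assms(2) by simp
  qed
  show "ent (tp x * y) i j = ent (inner x y *\<^sub>R unitm 0 0) i j"
  proof (cases "i = 0 \<and> j = 0")
    case True
    have "x * unitm 0 0 = x"
      by (rule fmat_eqI) (use assms(1) in \<open>auto simp: fix_proj_iff ent_mult_unitm\<close>)
    with e True show ?thesis by simp
  next
    case False
    have "ent (tp x * y) i j = ent (proj {0} * (tp x * y) * proj {0}) i j" using z by simp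
    also have "\<dots> = 0" using False by (auto simp: ent_mult_proj ent_proj_mult)
    finally show ?thesis using False by auto
  qed
qed

definition upper_tri :: "fmat \<Rightarrow> bool" where
  "upper_tri G \<longleftrightarrow> (\<forall>i j. j < i \<longrightarrow> ent G i j = 0)"

text \<open>Induction on the dimension: the new coordinate vector, freed of its
  \<open>S\<close>-projection onto the earlier columns, has entry one in the new row. So it does not
  vanish, and the diagonal of \<open>G\<close> stays positive.\<close>

lemma gram_schmidt:
  assumes sym: "tp S = S"
    and pos: "\<And>x. proj {..<d} * x = x \<Longrightarrow> x * proj {0} = x \<Longrightarrow> x \<noteq> 0 \<Longrightarrow> 0 < inner (S * x) x"
  shows "\<exists>G. proj {..<d} * G = G \<and> G * proj {..<d} = G \<and> upper_tri G \<and>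
    (\<forall>j<d. 0 < ent G j j) \<and> tp G * S * G = proj {..<d}"
  using pos
proof (induction d)
  case 0
  have "proj {} = 0" by (rule fmat_eqI) simp
  then show ?case by (intro exI[of _ 0]) (auto simp: upper_tri_def)
next
  case (Suc d)
  have "\<exists>G. proj {..<d} * G = G \<and> G * proj {..<d} = G \<and> upper_tri G \<and>
    (\<forall>j<d. 0 < ent G j j) \<and> tp G * S * G = proj {..<d}"
  proof (rule Suc.IH)
    fix x assume "proj {..<d} * x = x" "x * proj {0} = x" "x \<noteq> 0"
    then show "0 < inner (S * x) x"
      by (intro Suc.prems proj_subset_fix[of "{..<Suc d}" "{..<d}"]) auto
  qed
  then obtain G where G: "proj {..<d} * G = G" "G * proj {..<d} = G" "upper_tri G"
    "\<And>j. j < d \<Longrightarrow> 0 < ent G j j" "tp G * S * G = proj {..<d}" by blast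
  let ?J = "proj {..<d}"
  define e where "e = unitm d 0"
  \<comment> \<open>\<open>G * tp G * S\<close> is the \<open>S\<close>-orthogonal projection onto
    the columns of \<open>G\<close>.\<close>
  define g0 where "g0 = e - G * tp G * S * e"
  have GS: "tp G * S * g0 = 0"
  proof -
    have JG: "?J * tp G = tp G" using G(2) by (metis tp_mult tp_proj)
    have "tp G * S * g0 = tp G * S * e - (tp G * S * G) * (tp G * S * e)"
      by (simp add: g0_def algebra_simps)
    also have "\<dots> = tp G * S * e - (?J * tp G) * S * e" unfolding G(5) by (simp only: mult.assoc)
    finally show ?thesis using JG by simp
  qed
  have ent_G: "ent G i j = 0" if "d \<le> i \<or> d \<le> j" for i j
    using that G(1,2) by (auto simp: proj_fix_iff fix_proj_iff)
  have g0_ent: "ent g0 d 0 = 1" "ent g0 i j = 0" if "j \<noteq> 0 \<or> d < i" for i j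
  proof -
    have a: "ent (G * (tp G * S * e)) i j = 0" if "d \<le> i" for i j
      unfolding ent_mult using ent_G that by simp
    have b: "ent (G * tp G * S * e) i j = 0" if "j \<noteq> 0" for i j
      using that by (simp add: e_def ent_mult_unitm)
    show "ent g0 d 0 = 1" using a[of d 0] by (simp add: g0_def e_def mult.assoc)
    show "ent g0 i j = 0" using that a[of i j] b[of j i] by (auto simp: g0_def mult.assoc) (auto simp: e_def)
  qed
  have c0: "g0 * proj {0} = g0" using g0_ent(2) by (auto simp: fix_proj_iff)
  have r0: "proj {..<Suc d} * g0 = g0" using g0_ent(2) by (auto simp: proj_fix_iff)
  have d0: "ent g0 d 0 = 1" using g0_ent(1)[of 0 "Suc d"] by simp
  then have "g0 \<noteq> 0" by auto
  then have q: "0 < inner (S * g0) g0" using Suc.prems r0 c0 by blast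
  define g where "g = (1 / sqrt (inner (S * g0) g0)) *\<^sub>R g0"
  have GSg: "tp G * S * g = 0" using GS by (simp add: g_def)
  have gSG: "tp g * S * G = 0" using arg_cong[OF GSg, of tp] sym by (simp add: mult.assoc)
  have gSg: "tp g * S * g = unitm 0 0"
  proof -
    have "S * g0 * proj {0} = S * g0" using c0 by (simp add: mult.assoc)
    then have "tp g0 * (S * g0) = inner g0 (S * g0) *\<^sub>R unitm 0 0" using c0 by (rule col_gram[rotated])
    then show ?thesis using q by (simp add: g_def mult.assoc inner_commute)
  qed
  define G' where "G' = G + g * unitm 0 d"
  have ent_G': "ent G' i j = ent G i j + (if j = d then ent g i 0 else 0)" for i j
    by (simp add: G'_def ent_mult_unitm)
  have "tp G' * S * G' = tp G * S * G + tp G * S * g * unitm 0 d + unitm d 0 * (tp g * S * G)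
     + unitm d 0 * (tp g * S * g) * unitm 0 d"
    by (simp add: G'_def algebra_simps)
  also have "\<dots> = proj {..<Suc d}"
  proof -
    have "unitm d 0 * unitm 0 0 * unitm 0 d = unitm d d"
      by (rule fmat_eqI) (auto simp: ent_mult_unitm)
    then show ?thesis unfolding GSg gSG gSg G(5) proj_Suc by simp
  qed
  finally have S': "tp G' * S * G' = proj {..<Suc d}" .
  have "proj {..<Suc d} * G' = G'"
    using ent_G g0_ent(2) by (auto simp: proj_fix_iff ent_G' g_def)
  moreover have "G' * proj {..<Suc d} = G'"
    using ent_G g0_ent(2) by (auto simp: fix_proj_iff ent_G' g_def)
  moreover have "upper_tri G'"
    using G(3) g0_ent(2) by (auto simp: upper_tri_def ent_G' g_def)
  moreover have "0 < ent G' j j" if "j < Suc d" for j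
    using that G(4) ent_G d0 q by (cases "j = d") (auto simp: ent_G' g_def)
  ultimately show ?case using S' by blast
qed

text \<open>Read column by column, each equation of \<open>R * G = proj {..<d}\<close> below the
  diagonal has one new unknown, with the positive coefficient \<open>ent G j j\<close>.\<close>

lemma triangular_left_inverse:
  assumes G: "upper_tri G" "\<And>j. j < d \<Longrightarrow> 0 < ent G j j" "corner d G"
    and R: "R * G = proj {..<d}" "R * proj {..<d} = R"
  shows "upper_tri R" "\<And>j. j < d \<Longrightarrow> ent R j j * ent G j j = 1"
proof -
  have eq: "(\<Sum>l<d. ent R i l * ent G l j) = (if i = j \<and> i < d then 1 else 0)" for i j
    using ent_mult_corner[of d R G i j] R(1) G(3) by simp
  have lower: "j < i \<Longrightarrow> ent R i j = 0" for i j
  proof (induction j rule: less_induct)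
    case (less j)
    show ?case
    proof (cases "j < d")
      case True
      have "(\<Sum>l<d. ent R i l * ent G l j) = (\<Sum>l<d. if l = j then ent R i j * ent G j j else 0)"
      proof (intro sum.cong refl)
        fix l show "ent R i l * ent G l j = (if l = j then ent R i j * ent G j j else 0)"
          using less.IH[of l] less.prems G(1) by (cases l j rule: linorder_cases) (auto simp: upper_tri_def)
      qed
      with eq[of i j] True less.prems have "ent R i j * ent G j j = 0" by simp
      with G(2)[OF True] show ?thesis by simp
    next
      case False then show ?thesis using R(2) by (auto simp: fix_proj_iff)
    qed
  qed
  then show "upper_tri R" by (simp add: upper_tri_def)
  fix j assume j: "j < d"
  have "(\<Sum>l<d. ent R j l * ent G l j) = (\<Sum>l<d. if l = j then ent R j j * ent G j j else 0)"
  proof (intro sum.cong refl)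
    fix l show "ent R j l * ent G l j = (if l = j then ent R j j * ent G j j else 0)"
      using lower[of l j] G(1) by (cases l j rule: linorder_cases) (auto simp: upper_tri_def)
  qed
  with eq[of j j] j show "ent R j j * ent G j j = 1" by simp
qed

text \<open>\<open>x - 1 / x\<close> is \<open>x - 1\<close> times a factor above one. It serves the
  diagonal entries, where \<open>R\<close> and \<open>G\<close> are reciprocal.\<close>

lemma abs_diff_inverse: "0 < x \<Longrightarrow> \<bar>x - 1\<bar> \<le> \<bar>x - 1 / (x::real)\<bar>"
proof -
  assume x: "0 < x"
  have "x - 1 / x = (x - 1) * (1 + 1 / x)" using x by (simp add: field_simps)
  then have "\<bar>x - 1 / x\<bar> = \<bar>x - 1\<bar> * (1 + 1 / x)" using x by (simp add: abs_mult)
  moreover have "\<bar>x - 1\<bar> * 1 \<le> \<bar>x - 1\<bar> * (1 + 1 / x)" using x by (intro mult_left_mono) auto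
  ultimately show ?thesis by simp
qed

text \<open>The inverse \<open>R = tp G * H\<close> of \<open>G\<close> is upper triangular, and \<open>R - tp G = tp G * (H - J)\<close>; since \<open>tp G\<close>
  is lower triangular, this bounds every entry of \<open>R - J\<close> without any a priori smallness of it.\<close>
lemma gram_schmidt_near_identity:
  assumes sym: "tp H = H" and HJ: "H * proj {..<r} = H" and near: "norm (H - proj {..<r}) \<le> 1 / 4"
  shows "\<exists>G. proj {..<r} * G = G \<and> G * proj {..<r} = G \<and> tp G * H * G = proj {..<r} \<and>
    norm (proj {..<r} - G) \<le> 2 * norm (H - proj {..<r})"
proof -
  let ?J = "proj {..<r}"
  define E where "E = H - ?J"
  have H: "H = ?J + E" by (simp add: E_def)
  have JH: "?J * H = H" using arg_cong[OF HJ, of tp] sym by simp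
  \<comment> \<open>The perturbation costs at most a quarter of the form of \<open>?J\<close>, so
    half of it remains.\<close>
  have coer: "(norm x)\<^sup>2 / 2 \<le> inner (H * x) x" if "?J * x = x" for x
  proof -
    have "\<bar>inner (E * x) x\<bar> \<le> norm (E * x) * norm x" by (rule Cauchy_Schwarz_ineq2)
    also have "\<dots> \<le> (norm E * norm x) * norm x" by (intro mult_right_mono norm_mult_ineq norm_ge_zero)
    also have "\<dots> \<le> (1 / 4) * norm x * norm x"
      using near by (intro mult_right_mono) (auto simp: E_def)
    finally have "\<bar>inner (E * x) x\<bar> \<le> (norm x)\<^sup>2 / 4" by (simp add: power2_eq_square)
    moreover have "inner (H * x) x = (norm x)\<^sup>2 + inner (E * x) x"
      using that by (simp add: H distrib_right inner_add_left norm_power2_inner)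
    moreover have "0 \<le> (norm x)\<^sup>2" by simp
    ultimately show ?thesis by linarith
  qed
  have "\<exists>G. ?J * G = G \<and> G * ?J = G \<and> upper_tri G \<and> (\<forall>j<r. 0 < ent G j j) \<and> tp G * H * G = ?J"
  proof (rule gram_schmidt[OF sym])
    fix x assume "?J * x = x" "x \<noteq> 0"
    then have "(norm x)\<^sup>2 / 2 \<le> inner (H * x) x" "0 < (norm x)\<^sup>2" using coer by auto
    then show "0 < inner (H * x) x" by linarith
  qed
  then obtain G where G: "?J * G = G" "G * ?J = G" "upper_tri G" "\<And>j. j < r \<Longrightarrow> 0 < ent G j j"
    "tp G * H * G = ?J" by blast
  define R where "R = tp G * H"
  have cG: "corner r G" using G(1,2) by (auto simp: corner_def proj_fix_iff fix_proj_iff)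
  have RG: "R * G = ?J" "R * ?J = R" using G(5) HJ by (auto simp: R_def mult.assoc)
  note tri = triangular_left_inverse[OF G(3,4) cG RG]
  define F where "F = tp G * E"
  have JG: "?J * tp G = tp G" "tp G * ?J = tp G" using G(1,2) by (metis tp_mult tp_proj)+
  have RF: "R = tp G + F" by (simp add: R_def F_def H distrib_left JG)
  have obG: "opb G (sqrt 2)"
  proof -
    have "norm (G * X) \<le> sqrt 2 * norm X" for X
    proof -
      have "(norm (G * X))\<^sup>2 / 2 \<le> inner (H * (G * X)) (G * X)"
        by (rule coer) (use G(1) in \<open>simp add: mult.assoc[symmetric]\<close>)
      also have "\<dots> = inner (tp G * H * G * X) X"
        using inner_mult_left[of G X "H * (G * X)"] by (simp add: inner_commute mult.assoc)
      also have "\<dots> = inner (?J * X) X" using G(5) by simp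
      also have "\<dots> \<le> norm (?J * X) * norm X" by (rule norm_cauchy_schwarz)
      also have "\<dots> \<le> norm X * norm X" by (intro mult_right_mono norm_proj_le) auto
      finally have "(norm (G * X))\<^sup>2 \<le> (sqrt 2 * norm X)\<^sup>2" by (simp add: power_mult_distrib power2_eq_square[of "norm X"])
      then show ?thesis by (rule power2_le_imp_le) simp
    qed
    then show ?thesis by (simp add: opb_def)
  qed
  \<comment> \<open>Entrywise: below the diagonal \<open>R\<close> vanishes, above it
    \<open>tp G\<close> does, and on it the reciprocal inequality applies.\<close>
  have "norm (R - ?J) \<le> norm F"
  proof (rule norm_le_ent)
    fix i j
    show "\<bar>ent (R - ?J) i j\<bar> \<le> \<bar>ent F i j\<bar>"
    proof (cases i j rule: linorder_cases)
      case greater then show ?thesis using tri(1) by (simp add: upper_tri_def)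
    next
      case less then show ?thesis using G(3) by (simp add: RF upper_tri_def)
    next
      case equal
      show ?thesis
      proof (cases "i < r")
        case True
        have Gi: "0 < ent G i i" "ent R i i * ent G i i = 1" using G(4) tri(2) True by auto
        have R0: "0 < ent R i i"
          by (rule zero_less_mult_pos2[OF _ Gi(1)]) (simp add: Gi(2))
        with Gi have "ent G i i = 1 / ent R i i" by (simp add: field_simps)
        with R0
        have "\<bar>ent R i i - 1\<bar> \<le> \<bar>ent R i i - ent G i i\<bar>" using abs_diff_inverse by simp
        also have "ent R i i - ent G i i = ent F i i" by (simp add: RF)
        finally show ?thesis using equal True by simp
      next
        case False
        then have "ent R i j = 0" using RG(2) equal by (auto simp: fix_proj_iff)
        then show ?thesis using False equal by simp
      qed
    qed
  qed
  also have "norm F \<le> sqrt 2 * norm E" unfolding F_def by (intro opbD opb_tp obG)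
  finally have RJ: "norm (R - ?J) \<le> sqrt 2 * norm E" .
  \<comment> \<open>Two factors \<open>sqrt 2\<close>, one from \<open>tp G\<close> in
    \<open>F\<close> and one from \<open>G\<close> here, make up the constant 2.\<close>
  have "?J - G = (R - ?J) * G" using RG(1) G(1) by (simp add: left_diff_distrib)
  then have "norm (?J - G) \<le> sqrt 2 * norm (R - ?J)" using opbD2[OF obG, of "R - ?J"] by simp
  also have "\<dots> \<le> sqrt 2 * (sqrt 2 * norm E)" by (intro mult_left_mono RJ) simp
  finally have "norm (?J - G) \<le> 2 * norm E" by (simp add: mult.assoc[symmetric])
  then show ?thesis using G unfolding E_def by blast
qed

section \<open>Deterministic analysis\<close>

text \<open>\<open>S\<close> and \<open>H\<close> are the joint population and sample covariances of all \<open>p + m\<close> coordinates, and \<open>D\<close> is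
  the data matrix divided by \<open>sqrt n\<close>.\<close>
locale sparse_perturbation =
  fixes S H D :: fmat and T :: "nat set" and r :: nat and b \<delta> \<tau> :: real
  assumes T: "finite T" and r: "0 < r"
    and symS: "tp S = S" and HD: "H = tp D * D"
    and oS: "opb S b" and b: "2 \<le> b"
    and small: "sparse_small T (2 * r) \<delta> (H - S)" and d0: "0 \<le> \<delta>" and d\<tau>: "\<delta> \<le> \<tau>"
    and \<tau>: "\<tau> \<le> 1 / (28 * b\<^sup>2)"
begin

abbreviation "J \<equiv> proj {..<r}"

lemma \<tau>0: "0 \<le> \<tau>" using d0 d\<tau> by simp

lemma symH: "tp H = H" by (simp add: HD)

text \<open>The constant 28 brings the Gram error \<open>7 * b\<^sup>2 * \<tau>\<close> below
  \<open>1 / 4\<close>, the range in which the orthonormalisation is stable.\<close>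

lemma b_sq_tau_le: "28 * b\<^sup>2 * \<tau> \<le> 1"
  using \<tau> b by (simp add: field_simps)

lemma b_tau_le: "56 * b * \<tau> \<le> 1"
proof -
  have "2 * b * \<tau> \<le> b * b * \<tau>" using b \<tau>0 by (intro mult_right_mono) auto
  with b_sq_tau_le show ?thesis by (simp add: power2_eq_square)
qed

lemma d_half: "\<delta> \<le> 1 / (2 * b)"
proof -
  have "\<delta> * (2 * b) \<le> \<tau> * (2 * b)" using d\<tau> b by (intro mult_right_mono) auto
  also have "\<dots> \<le> 1" using b_tau_le \<tau>0 b by (simp add: mult_ac)
  finally show ?thesis using b by (simp add: field_simps)
qed

lemma d_le_b: "\<delta> \<le> b"
proof -
  have "1 / (2 * b) \<le> 1" using b by (simp add: field_simps)
  then show ?thesis using d_half b by linarith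
qed

lemma fix_proj_double: "X * J = X \<Longrightarrow> X * proj {..<2 * r} = X"
  by (rule fix_proj_subset) auto

lemma H_quad: "inner (H * X) Y = inner (D * X) (D * Y)"
  using inner_mult_left[of "tp D" "D * X" Y] by (simp add: HD mult.assoc)

text \<open>As \<delta> is at most \<open>1 / (2 * b)\<close>, sampling costs at most half of the
  coercivity of \<open>S\<close>.\<close>

lemma H_lower:
  assumes "proj T * X = X" "(norm X)\<^sup>2 / b \<le> inner (S * X) X"
  shows "(norm X)\<^sup>2 / (2 * b) \<le> (norm (D * X))\<^sup>2"
proof -
  have "\<bar>inner ((H - S) * X) X\<bar> \<le> \<delta> * (norm X)\<^sup>2"
    using r by (intro sparse_small_quad[OF T small d0]) (auto simp: assms)
  moreover have "\<delta> * (norm X)\<^sup>2 \<le> 1 / (2 * b) * (norm X)\<^sup>2"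
    by (intro mult_right_mono d_half) simp
  moreover have "inner ((H - S) * X) X = (norm (D * X))\<^sup>2 - inner (S * X) X"
    by (simp add: left_diff_distrib inner_diff_left H_quad norm_power2_inner)
  moreover have "(norm X)\<^sup>2 / b = 1 / (2 * b) * (norm X)\<^sup>2 + (norm X)\<^sup>2 / (2 * b)"
    using b by (simp add: field_simps)
  ultimately show ?thesis using assms(2) by linarith
qed

lemma H_upper:
  assumes "proj T * X = X"
  shows "(norm (D * X))\<^sup>2 \<le> (2 * b * norm X)\<^sup>2"
proof -
  have "\<bar>inner ((H - S) * X) X\<bar> \<le> \<delta> * (norm X)\<^sup>2"
    using r by (intro sparse_small_quad[OF T small d0]) (auto simp: assms)
  moreover have "\<delta> * (norm X)\<^sup>2 \<le> b * (norm X)\<^sup>2"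
    by (intro mult_right_mono d_le_b) simp
  moreover have "inner ((H - S) * X) X = (norm (D * X))\<^sup>2 - inner (S * X) X"
    by (simp add: left_diff_distrib inner_diff_left H_quad norm_power2_inner)
  moreover have "inner (S * X) X \<le> b * (norm X)\<^sup>2"
  proof -
    have "inner (S * X) X \<le> norm (S * X) * norm X" by (rule norm_cauchy_schwarz)
    also have "\<dots> \<le> b * norm X * norm X" by (intro mult_right_mono opbD oS norm_ge_zero)
    finally show ?thesis by (simp add: power2_eq_square mult.assoc)
  qed
  ultimately have "(norm (D * X))\<^sup>2 \<le> (2 * b) * (norm X)\<^sup>2" by linarith
  \<comment> \<open>\<open>2 * b\<close> is enlarged to its square so that norms can be compared
    without a root of \<open>b\<close>.\<close>
  also have "\<dots> \<le> (2 * b)\<^sup>2 * (norm X)\<^sup>2"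
    using b by (intro mult_right_mono) (auto simp: power2_eq_square)
  finally show ?thesis by (simp only: power_mult_distrib)
qed

lemma opb_normalised:
  assumes A: "tp A * (S * A) = proj I" "finite I" and c: "\<And>X. (norm (A * X))\<^sup>2 / b \<le> inner (S * (A * X)) (A * X)"
  shows "opb A b"
proof -
  have "norm (A * X) \<le> b * norm X" for X
  proof -
    have "inner (S * (A * X)) (A * X) = inner (tp A * (S * A) * X) X"
      using inner_mult_left[of A X "S * (A * X)"] by (simp add: inner_commute mult.assoc)
    also have "\<dots> \<le> norm (proj I * X) * norm X" unfolding A(1) by (rule norm_cauchy_schwarz)
    also have "\<dots> \<le> norm X * norm X" by (intro mult_right_mono norm_proj_le A norm_ge_zero)
    finally have "(norm (A * X))\<^sup>2 / b \<le> (norm X)\<^sup>2" using c[of X] by (simp add: power2_eq_square)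
    then have "(norm (A * X))\<^sup>2 \<le> b * (norm X)\<^sup>2" using b by (simp add: field_simps)
    also have "\<dots> \<le> b\<^sup>2 * (norm X)\<^sup>2" using b by (intro mult_right_mono) (auto simp: power2_eq_square)
    finally have "(norm (A * X))\<^sup>2 \<le> (b * norm X)\<^sup>2" by (simp only: power_mult_distrib)
    then show ?thesis by (rule power2_le_imp_le) (use b in simp)
  qed
  then show ?thesis using b by (simp add: opb_def)
qed

text \<open>Since \<open>H\<close> is \<open>tp D * D\<close>, normalisation by \<open>H\<close>
  says that \<open>D * A\<close> has orthonormal columns. The bound on \<open>A\<close> itself comes
  back through \<open>H_lower\<close>.\<close>

lemma opb_normalised_sample:
  assumes A: "tp A * (H * A) = J" "proj T * A = A"
    and c: "\<And>X. (norm (A * X))\<^sup>2 / b \<le> inner (S * (A * X)) (A * X)"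
  shows "opb A (2 * b)" "opb (D * A) 1"
proof -
  have "tp (D * A) * (D * A) = J" using A(1) by (simp add: HD mult.assoc)
  then show o1: "opb (D * A) 1" by (rule opb_orthonormal[rotated]) simp
  have "norm (A * X) \<le> 2 * b * norm X" for X
  proof -
    have "(norm (A * X))\<^sup>2 / (2 * b) \<le> (norm (D * (A * X)))\<^sup>2"
      by (rule H_lower[OF _ c]) (simp add: mult.assoc[symmetric] A)
    also have "\<dots> \<le> (norm X)\<^sup>2"
      using opbD[OF o1, of X] by (simp add: mult.assoc)
    finally have "(norm (A * X))\<^sup>2 \<le> 2 * b * (norm X)\<^sup>2" using b by (simp add: field_simps)
    also have "\<dots> \<le> (2 * b)\<^sup>2 * (norm X)\<^sup>2"
      using b by (intro mult_right_mono) (auto simp: power2_eq_square)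
    finally have "(norm (A * X))\<^sup>2 \<le> (2 * b * norm X)\<^sup>2" by (simp only: power_mult_distrib)
    then show ?thesis by (rule power2_le_imp_le) (use b in simp)
  qed
  then show "opb A (2 * b)" using b by (simp add: opb_def)
qed

end

text \<open>One of the two canonical sides. The set \<open>X\<close> holds the coordinates of that side, and \<open>U0\<close> is the
  sparse surrogate of the leading directions \<open>U1\<close>.\<close>
locale cca_side = sparse_perturbation +
  fixes X :: "nat set" and U1 U2 U0 :: fmat and I2 :: "nat set"
  assumes X: "finite X" and cS: "\<And>Y. proj X * Y = Y \<Longrightarrow> (norm Y)\<^sup>2 / b \<le> inner (S * Y) Y"
    and U1: "proj X * U1 = U1" "U1 * J = U1" "tp U1 * (S * U1) = J"
    and U2: "proj X * U2 = U2" "tp U2 * (S * U2) = proj I2" "finite I2" "tp U2 * (S * U1) = 0"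
    and U0: "proj X * U0 = U0" "proj T * U0 = U0" "U0 * J = U0" "norm (U0 - U1) \<le> \<tau>"
begin

text \<open>A bound for the distance of the normalised surrogate from \<open>U1\<close>: \<tau> for
  the truncation, plus twice the Gram error \<open>7 * b\<^sup>2 * \<tau>\<close> times the bound
  \<open>2 * b\<close> of \<open>U0\<close>.\<close>

definition "\<rho> = 29 * b ^ 3 * \<tau>"

lemma \<rho>0: "0 \<le> \<rho>" using b \<tau>0 by (simp add: \<rho>_def)

lemma \<tau>\<rho>: "2 * \<tau> \<le> \<rho>"
proof -
  have "1 ^ 3 \<le> b ^ 3" using b by (intro power_mono) auto
  then have "2 * \<tau> \<le> (29 * b ^ 3) * \<tau>" using \<tau>0 by (intro mult_right_mono) auto
  then show ?thesis by (simp add: \<rho>_def)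
qed

lemma cS': "proj X * Z = Z \<Longrightarrow> (norm (Z * Y))\<^sup>2 / b \<le> inner (S * (Z * Y)) (Z * Y)"
  by (rule cS) (simp add: mult.assoc[symmetric])

lemma oU1: "opb U1 b" and oU2: "opb U2 b"
  by (rule opb_normalised[OF U1(3) _ cS'[OF U1(1)]], simp)
    (rule opb_normalised[OF U2(2,3) cS'[OF U2(1)]])

lemma oU0: "opb U0 (2 * b)"
proof -
  have "opb (U1 + (U0 - U1)) (b + norm (U0 - U1))" by (intro opb_add oU1 opb_norm)
  moreover have "\<tau> \<le> b" using b_tau_le b \<tau>0 by (smt (verit) mult_mono mult_cancel_right1)
  ultimately have "opb U0 (b + norm (U0 - U1))" "b + norm (U0 - U1) \<le> 2 * b" using U0(4) by auto
  then show ?thesis by (rule opb_mono)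
qed

lemma gram_error: "norm (tp U0 * (H * U0) - J) \<le> 7 * b\<^sup>2 * \<tau>"
proof -
  \<comment> \<open>One sampling error and two truncation errors, of sizes
    \<open>4 * b\<^sup>2 * \<tau>\<close>, \<open>2 * b\<^sup>2 * \<tau>\<close> and
    \<open>b\<^sup>2 * \<tau>\<close>.\<close>
  have "tp U0 * (H * U0) - J = tp U0 * (proj T * (H - S) * U0) + tp U0 * (S * (U0 - U1)) + tp (U0 - U1) * (S * U1)"
    (is "_ = ?a + ?b + ?c")
  proof -
    have t: "tp U0 * proj T = tp U0" using U0(2) by (metis tp_mult tp_proj)
    have "?a = tp U0 * (H * U0) - tp U0 * (S * U0)"
      by (simp add: right_diff_distrib left_diff_distrib mult.assoc[symmetric] t)
    then show ?thesis by (simp add: algebra_simps U1(3))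
  qed
  then have "norm (tp U0 * (H * U0) - J) \<le> norm ?a + norm ?b + norm ?c"
    by (metis norm_triangle_ineq norm_triangle_le add_right_mono)
  moreover have "norm ?a \<le> 2 * b * (\<delta> * (2 * b))"
    by (intro order_trans[OF opbD[OF opb_tp[OF oU0]]] mult_left_mono sparse_small_frob[OF T small d0 U0(2) fix_proj_double[OF U0(3)] oU0])
      (use b in auto)
  moreover have "2 * b * (\<delta> * (2 * b)) \<le> 2 * b * (\<tau> * (2 * b))"
    using b d\<tau> by (intro mult_left_mono mult_right_mono) auto
  moreover have "norm ?b \<le> 2 * b * (b * \<tau>)"
    by (intro order_trans[OF opbD[OF opb_tp[OF oU0]]] mult_left_mono order_trans[OF opbD[OF oS]] U0(4))
      (use b in auto)
  moreover have "norm ?c \<le> \<tau> * (b * b)"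
  proof -
    have "norm ?c \<le> b * (b * norm (U0 - U1))"
      using opbD2[OF oU1, of "tp (U0 - U1) * S"] opbD2[OF oS, of "tp (U0 - U1)"] b
      unfolding norm_tp by (simp add: mult.assoc) (smt (verit) mult_left_mono)
    also have "\<dots> \<le> b * (b * \<tau>)" using b U0(4) by (intro mult_left_mono) auto
    finally show ?thesis by (simp add: mult_ac)
  qed
  ultimately show ?thesis by (simp add: power2_eq_square algebra_simps)
qed

text \<open>\<open>norm (J - G) < 1\<close> guards the nonzero rows, hence feasibility. The two
  facts on \<open>proj T * H\<close> let the sample gradient be replaced by the population one, and
  the last fact says that the competitor hardly overlaps the residual directions.\<close>

lemma normalised_truth:
  obtains G where "J * G = G" "G * J = G" "norm (J - G) < 1" "tp (U0 * G) * (H * (U0 * G)) = J"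
    "norm (U0 * G - U1) \<le> \<rho>" "opb (U0 * G) (2 * b)" "opb (D * (U0 * G)) 1"
    "norm (proj T * H * (U0 * G) - proj T * S * U1) \<le> 2 * b * \<rho>"
    "opb (proj T * H * (U0 * G)) (4 * b\<^sup>2)" "norm (tp U2 * (S * (U0 * G))) \<le> b\<^sup>2 * \<rho>"
proof -
  let ?H = "tp U0 * (H * U0)"
  have sym: "tp ?H = ?H" "?H * J = ?H" using symH U0(3) by (simp_all add: mult.assoc)
  have ne: "norm (?H - J) \<le> 1 / 4"
    using gram_error b_sq_tau_le by linarith
  obtain G where G: "J * G = G" "G * J = G" "tp G * ?H * G = J" "norm (J - G) \<le> 2 * norm (?H - J)"
    using gram_schmidt_near_identity[OF sym ne] by blast
  have JG: "norm (J - G) \<le> 14 * b\<^sup>2 * \<tau>" using G(4) gram_error by linarith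
  let ?A = "U0 * G"
  have 1: "norm (J - G) < 1" using G(4) ne by linarith
  have 2: "tp ?A * (H * ?A) = J" using G(3) by (simp add: mult.assoc)
  have A: "proj T * ?A = ?A" "proj X * ?A = ?A" "?A * J = ?A"
    using U0 G(2) by (simp_all add: mult.assoc[symmetric]) (simp add: mult.assoc)
  have 3: "norm (?A - U1) \<le> \<rho>"
  proof -
    have "?A - U1 = (U0 - U1) - U0 * (J - G)" using U0(3) by (simp add: right_diff_distrib)
    then have "norm (?A - U1) \<le> norm (U0 - U1) + norm (U0 * (J - G))" by (metis norm_triangle_ineq4)
    also have "\<dots> \<le> \<tau> + 2 * b * (14 * b\<^sup>2 * \<tau>)"
      by (intro add_mono U0(4) order_trans[OF opbD[OF oU0]] mult_left_mono JG) (use b in auto)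
    also have "\<dots> \<le> \<rho>"
    proof -
      have "1 ^ 3 * \<tau> \<le> b ^ 3 * \<tau>" using b \<tau>0 by (intro mult_right_mono power_mono) auto
      then show ?thesis by (simp add: \<rho>_def power2_eq_square power3_eq_cube mult_ac)
    qed
    finally show ?thesis .
  qed
  note 4 = opb_normalised_sample[OF 2 A(1) cS'[OF A(2)]]
  have W: "norm (proj T * (H - S) * ?A) \<le> \<delta> * (2 * b)"
    by (rule sparse_small_frob[OF T small d0 A(1) fix_proj_double[OF A(3)] 4(1)])
  have 5: "norm (proj T * H * ?A - proj T * S * U1) \<le> 2 * b * \<rho>"
  proof -
    have "proj T * H * ?A - proj T * S * U1 = proj T * (H - S) * ?A + proj T * (S * (?A - U1))"
      by (simp add: algebra_simps)
    then have "norm (proj T * H * ?A - proj T * S * U1) \<le> \<delta> * (2 * b) + norm (proj T * (S * (?A - U1)))"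
      using W norm_triangle_ineq[of "proj T * (H - S) * ?A" "proj T * (S * (?A - U1))"] by simp
    also have "\<dots> \<le> \<tau> * (2 * b) + b * \<rho>"
      by (intro add_mono mult_right_mono d\<tau> order_trans[OF norm_proj_le[OF T]] order_trans[OF opbD[OF oS]]
          mult_left_mono 3) (use b in auto)
    also have "\<dots> \<le> 2 * b * \<rho>" using mult_right_mono[OF \<tau>\<rho>, of b] b by (simp add: mult_ac)
    finally show ?thesis .
  qed
  have 6: "opb (proj T * H * ?A) (4 * b\<^sup>2)"
  proof -
    have "proj T * H * ?A = proj T * (S * ?A) + proj T * (H - S) * ?A"
      by (simp add: algebra_simps)
    moreover have "opb (proj T * (S * ?A) + proj T * (H - S) * ?A) (1 * (b * (2 * b)) + \<delta> * (2 * b))"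
      by (intro opb_add opb_mult opb_proj T oS 4 opb_mono[OF opb_norm W])
    moreover have "1 * (b * (2 * b)) + \<delta> * (2 * b) \<le> 4 * b\<^sup>2"
      using mult_right_mono[OF d_le_b, of "2 * b"] b by (simp add: power2_eq_square)
    ultimately show ?thesis using opb_mono by metis
  qed
  have 7: "norm (tp U2 * (S * ?A)) \<le> b\<^sup>2 * \<rho>"
  proof -
    have "tp U2 * (S * ?A) = tp U2 * (S * (?A - U1))"
      using U2(4) by (simp add: right_diff_distrib)
    also have "norm \<dots> \<le> b * (b * \<rho>)"
      by (intro order_trans[OF opbD[OF opb_tp[OF oU2]]] mult_left_mono order_trans[OF opbD[OF oS]] 3)
        (use b in auto)
    finally show ?thesis by (simp add: power2_eq_square mult.assoc)
  qed
  show ?thesis by (rule that[OF G(1,2) 1 2 3 4 5 6 7])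
qed

end

lemma quadratic_bound:
  fixes x a e :: real
  assumes "x\<^sup>2 \<le> a * x + e\<^sup>2" "0 \<le> a" "0 \<le> e"
  shows "x \<le> a + e"
proof (rule ccontr)
  assume "\<not> ?thesis"
  then have x: "a + e < x" by simp
  then have "(a + e) * x < x * x" using assms by (intro mult_strict_right_mono) auto
  moreover have "e * e \<le> e * x" using x assms by (intro mult_left_mono) auto
  ultimately show False using assms(1) by (simp add: power2_eq_square algebra_simps)
qed

text \<open>\<open>A\<close> and \<open>B\<close> are the estimator in joint coordinates, and
  \<open>opt\<close> compares it with normalised surrogates only, the competitors that actually
  occur. The bound on \<open>c\<close> is chosen so that the residual correlations use up no more
  than half of the curvature.\<close>

locale cca_oracle =
  u: cca_side S H D T r b \<delta> \<tau> X U1 U2 U0 I2 + v: cca_side S H D T r b \<delta> \<tau> Y V1 V2 V0 I3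
  for S H D T r b \<delta> \<tau> X U1 U2 U0 I2 Y V1 V2 V0 I3 +
  fixes A B L1 L2 :: fmat and l :: "nat \<Rightarrow> real" and lam \<kappa> c :: real
  assumes A: "proj X * A = A" "proj T * A = A" "A * proj {..<r} = A" "tp A * (H * A) = proj {..<r}"
    and B: "proj Y * B = B" "proj T * B = B" "B * proj {..<r} = B" "tp B * (H * B) = proj {..<r}"
    and Sxy: "proj X * S * proj Y = proj X * (S * (U1 * L1 * tp V1 + U2 * L2 * tp V2) * S) * proj Y"
    and L1: "L1 = diagm r l" "\<And>i. i < r \<Longrightarrow> lam \<le> l i \<and> l i \<le> \<kappa> * lam"
    and lam: "0 < lam" and \<kappa>: "1 \<le> \<kappa>"
    and L2: "opb L2 (c * lam)" and c: "0 \<le> c" "c \<le> 1 / (128 * b ^ 8)"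
    and dl: "\<delta> \<le> lam * \<tau>"
    and opt: "\<And>G G'. proj {..<r} * G = G \<Longrightarrow> G * proj {..<r} = G \<Longrightarrow> norm (proj {..<r} - G) < 1 \<Longrightarrow>
      tp (U0 * G) * (H * (U0 * G)) = proj {..<r} \<Longrightarrow>
      proj {..<r} * G' = G' \<Longrightarrow> G' * proj {..<r} = G' \<Longrightarrow> norm (proj {..<r} - G') < 1 \<Longrightarrow>
      tp (V0 * G') * (H * (V0 * G')) = proj {..<r} \<Longrightarrow>
      inner H ((U0 * G) * tp (V0 * G')) \<le> inner H (A * tp B)"
begin

abbreviation "J \<equiv> proj {..<r}"

lemma oL1: "opb L1 (\<kappa> * lam)"
  unfolding L1(1) using L1(2) lam \<kappa> by (intro opb_diagm) (force intro: mult_nonneg_nonneg)+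

text \<open>The aim is a quadratic inequality for \<open>x = norm K\<close> whose linear coefficient
  is a multiple of \<rho> and whose constant is a multiple of its square. Curvature supplies the
  left side, optimality removes \<open>inner H K\<close>, and what remains splits into noise,
  gradient error and residual correlations.\<close>

lemma estimation_error: "norm (A * tp B - U1 * tp V1) \<le> 6000 * \<kappa> * b ^ 8 * \<tau>"
proof -
  obtain G where G: "J * G = G" "G * J = G" "norm (J - G) < 1" "tp (U0 * G) * (H * (U0 * G)) = J"
    "norm (U0 * G - U1) \<le> u.\<rho>" "opb (U0 * G) (2 * b)" "opb (D * (U0 * G)) 1"
    "norm (proj T * H * (U0 * G) - proj T * S * U1) \<le> 2 * b * u.\<rho>"
    "opb (proj T * H * (U0 * G)) (4 * b\<^sup>2)" "norm (tp U2 * (S * (U0 * G))) \<le> b\<^sup>2 * u.\<rho>"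
    using u.normalised_truth .
  obtain G' where G': "J * G' = G'" "G' * J = G'" "norm (J - G') < 1" "tp (V0 * G') * (H * (V0 * G')) = J"
    "norm (V0 * G' - V1) \<le> u.\<rho>" "opb (V0 * G') (2 * b)" "opb (D * (V0 * G')) 1"
    "norm (proj T * H * (V0 * G') - proj T * S * V1) \<le> 2 * b * u.\<rho>"
    "opb (proj T * H * (V0 * G')) (4 * b\<^sup>2)" "norm (tp V2 * (S * (V0 * G'))) \<le> b\<^sup>2 * u.\<rho>"
    using v.normalised_truth .
  note b = u.b and T = u.T and \<rho>0 = u.\<rho>0 and \<tau>0 = u.\<tau>0
  define A' where "A' = U0 * G"
  define B' where "B' = V0 * G'"
  note G = G[folded A'_def] and G' = G'[folded B'_def]
  have A': "proj X * A' = A'" "proj T * A' = A'" "A' * J = A'"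
    using u.U0 G(2) by (simp_all add: A'_def mult.assoc[symmetric]) (simp add: mult.assoc)
  have B': "proj Y * B' = B'" "proj T * B' = B'" "B' * J = B'"
    using v.U0 G'(2) by (simp_all add: B'_def mult.assoc[symmetric]) (simp add: mult.assoc)
  define K where "K = A' * tp B' - A * tp B"
  define x where "x = norm K"
  have x0: "0 \<le> x" by (simp add: x_def)
  have K: "proj X * K = K" "proj T * K = K" "proj Y * tp K = tp K" "proj T * tp K = tp K"
    using A A' B B' by (simp_all add: K_def right_diff_distrib mult.assoc[symmetric])
  have tK: "K * proj Y = K" "K * proj T = K"
    using arg_cong[OF K(3), of tp] arg_cong[OF K(4), of tp] by simp_all
  note oA = u.opb_normalised_sample[OF A(4,2) u.cS'[OF A(1)]]
  note oB = u.opb_normalised_sample[OF B(4,2) v.cS'[OF B(1)]]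
  have oV1: "opb V1 b" "opb U1 b" "opb U2 b" "opb V2 b" by (rule v.oU1 u.oU1 u.oU2 v.oU2)+
  \<comment> \<open>Coercivity is spent once on \<open>tp K\<close>, supported in the Y coordinates,
    and once on \<open>K * tp D\<close>, supported in the X coordinates, at a cost of
    \<open>2 * b\<close> each.\<close>
  have KD_lower: "x\<^sup>2 / (4 * b\<^sup>2) \<le> (norm (D * K * tp D))\<^sup>2"
  proof -
    have "(norm (tp K))\<^sup>2 / (2 * b) \<le> (norm (D * tp K))\<^sup>2"
      by (rule u.H_lower[OF K(4) v.cS[OF K(3)]])
    also have "norm (D * tp K) = norm (K * tp D)" using norm_tp[of "K * tp D"] by simp
    finally have 1: "x\<^sup>2 / (2 * b) \<le> (norm (K * tp D))\<^sup>2" by (simp add: x_def)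
    have "(norm (K * tp D))\<^sup>2 / (2 * b) \<le> (norm (D * (K * tp D)))\<^sup>2"
      by (rule u.H_lower[OF _ u.cS]) (simp_all add: mult.assoc[symmetric] K)
    then have "(norm (K * tp D))\<^sup>2 \<le> (norm (D * (K * tp D)))\<^sup>2 * (2 * b)"
      using b by (simp add: pos_divide_le_eq)
    then have "(norm (K * tp D))\<^sup>2 * (2 * b) \<le> (norm (D * (K * tp D)))\<^sup>2 * (2 * b) * (2 * b)"
      using b by (intro mult_right_mono) auto
    moreover have "x\<^sup>2 \<le> (norm (K * tp D))\<^sup>2 * (2 * b)"
      using 1 b by (simp add: pos_divide_le_eq)
    ultimately have "x\<^sup>2 \<le> (norm (D * K * tp D))\<^sup>2 * (4 * b\<^sup>2)"
      by (simp add: power2_eq_square[of b] mult.assoc mult_ac)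
    then show ?thesis using b by (simp add: pos_divide_le_eq)
  qed
  have K_upper: "norm (D * K) \<le> 2 * b * x" "norm (D * tp K) \<le> 2 * b * x"
    using u.H_upper[OF K(2)] u.H_upper[OF K(4)] b x0 unfolding x_def norm_tp
    by (auto intro!: power2_le_imp_le)
  have DKD: "D * K * tp D = (D * A') * tp (D * B') - (D * A) * tp (D * B)"
    by (simp add: K_def algebra_simps)
  \<comment> \<open>\<open>N\<close> is the square root of \<open>L1 - lam *\<^sub>R J\<close>,
    which exists because the leading correlations are at least \<open>lam\<close>.\<close>
  have curv: "lam / 2 * (norm (D * K * tp D))\<^sup>2 \<le> inner (D * A' * L1 * tp (D * B')) (D * K * tp D)"
    unfolding DKD
  proof (rule curvature[where J = J and S = "{..<r}" and N = "diagm r (\<lambda>i. sqrt (l i - lam))"])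
    show "tp (D * A') * (D * A') = J" "tp (D * B') * (D * B') = J" "tp (D * A) * (D * A) = J" "tp (D * B) * (D * B) = J"
      using G(4) G'(4) A(4) B(4) by (simp_all add: u.HD mult.assoc)
    show "D * A' * J = D * A'" using A' by (simp add: mult.assoc)
    show "L1 = lam *\<^sub>R J + diagm r (\<lambda>i. sqrt (l i - lam)) * diagm r (\<lambda>i. sqrt (l i - lam))"
      unfolding L1(1) diagm_mult_diagm using L1(2) by (intro fmat_eqI) auto
    show "J * diagm r (\<lambda>i. sqrt (l i - lam)) = diagm r (\<lambda>i. sqrt (l i - lam))"
      by (intro fmat_eqI) (auto simp: ent_proj_mult)
  qed (use lam in auto)
  have lhs: "inner (D * A' * L1 * tp (D * B')) (D * K * tp D) = inner (H * A' * L1 * tp B' * H) K"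
  proof -
    have "inner (D * A' * L1 * tp (D * B')) (D * K * tp D) = inner (D * A' * L1 * tp (D * B') * D) (D * K)"
      using inner_mult_right[of "D * K" "tp D" "D * A' * L1 * tp (D * B')"] by (simp add: inner_commute)
    also have "\<dots> = inner (tp D * (D * A' * L1 * tp (D * B') * D)) K"
      using inner_mult_left[of D K "D * A' * L1 * tp (D * B') * D"] by (simp add: inner_commute)
    finally show ?thesis by (simp add: u.HD mult.assoc)
  qed
  \<comment> \<open>\<open>K\<close> lives on \<open>T\<close> and in the X-Y block, so a matrix
    paired with it may be compressed first; \<open>H\<close> and \<open>S\<close> are known to be
    close only after compression to \<open>T\<close>.\<close>
  have TT: "inner Z K = inner (proj T * Z * proj T) K" "inner Z K = inner (proj X * Z * proj Y) K" for Z
  proof -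
    have *: "inner (proj Q * Z * proj R) K = inner Z (proj Q * K * proj R)" for Q R
      using inner_mult_right[of "proj Q * Z" "proj R" K] inner_mult_left[of "proj Q" Z "K * proj R"]
      by (simp add: mult.assoc)
    show "inner Z K = inner (proj T * Z * proj T) K" "inner Z K = inner (proj X * Z * proj Y) K"
      unfolding * K tK by simp_all
  qed
  \<comment> \<open>The trace criterion is linear in the product of the two factors, so optimality
    is the sign of one inner product.\<close>
  have HK: "inner H K \<le> 0"
    using opt[OF G(1,2,3) _ G'(1,2,3)] G(4) G'(4) by (simp add: K_def A'_def B'_def inner_diff_right)
  define P where "P = S * U1 * L1 * tp V1 * S"
  define Q where "Q = S * U2 * L2 * tp V2 * S"
  have SK: "inner S K = inner P K + inner Q K"
  proof -
    have "inner S K = inner (S * (U1 * L1 * tp V1 + U2 * L2 * tp V2) * S) K"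
      using TT(2)[of S] TT(2)[of "S * (U1 * L1 * tp V1 + U2 * L2 * tp V2) * S"] Sxy by simp
    then show ?thesis by (simp add: P_def Q_def algebra_simps inner_add_left)
  qed
  have WK: "- inner (H - S) K \<le> lam * \<tau> * x"
  proof -
    have "inner (H - S) (A * tp B - A' * tp B') \<le> \<delta> * norm (A * tp B - A' * tp B')"
      by (rule sparse_small_diff[OF T u.small]) (use A A' B B' in simp_all)
    also have "A * tp B - A' * tp B' = - K" by (simp add: K_def)
    finally have "- inner (H - S) K \<le> \<delta> * x" by (simp add: x_def)
    also have "\<dots> \<le> lam * \<tau> * x" by (intro mult_right_mono dl x0)
    finally show ?thesis .
  qed
  \<comment> \<open>The two factors are exchanged one at a time, at costs with
    \<open>8 * b ^ 3\<close> and \<open>2 * b ^ 3\<close> in front of \<rho>.\<close>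
  have PK: "inner (H * A' * L1 * tp B' * H) K - inner P K \<le> \<kappa> * lam * (10 * b ^ 3 * u.\<rho>) * x"
  proof -
    let ?a = "proj T * S * U1" and ?a' = "proj T * H * A'" and ?b = "proj T * S * V1" and ?b' = "proj T * H * B'"
    have e: "(a' - a) * (L1 * tp f') + a * (L1 * tp (f' - f)) = a' * L1 * tp f' - a * L1 * tp f" for a a' f f'
      by (simp add: algebra_simps)
    have "inner (H * A' * L1 * tp B' * H) K = inner (?a' * L1 * tp ?b') K"
      by (subst TT(1)) (simp add: u.symH mult.assoc)
    moreover have "inner P K = inner (?a * L1 * tp ?b) K"
      by (subst TT(1)) (simp add: u.symS P_def mult.assoc)
    ultimately have "inner (H * A' * L1 * tp B' * H) K - inner P K = inner ((?a' - ?a) * (L1 * tp ?b') + ?a * (L1 * tp (?b' - ?b))) K"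
      by (simp only: e inner_diff_left)
    also have "\<dots> \<le> norm ((?a' - ?a) * (L1 * tp ?b') + ?a * (L1 * tp (?b' - ?b))) * x"
      unfolding x_def by (rule norm_cauchy_schwarz)
    also have "\<dots> \<le> ((\<kappa> * lam * (4 * b\<^sup>2)) * (2 * b * u.\<rho>) + (1 * b * b) * ((\<kappa> * lam) * (2 * b * u.\<rho>))) * x"
    proof (intro mult_right_mono x0 norm_triangle_le add_mono)
      have "norm ((?a' - ?a) * (L1 * tp ?b')) \<le> (\<kappa> * lam * (4 * b\<^sup>2)) * norm (?a' - ?a)"
        by (rule opbD2[OF opb_mult[OF oL1 opb_tp[OF G'(9)]]])
      also have "\<dots> \<le> (\<kappa> * lam * (4 * b\<^sup>2)) * (2 * b * u.\<rho>)"
        using G(8) \<kappa> lam b by (intro mult_left_mono) auto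
      finally show "norm ((?a' - ?a) * (L1 * tp ?b')) \<le> (\<kappa> * lam * (4 * b\<^sup>2)) * (2 * b * u.\<rho>)" .
      have "norm (?a * (L1 * tp (?b' - ?b))) \<le> (1 * b * b) * norm (L1 * tp (?b' - ?b))"
        by (rule opbD[OF opb_mult[OF opb_mult[OF opb_proj[OF T] u.oS] oV1(2)]])
      also have "\<dots> \<le> (1 * b * b) * ((\<kappa> * lam) * (2 * b * u.\<rho>))"
      proof (rule mult_left_mono)
        have "norm (L1 * tp (?b' - ?b)) \<le> \<kappa> * lam * norm (tp (?b' - ?b))" by (rule opbD[OF oL1])
        also have "\<dots> \<le> \<kappa> * lam * (2 * b * u.\<rho>)" unfolding norm_tp
          using G'(8) \<kappa> lam by (intro mult_left_mono) auto
        finally show "norm (L1 * tp (?b' - ?b)) \<le> \<kappa> * lam * (2 * b * u.\<rho>)" .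
      qed (use b in simp)
      finally show "norm (?a * (L1 * tp (?b' - ?b))) \<le> (1 * b * b) * ((\<kappa> * lam) * (2 * b * u.\<rho>))" .
    qed
    also have "\<dots> = \<kappa> * lam * (10 * b ^ 3 * u.\<rho>) * x"
      by (simp add: power2_eq_square power3_eq_cube algebra_simps)
    finally show ?thesis .
  qed
  define s where "s = b\<^sup>2 * u.\<rho>"
  have s0: "0 \<le> s" using \<rho>0 b by (simp add: s_def)
  \<comment> \<open>Since \<open>tp B * (H * B) = J\<close>, \<open>A\<close> equals
    \<open>(A * tp B) * (H * B)\<close> and is thereby expressed through the surrogate product and
    \<open>K\<close>. Its overlap with the residual directions is that of the surrogate plus a
    multiple of \<open>x\<close>.\<close>
  have SA: "norm (tp U2 * (S * A)) \<le> s + 2 * b ^ 3 * x"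
  proof -
    have "A = (A * tp B) * (H * B)" using A(3) B(4) by (simp add: mult.assoc)
    then have "A = (A' * tp B' - K) * (H * B)" by (simp add: K_def)
    then have "tp U2 * (S * A) = tp U2 * (S * ((A' * tp B' - K) * (H * B)))" by (rule arg_cong)
    also have "\<dots> = (tp U2 * (S * A')) * (tp (D * B') * (D * B)) - tp U2 * (S * (K * tp D * (D * B)))"
      by (simp add: u.HD algebra_simps)
    finally have "norm (tp U2 * (S * A)) \<le> norm ((tp U2 * (S * A')) * (tp (D * B') * (D * B))) + norm (tp U2 * (S * (K * tp D * (D * B))))"
      by (simp only: norm_triangle_ineq4)
    also have "\<dots> \<le> 1 * 1 * s + b * (b * (2 * b * x))"
    proof (intro add_mono)
      show "norm ((tp U2 * (S * A')) * (tp (D * B') * (D * B))) \<le> 1 * 1 * s"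
        using opbD2[OF opb_mult[OF opb_tp[OF G'(7)] oB(2)], of "tp U2 * (S * A')"] G(10)
        by (simp add: s_def)
      have "norm (K * tp D * (D * B)) \<le> 1 * norm (K * tp D)" by (rule opbD2[OF oB(2)])
      also have "norm (K * tp D) = norm (D * tp K)" using norm_tp[of "D * tp K"] by simp
      finally have *: "norm (K * tp D * (D * B)) \<le> 2 * b * x" using K_upper(2) by simp
      show "norm (tp U2 * (S * (K * tp D * (D * B)))) \<le> b * (b * (2 * b * x))"
        by (intro order_trans[OF opbD[OF opb_tp[OF oV1(3)]]] mult_left_mono order_trans[OF opbD[OF u.oS]] *)
          (use b in auto)
    qed
    finally show ?thesis by (simp add: power3_eq_cube mult.assoc)
  qed
  have SB: "norm (tp V2 * (S * B)) \<le> s + 2 * b ^ 3 * x"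
  proof -
    have "B = (B * tp A) * (H * A)" using B(3) A(4) by (simp add: mult.assoc)
    then have "B = (B' * tp A' - tp K) * (H * A)" by (simp add: K_def)
    then have "tp V2 * (S * B) = tp V2 * (S * ((B' * tp A' - tp K) * (H * A)))" by (rule arg_cong)
    also have "\<dots> = (tp V2 * (S * B')) * (tp (D * A') * (D * A)) - tp V2 * (S * (tp K * tp D * (D * A)))"
      by (simp add: u.HD algebra_simps)
    finally have "norm (tp V2 * (S * B)) \<le> norm ((tp V2 * (S * B')) * (tp (D * A') * (D * A))) + norm (tp V2 * (S * (tp K * tp D * (D * A))))"
      by (simp only: norm_triangle_ineq4)
    also have "\<dots> \<le> 1 * 1 * s + b * (b * (2 * b * x))"
    proof (intro add_mono)
      show "norm ((tp V2 * (S * B')) * (tp (D * A') * (D * A))) \<le> 1 * 1 * s"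
        using opbD2[OF opb_mult[OF opb_tp[OF G(7)] oA(2)], of "tp V2 * (S * B')"] G'(10)
        by (simp add: s_def)
      have "norm (tp K * tp D * (D * A)) \<le> 1 * norm (tp K * tp D)" by (rule opbD2[OF oA(2)])
      also have "norm (tp K * tp D) = norm (D * K)" using norm_tp[of "D * K"] by simp
      finally have *: "norm (tp K * tp D * (D * A)) \<le> 2 * b * x" using K_upper(1) by simp
      show "norm (tp V2 * (S * (tp K * tp D * (D * A)))) \<le> b * (b * (2 * b * x))"
        by (intro order_trans[OF opbD[OF opb_tp[OF oV1(4)]]] mult_left_mono order_trans[OF opbD[OF u.oS]] *)
          (use b in auto)
    qed
    finally show ?thesis by (simp add: power3_eq_cube mult.assoc)
  qed
  have Q_bound: "\<bar>inner Q (E * tp F)\<bar> \<le> c * lam * (e * f)"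
    if "norm (tp U2 * (S * E)) \<le> e" "norm (tp V2 * (S * F)) \<le> f" for E F e f
  proof -
    have "inner Q (E * tp F) = inner (L2 * (tp V2 * S)) ((tp U2 * S) * (E * tp F))"
      using inner_mult_left[of "S * U2" "L2 * (tp V2 * S)" "E * tp F"] by (simp add: Q_def u.symS mult.assoc)
    also have "\<dots> = inner (L2 * (tp V2 * S) * F) (tp U2 * (S * E))"
      using inner_mult_right[of "tp U2 * (S * E)" "tp F" "L2 * (tp V2 * S)"] u.symS
      by (simp add: inner_commute mult.assoc)
    also have "\<bar>\<dots>\<bar> \<le> norm (L2 * (tp V2 * (S * F))) * norm (tp U2 * (S * E))"
      using Cauchy_Schwarz_ineq2 by (simp add: mult.assoc)
    also have "\<dots> \<le> (c * lam * f) * e"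
    proof (intro mult_mono that order_trans[OF opbD[OF L2]] mult_left_mono)
      have "0 \<le> f" using that(2) norm_ge_zero order_trans by blast
      then show "0 \<le> c * lam * f" using c lam by simp
    qed (use c lam in auto)
    finally show ?thesis by (simp add: mult_ac)
  qed
  have QK: "- inner Q K \<le> c * lam * (s * s + (s + 2 * b ^ 3 * x) * (s + 2 * b ^ 3 * x))"
    using Q_bound[OF G(10) G'(10)] Q_bound[OF SA SB]
    by (simp add: K_def inner_diff_right s_def distrib_left)
  have main: "lam * (x\<^sup>2 / (8 * b\<^sup>2)) \<le> lam * (\<tau> * x + \<kappa> * (10 * b ^ 3 * u.\<rho>) * x
      + c * (s * s + (s + 2 * b ^ 3 * x) * (s + 2 * b ^ 3 * x)))"
  proof -
    have "lam * (x\<^sup>2 / (8 * b\<^sup>2)) = lam / 2 * (x\<^sup>2 / (4 * b\<^sup>2))" by simp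
    also have "\<dots> \<le> lam / 2 * (norm (D * K * tp D))\<^sup>2"
      using lam KD_lower by (intro mult_left_mono) auto
    also have "\<dots> \<le> inner (H * A' * L1 * tp B' * H) K - inner H K" using curv lhs HK by simp
    also have "\<dots> = - inner (H - S) K + (inner (H * A' * L1 * tp B' * H) K - inner P K) - inner Q K"
      using SK by (simp add: inner_diff_left)
    also have "\<dots> \<le> lam * \<tau> * x + \<kappa> * lam * (10 * b ^ 3 * u.\<rho>) * x
      + c * lam * (s * s + (s + 2 * b ^ 3 * x) * (s + 2 * b ^ 3 * x))"
      using WK PK QK by linarith
    finally show ?thesis by (simp add: algebra_simps)
  qed
  have b0: "0 < b" "1 \<le> b" using b by auto
  have cb: "c * (128 * b ^ 8) \<le> 1" using c b0 by (simp add: field_simps)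
  have x_quad: "x\<^sup>2 \<le> (176 * \<kappa> * b ^ 5 * u.\<rho>) * x + (7 * b * u.\<rho>)\<^sup>2"
  proof -
    have 1: "x\<^sup>2 / (8 * b\<^sup>2) \<le> \<tau> * x + \<kappa> * (10 * b ^ 3 * u.\<rho>) * x
      + c * (s * s + (s + 2 * b ^ 3 * x) * (s + 2 * b ^ 3 * x))"
      using main lam by (simp only: mult_le_cancel_left_pos)
    have "(s + 2 * b ^ 3 * x) * (s + 2 * b ^ 3 * x) \<le> 2 * (s * s) + 8 * b ^ 6 * x\<^sup>2"
    proof -
      have "0 \<le> (s - 2 * b ^ 3 * x)\<^sup>2" by simp
      moreover have "b ^ 3 * b ^ 3 = b ^ 6" by (simp add: power_add[symmetric])
      ultimately show ?thesis by (simp add: power2_eq_square algebra_simps)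
    qed
    then have "c * (s * s + (s + 2 * b ^ 3 * x) * (s + 2 * b ^ 3 * x)) \<le> c * (3 * (s * s) + 8 * b ^ 6 * x\<^sup>2)"
      using c by (intro mult_left_mono) auto
    \<comment> \<open>Here \<open>c\<close> is used: \<open>8 * c * b ^ 6\<close> is at most
      \<open>1 / (16 * b\<^sup>2)\<close>, half of the curvature constant
      \<open>1 / (8 * b\<^sup>2)\<close>.\<close>
    also have "\<dots> \<le> 3 * u.\<rho>\<^sup>2 + x\<^sup>2 / (16 * b\<^sup>2)"
    proof -
      have e: "b ^ 8 = b ^ 6 * b\<^sup>2" "b ^ 8 = b ^ 4 * b ^ 4" by (simp_all add: power_add[symmetric])
      have "c * 8 * b ^ 6 \<le> 1 / (16 * b\<^sup>2)"
        using cb b0 unfolding e(1) by (simp add: field_simps)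
      then have 2: "c * 8 * b ^ 6 * x\<^sup>2 \<le> 1 / (16 * b\<^sup>2) * x\<^sup>2" by (rule mult_right_mono) simp
      have "1 \<le> b ^ 4" using b0 by simp
      then have "c * b ^ 4 * 1 \<le> c * b ^ 4 * b ^ 4" using c b0 by (intro mult_left_mono) auto
      also have "\<dots> = c * (1 * b ^ 8)" by (simp only: e(2) mult_1_left mult.assoc)
      also have "\<dots> \<le> c * (128 * b ^ 8)" using c b0 by (intro mult_left_mono mult_right_mono) auto
      also note cb
      finally have "c * b ^ 4 \<le> 1" by simp
      then have "c * b ^ 4 * u.\<rho>\<^sup>2 \<le> 1 * u.\<rho>\<^sup>2" by (rule mult_right_mono) simp
      moreover have "c * (3 * (s * s) + 8 * b ^ 6 * x\<^sup>2) = 3 * (c * b ^ 4 * u.\<rho>\<^sup>2) + c * 8 * b ^ 6 * x\<^sup>2"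
      proof -
        have "s * s = b ^ 4 * u.\<rho>\<^sup>2" by (simp add: s_def power2_eq_square eval_nat_numeral)
        then show ?thesis by (simp add: distrib_left)
      qed
      moreover have "1 / (16 * b\<^sup>2) * x\<^sup>2 = x\<^sup>2 / (16 * b\<^sup>2)" by simp
      ultimately show ?thesis using 2 by linarith
    qed
    finally have 3: "x\<^sup>2 / (16 * b\<^sup>2) \<le> (\<tau> + \<kappa> * (10 * b ^ 3 * u.\<rho>)) * x + 3 * u.\<rho>\<^sup>2"
      using 1 by (simp add: algebra_simps)
    have "\<tau> \<le> \<kappa> * (b ^ 3 * u.\<rho>)"
    proof -
      have "\<tau> \<le> u.\<rho>" using u.\<tau>\<rho> \<tau>0 by simp
      also have "1 * (1 * u.\<rho>) \<le> \<kappa> * (b ^ 3 * u.\<rho>)"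
        using b0 \<kappa> \<rho>0 by (intro mult_mono) (auto intro: mult_right_mono)
      finally show ?thesis by simp
    qed
    then have "(\<tau> + \<kappa> * (10 * b ^ 3 * u.\<rho>)) * x \<le> (11 * \<kappa> * b ^ 3 * u.\<rho>) * x"
      by (intro mult_right_mono x0) (simp add: mult_ac)
    with 3 have "x\<^sup>2 / (16 * b\<^sup>2) \<le> (11 * \<kappa> * b ^ 3 * u.\<rho>) * x + 3 * u.\<rho>\<^sup>2" by simp
    then have "x\<^sup>2 \<le> ((11 * \<kappa> * b ^ 3 * u.\<rho>) * x + 3 * u.\<rho>\<^sup>2) * (16 * b\<^sup>2)"
      using b0 by (simp add: pos_divide_le_eq)
    also have "\<dots> = (176 * \<kappa> * b ^ 5 * u.\<rho>) * x + 48 * (b * u.\<rho>)\<^sup>2"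
      by (simp add: algebra_simps power2_eq_square eval_nat_numeral)
    \<comment> \<open>48 is raised to 49, so that the constant term is a square, as
      \<open>quadratic_bound\<close> wants it.\<close>
    also have "\<dots> \<le> (176 * \<kappa> * b ^ 5 * u.\<rho>) * x + (7 * b * u.\<rho>)\<^sup>2"
      by (simp add: power_mult_distrib)
    finally show ?thesis .
  qed
  have xb: "x \<le> 183 * \<kappa> * b ^ 5 * u.\<rho>"
  proof -
    have "x \<le> 176 * \<kappa> * b ^ 5 * u.\<rho> + 7 * b * u.\<rho>"
      by (rule quadratic_bound[OF x_quad]) (use \<kappa> b0 \<rho>0 in auto)
    moreover have "7 * (1 * b) * u.\<rho> \<le> 7 * (\<kappa> * b ^ 5) * u.\<rho>"
      using b0 \<kappa> \<rho>0 by (intro mult_right_mono mult_left_mono mult_mono self_le_power) auto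
    ultimately show ?thesis by (simp add: algebra_simps)
  qed
  have "A * tp B - U1 * tp V1 = (A' - U1) * tp B' + U1 * tp (B' - V1) - K"
    by (simp add: K_def algebra_simps)
  then have "norm (A * tp B - U1 * tp V1) \<le> norm ((A' - U1) * tp B' + U1 * tp (B' - V1)) + x"
    by (simp only: norm_triangle_ineq4 x_def)
  also have "norm ((A' - U1) * tp B' + U1 * tp (B' - V1)) \<le> 2 * b * u.\<rho> + b * u.\<rho>"
  proof (intro norm_triangle_le add_mono)
    show "norm ((A' - U1) * tp B') \<le> 2 * b * u.\<rho>"
      by (rule order_trans[OF opbD2[OF opb_tp[OF G'(6)]] mult_left_mono[OF G(5)]]) (use b0 in auto)
    show "norm (U1 * tp (B' - V1)) \<le> b * u.\<rho>"
      by (rule order_trans[OF opbD[OF oV1(2)]]) (use G'(5) b0 in \<open>simp only: norm_tp, simp\<close>)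
  qed
  also have "2 * b * u.\<rho> + b * u.\<rho> + x \<le> 186 * \<kappa> * b ^ 5 * u.\<rho>"
  proof -
    have "3 * (1 * b) * u.\<rho> \<le> 3 * (\<kappa> * b ^ 5) * u.\<rho>"
      using b0 \<kappa> \<rho>0 by (intro mult_right_mono mult_left_mono mult_mono self_le_power) auto
    with xb show ?thesis by (simp add: algebra_simps)
  qed
  \<comment> \<open>\<open>5394 = 186 * 29\<close>, with 29 from the definition of \<rho>.\<close>
  also have "186 * \<kappa> * b ^ 5 * u.\<rho> = 5394 * \<kappa> * b ^ 8 * \<tau>"
    by (simp add: u.\<rho>_def eval_nat_numeral)
  also have "\<dots> \<le> 6000 * \<kappa> * b ^ 8 * \<tau>"
    using \<kappa> b0 \<tau>0 by (intro mult_right_mono) auto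
  finally show ?thesis by simp
qed

end

section \<open>Gaussian integrals\<close>

interpretation lborel_prod: product_sigma_finite "\<lambda>_::nat. lborel :: real measure"
  by standard

text \<open>Completing the square turns the integrand into a multiple of the normal density with
  mean \<open>\<beta> / \<alpha>\<close> and variance \<open>1 / \<alpha>\<close>.\<close>

lemma gaussian_integral_1d:
  fixes \<alpha> \<beta> :: real
  assumes "0 < \<alpha>"
  shows "(\<integral>\<^sup>+ y. ennreal (exp (\<beta> * y - \<alpha> * y\<^sup>2 / 2)) \<partial>lborel) = ennreal (sqrt (2 * pi / \<alpha>) * exp (\<beta>\<^sup>2 / (2 * \<alpha>)))"
proof -
  let ?d = "normal_density (\<beta> / \<alpha>) (1 / sqrt \<alpha>)"
  have e: "exp (\<beta> * y - \<alpha> * y\<^sup>2 / 2) = (sqrt (2 * pi / \<alpha>) * exp (\<beta>\<^sup>2 / (2 * \<alpha>))) * ?d y" for y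
  proof -
    have "(1 / sqrt \<alpha>)\<^sup>2 = 1 / \<alpha>" using assms by (simp add: power_divide)
    then have "?d y = 1 / sqrt (2 * pi / \<alpha>) * exp (- (y - \<beta> / \<alpha>)\<^sup>2 * \<alpha> / 2)"
      by (simp add: normal_density_def)
    moreover have "- (y - \<beta> / \<alpha>)\<^sup>2 * \<alpha> / 2 = (\<beta> * y - \<alpha> * y\<^sup>2 / 2) - \<beta>\<^sup>2 / (2 * \<alpha>)"
      using assms by (simp add: field_simps power2_eq_square)
    ultimately show ?thesis using assms by (simp add: exp_diff)
  qed
  interpret prob_space "density lborel ?d"
    using assms by (intro prob_space_normal_density) simp
  have "(\<integral>\<^sup>+ y. ennreal (?d y) \<partial>lborel) = 1"
    using emeasure_space_1 by (simp add: emeasure_density)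
  then show ?thesis unfolding e
    by (subst ennreal_mult) (use assms in \<open>auto simp: nn_integral_cmult\<close>)
qed

lemma PiM_Suc: "Pi\<^sub>M {..<Suc d} M = Pi\<^sub>M (insert d {..<d}) M"
  by (simp add: lessThan_Suc)

text \<open>The arithmetic of one induction step. \<open>F\<close>, \<open>s\<close>,
  \<open>t\<close> are the squared norm of the leading block, that of the last column above the
  corner, and the corner entry; \<open>f\<close> is the squared norm of the matrix left after
  integration. \<open>F + 2 * s + t\<^sup>2\<close> is the squared norm of the whole matrix, so the
  exponent reproduces itself: the terms in \<open>s\<close> add up to \<open>25 / 18 * s\<close>,
  within the available \<open>2 * s\<close>.\<close>

lemma gaussian_quadratic_step:
  fixes F s t tr e f \<alpha> :: real
  assumes a: "\<bar>t\<bar> \<le> 1 / 4" and s: "0 \<le> s" "s \<le> 1 / 32" and F': "f \<le> F + 2 * (s / 4) / (1 - t) + s\<^sup>2 / (1 - t)\<^sup>2"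
  shows "f \<le> F + 2 * s" and
    "sqrt (2 * pi / (1 - t)) * exp ((tr + s / (1 - t)) / 2 + f) \<le> sqrt (2 * pi) * exp ((tr + t) / 2 + (F + 2 * s + t\<^sup>2))"
proof -
  have t: "3 / 4 \<le> 1 - t" using a by (simp add: abs_le_iff)
  then have i: "1 / (1 - t) \<le> 4 / 3" by (simp add: field_simps)
  have 1: "s / (1 - t) \<le> s * (4 / 3)" using mult_left_mono[OF i s(1)] by simp
  have 2: "s\<^sup>2 / (1 - t)\<^sup>2 \<le> s / 18"
  proof -
    have "s\<^sup>2 / (1 - t)\<^sup>2 = (s / (1 - t)) * (s / (1 - t))" by (simp add: power2_eq_square)
    also have "\<dots> \<le> (s * (4 / 3)) * (1 / 32 * (4 / 3))"
      using 1 s t by (intro mult_mono order_trans[OF 1]) auto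
    finally show ?thesis by simp
  qed
  have "2 * (s / 4) / (1 - t) = s / (1 - t) / 2" by simp
  then have f: "f \<le> F + 13 / 18 * s" using F' 1 2 by linarith
  then show "f \<le> F + 2 * s" using s by simp
  have ln: "- ln (1 - t) / 2 \<le> t / 2 + t\<^sup>2"
    using abs_ln_one_plus_x_minus_x_bound[of "- t"] a by (simp add: abs_le_iff)
  have "sqrt (2 * pi / (1 - t)) = sqrt (2 * pi) * exp (- ln (1 - t) / 2)"
  proof -
    have "exp (- ln (1 - t) / 2) = 1 / sqrt (1 - t)"
      using t by (simp add: exp_minus field_simps powr_half_sqrt[symmetric] powr_def)
    then show ?thesis by (simp add: real_sqrt_divide)
  qed
  then have "sqrt (2 * pi / (1 - t)) * exp ((tr + s / (1 - t)) / 2 + f)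
    = sqrt (2 * pi) * exp (- ln (1 - t) / 2 + ((tr + s / (1 - t)) / 2 + f))"
    by (simp only: exp_add mult.assoc)
  also have "\<dots> \<le> sqrt (2 * pi) * exp ((tr + t) / 2 + (F + 2 * s + t\<^sup>2))"
  proof (intro mult_left_mono)
    show "exp (- ln (1 - t) / 2 + ((tr + s / (1 - t)) / 2 + f)) \<le> exp ((tr + t) / 2 + (F + 2 * s + t\<^sup>2))"
      unfolding exp_le_cancel_iff using ln 1 f s by argo
  qed simp
  finally show "sqrt (2 * pi / (1 - t)) * exp ((tr + s / (1 - t)) / 2 + f)
    \<le> sqrt (2 * pi) * exp ((tr + t) / 2 + (F + 2 * s + t\<^sup>2))" .
qed

lemma abs_le_of_power2: "(x::real)\<^sup>2 \<le> y\<^sup>2 \<Longrightarrow> 0 \<le> y \<Longrightarrow> \<bar>x\<bar> \<le> y"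
  using abs_le_square_iff[of x y] by simp

text \<open>Integrating out the last coordinate turns \<open>I - A\<close> into its Schur complement, so neither
  determinants nor eigenvalues are needed.\<close>
lemma gaussian_quadratic_integral:
  fixes a :: "nat \<Rightarrow> nat \<Rightarrow> real"
  assumes "\<And>i j. a i j = a j i" "(\<Sum>i<d. \<Sum>j<d. (a i j)\<^sup>2) \<le> 1 / 16"
  shows "(\<integral>\<^sup>+ g. ennreal (exp ((\<Sum>i<d. \<Sum>j<d. a i j * g i * g j) / 2 - (\<Sum>i<d. (g i)\<^sup>2) / 2)) \<partial>(\<Pi>\<^sub>M i\<in>{..<d}. lborel))
    \<le> ennreal (sqrt (2 * pi) ^ d * exp ((\<Sum>i<d. a i i) / 2 + (\<Sum>i<d. \<Sum>j<d. (a i j)\<^sup>2)))"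
  using assms
proof (induction d arbitrary: a)
  case 0
  show ?case by (simp add: PiM_empty nn_integral_count_space_finite)
next
  case (Suc d)
  define t where "t = a d d"
  define s where "s = (\<Sum>i<d. (a i d)\<^sup>2)"
  define F where "F = (\<Sum>i<d. \<Sum>j<d. (a i j)\<^sup>2)"
  define tr where "tr = (\<Sum>i<d. a i i)"
  define \<alpha> where "\<alpha> = 1 - t"
  define a' where "a' = (\<lambda>i j. a i j + a i d * a j d / \<alpha>)"
  define f where "f = (\<Sum>i<d. \<Sum>j<d. (a' i j)\<^sup>2)"
  have sym: "a d j = a j d" for j by (rule Suc.prems)
  have tot: "(\<Sum>i<Suc d. \<Sum>j<Suc d. (a i j)\<^sup>2) = F + 2 * s + t\<^sup>2"
  proof -
    have "(\<Sum>j<d. (a d j)\<^sup>2) = s" unfolding s_def by (intro sum.cong refl) (simp only: sym)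
    then show ?thesis by (simp add: F_def s_def t_def sum.distrib)
  qed
  have s0: "0 \<le> s" and F0: "0 \<le> F" by (auto simp: s_def F_def intro!: sum_nonneg)
  have le: "F + 2 * s + t\<^sup>2 \<le> 1 / 16" using Suc.prems(2) tot by simp
  have t2: "0 \<le> t\<^sup>2" by simp
  have s1: "s \<le> 1 / 32" using le F0 t2 by linarith
  have "t\<^sup>2 \<le> 1 / 16" using le F0 s0 by linarith
  then have "t\<^sup>2 \<le> (1 / 4)\<^sup>2" by (simp add: power_divide)
  then have t1: "\<bar>t\<bar> \<le> 1 / 4" by (rule abs_le_of_power2) simp
  then have \<alpha>: "0 < \<alpha>" by (simp add: \<alpha>_def abs_le_iff)
  \<comment> \<open>Cauchy-Schwarz gives \<open>sqrt F * s\<close>, and \<open>F\<close> is at most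
    \<open>1 / 16\<close>.\<close>
  have cross: "\<bar>\<Sum>i<d. \<Sum>j<d. a i j * (a i d * a j d)\<bar> \<le> s / 4"
  proof (rule abs_le_of_power2)
    have "(\<Sum>i<d. \<Sum>j<d. a i j * (a i d * a j d))\<^sup>2 \<le> F * (\<Sum>i<d. \<Sum>j<d. (a i d * a j d)\<^sup>2)"
      unfolding F_def sum.cartesian_product split_def by (rule Cauchy_Schwarz_ineq_sum)
    also have "(\<Sum>i<d. \<Sum>j<d. (a i d * a j d)\<^sup>2) = s\<^sup>2"
      by (simp add: s_def power2_eq_square sum_product mult_ac)
    also have "F * s\<^sup>2 \<le> 1 / 16 * s\<^sup>2"
    proof (rule mult_right_mono)
      show "F \<le> 1 / 16" using le s0 t2 by linarith
    qed simp
    finally show "(\<Sum>i<d. \<Sum>j<d. a i j * (a i d * a j d))\<^sup>2 \<le> (s / 4)\<^sup>2" by (simp add: power_divide)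
  qed (use s0 in simp)
  have f_eq: "f = F + 2 * (\<Sum>i<d. \<Sum>j<d. a i j * (a i d * a j d)) / \<alpha> + s\<^sup>2 / \<alpha>\<^sup>2"
  proof -
    have "f = (\<Sum>i<d. \<Sum>j<d. (a i j)\<^sup>2 + 2 / \<alpha> * (a i j * (a i d * a j d)) + (a i d)\<^sup>2 * (a j d)\<^sup>2 * (1 / \<alpha>\<^sup>2))"
      unfolding f_def a'_def by (intro sum.cong refl) (simp add: power2_eq_square algebra_simps add_divide_distrib)
    also have "\<dots> = F + 2 / \<alpha> * (\<Sum>i<d. \<Sum>j<d. a i j * (a i d * a j d)) + (\<Sum>i<d. \<Sum>j<d. (a i d)\<^sup>2 * (a j d)\<^sup>2) * (1 / \<alpha>\<^sup>2)"
      by (simp only: sum.distrib F_def sum_distrib_left sum_distrib_right)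
    also have "(\<Sum>i<d. \<Sum>j<d. (a i d)\<^sup>2 * (a j d)\<^sup>2) = s\<^sup>2"
      by (simp add: s_def power2_eq_square[of "sum _ _"] sum_product)
    finally show ?thesis by simp
  qed
  have "f \<le> F + 2 * (s / 4) / (1 - t) + s\<^sup>2 / (1 - t)\<^sup>2"
    unfolding f_eq \<alpha>_def[symmetric] using cross \<alpha>
    by (intro add_mono order_refl divide_right_mono mult_left_mono) (auto simp: abs_le_iff)
  note step = gaussian_quadratic_step[OF t1 s0 s1 this]
  \<comment> \<open>The matrix left after integration is as small as the original one, so the
    induction hypothesis applies to it.\<close>
  have f16: "f \<le> 1 / 16" using step(1) le t2 by linarith
  define q where "q = (\<lambda>x::nat \<Rightarrow> real. (\<Sum>i<d. \<Sum>j<d. a i j * x i * x j) / 2 - (\<Sum>i<d. (x i)\<^sup>2) / 2)"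
  define B where "B = (\<lambda>x::nat \<Rightarrow> real. \<Sum>i<d. a i d * x i)"
  have split: "(\<Sum>i<Suc d. \<Sum>j<Suc d. a i j * (x(d := y)) i * (x(d := y)) j) / 2 - (\<Sum>i<Suc d. ((x(d := y)) i)\<^sup>2) / 2
      = q x + (B x * y - \<alpha> * y\<^sup>2 / 2)" for x y
  proof -
    have "(\<Sum>i<Suc d. \<Sum>j<Suc d. a i j * (x(d := y)) i * (x(d := y)) j)
      = (\<Sum>i<d. \<Sum>j<d. a i j * x i * x j) + (\<Sum>i<d. a i d * x i * y) + (\<Sum>j<d. a d j * y * x j) + t * y * y"
      by (simp add: sum.distrib t_def)
    also have "(\<Sum>i<d. a i d * x i * y) = B x * y" by (simp add: B_def sum_distrib_right)
    also have "(\<Sum>j<d. a d j * y * x j) = B x * y"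
      unfolding B_def sum_distrib_right by (intro sum.cong refl) (simp add: sym)
    finally have "(\<Sum>i<Suc d. \<Sum>j<Suc d. a i j * (x(d := y)) i * (x(d := y)) j)
      = (\<Sum>i<d. \<Sum>j<d. a i j * x i * x j) + 2 * (B x * y) + t * y * y" by simp
    moreover have "(\<Sum>i<Suc d. ((x(d := y)) i)\<^sup>2) = (\<Sum>i<d. (x i)\<^sup>2) + y\<^sup>2" by simp
    ultimately show ?thesis unfolding q_def \<alpha>_def by (simp add: power2_eq_square[of y] field_simps)
  qed
  have q': "q x + (B x)\<^sup>2 / (2 * \<alpha>) = (\<Sum>i<d. \<Sum>j<d. a' i j * x i * x j) / 2 - (\<Sum>i<d. (x i)\<^sup>2) / 2" for x
  proof -
    have "(\<Sum>i<d. \<Sum>j<d. a' i j * x i * x j) = (\<Sum>i<d. \<Sum>j<d. a i j * x i * x j + (a i d * x i) * (a j d * x j) * (1 / \<alpha>))"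
      unfolding a'_def by (intro sum.cong refl) (simp add: algebra_simps)
    also have "\<dots> = (\<Sum>i<d. \<Sum>j<d. a i j * x i * x j) + (\<Sum>i<d. \<Sum>j<d. (a i d * x i) * (a j d * x j)) * (1 / \<alpha>)"
      by (simp only: sum.distrib sum_distrib_right)
    also have "(\<Sum>i<d. \<Sum>j<d. (a i d * x i) * (a j d * x j)) = (B x)\<^sup>2"
      by (simp add: B_def power2_eq_square sum_product)
    finally show ?thesis using \<alpha> by (simp add: q_def field_simps)
  qed
  have "(\<integral>\<^sup>+ g. ennreal (exp ((\<Sum>i<Suc d. \<Sum>j<Suc d. a i j * g i * g j) / 2 - (\<Sum>i<Suc d. (g i)\<^sup>2) / 2)) \<partial>(\<Pi>\<^sub>M i\<in>{..<Suc d}. lborel))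
    = (\<integral>\<^sup>+ x. (\<integral>\<^sup>+ y. ennreal (exp (q x + (B x * y - \<alpha> * y\<^sup>2 / 2))) \<partial>lborel) \<partial>(\<Pi>\<^sub>M i\<in>{..<d}. lborel))"
  proof -
    have "(\<lambda>g. ennreal (exp ((\<Sum>i<Suc d. \<Sum>j<Suc d. a i j * g i * g j) / 2 - (\<Sum>i<Suc d. (g i)\<^sup>2) / 2)))
      \<in> borel_measurable (\<Pi>\<^sub>M i\<in>{..<Suc d}. lborel)"
      by measurable
    then show ?thesis unfolding PiM_Suc
      by (subst lborel_prod.product_nn_integral_insert) (simp_all only: split finite_lessThan lessThan_iff less_irrefl not_False_eq_True)
  qed
  also have "\<dots> = (\<integral>\<^sup>+ x. ennreal (sqrt (2 * pi / \<alpha>)) * ennreal (exp ((\<Sum>i<d. \<Sum>j<d. a' i j * x i * x j) / 2 - (\<Sum>i<d. (x i)\<^sup>2) / 2)) \<partial>(\<Pi>\<^sub>M i\<in>{..<d}. lborel))"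
  proof (intro nn_integral_cong)
    fix x :: "nat \<Rightarrow> real"
    have "(\<integral>\<^sup>+ y. ennreal (exp (q x + (B x * y - \<alpha> * y\<^sup>2 / 2))) \<partial>lborel)
      = ennreal (exp (q x)) * (\<integral>\<^sup>+ y. ennreal (exp (B x * y - \<alpha> * y\<^sup>2 / 2)) \<partial>lborel)"
      by (subst nn_integral_cmult[symmetric]) (auto simp: exp_add ennreal_mult)
    also have "\<dots> = ennreal (exp (q x)) * ennreal (sqrt (2 * pi / \<alpha>) * exp ((B x)\<^sup>2 / (2 * \<alpha>)))"
      by (simp only: gaussian_integral_1d[OF \<alpha>])
    also have "\<dots> = ennreal (sqrt (2 * pi / \<alpha>)) * ennreal (exp (q x + (B x)\<^sup>2 / (2 * \<alpha>)))"
      using \<alpha> by (simp add: exp_add ennreal_mult[symmetric] mult_ac)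
    finally show "(\<integral>\<^sup>+ y. ennreal (exp (q x + (B x * y - \<alpha> * y\<^sup>2 / 2))) \<partial>lborel)
      = ennreal (sqrt (2 * pi / \<alpha>)) * ennreal (exp ((\<Sum>i<d. \<Sum>j<d. a' i j * x i * x j) / 2 - (\<Sum>i<d. (x i)\<^sup>2) / 2))"
      by (simp only: q')
  qed
  also have "\<dots> = ennreal (sqrt (2 * pi / \<alpha>)) * (\<integral>\<^sup>+ x. ennreal (exp ((\<Sum>i<d. \<Sum>j<d. a' i j * x i * x j) / 2 - (\<Sum>i<d. (x i)\<^sup>2) / 2)) \<partial>(\<Pi>\<^sub>M i\<in>{..<d}. lborel))"
    by (rule nn_integral_cmult) simp
  also have "\<dots> \<le> ennreal (sqrt (2 * pi / \<alpha>)) * ennreal (sqrt (2 * pi) ^ d * exp ((\<Sum>i<d. a' i i) / 2 + f))"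
    unfolding f_def
    by (intro mult_left_mono Suc.IH) (use Suc.prems(1) f16 in \<open>auto simp: a'_def f_def mult.commute\<close>)
  also have "(\<Sum>i<d. a' i i) = tr + s / \<alpha>"
    by (simp add: a'_def tr_def s_def sum.distrib sum_divide_distrib power2_eq_square)
  also have "ennreal (sqrt (2 * pi / \<alpha>)) * ennreal (sqrt (2 * pi) ^ d * exp ((tr + s / \<alpha>) / 2 + f))
    = ennreal (sqrt (2 * pi) ^ d * (sqrt (2 * pi / \<alpha>) * exp ((tr + s / \<alpha>) / 2 + f)))"
    using \<alpha> by (simp add: ennreal_mult[symmetric] mult_ac)
  also have "\<dots> \<le> ennreal (sqrt (2 * pi) ^ d * (sqrt (2 * pi) * exp ((tr + t) / 2 + (F + 2 * s + t\<^sup>2))))"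
    unfolding \<alpha>_def by (intro ennreal_leI mult_left_mono step(2)) simp
  finally show ?case unfolding tot by (simp add: tr_def t_def mult_ac)
qed

text \<open>With the earlier coordinates fixed, the last one undergoes a one-dimensional affine
  substitution with slope \<open>L d d\<close>. Fubini and induction then produce the product of the
  diagonal as Jacobian.\<close>

lemma lower_triangular_change_of_variables:
  fixes L :: "nat \<Rightarrow> nat \<Rightarrow> real"
  assumes "\<And>i. i < d \<Longrightarrow> 0 < L i i" "f \<in> borel_measurable (\<Pi>\<^sub>M i\<in>{..<d}. lborel)"
  shows "(\<integral>\<^sup>+ z. f z \<partial>(\<Pi>\<^sub>M i\<in>{..<d}. lborel))
    = ennreal (\<Prod>i<d. L i i) * (\<integral>\<^sup>+ g. f (\<lambda>i\<in>{..<d}. \<Sum>j<Suc i. L i j * g j) \<partial>(\<Pi>\<^sub>M i\<in>{..<d}. lborel))"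
  using assms
proof (induction d arbitrary: f)
  case 0
  have "(\<lambda>i\<in>{}. \<Sum>j<Suc i. L i j * g j) = (\<lambda>_. undefined)" for g by auto
  then show ?case by (simp add: PiM_empty nn_integral_count_space_finite)
next
  case (Suc d)
  let ?M = "\<lambda>d. \<Pi>\<^sub>M i\<in>{..<d::nat}. (lborel :: real measure)"
  let ?T = "\<lambda>d g. \<lambda>i\<in>{..<d}. \<Sum>j<Suc i. L i j * g j"
  have f[measurable]: "f \<in> borel_measurable (\<Pi>\<^sub>M i\<in>insert d {..<d}. lborel)" using Suc.prems(2) by (simp add: PiM_Suc)
  have L: "0 < L d d" using Suc.prems(1) by simp
  define h where "h x = (\<integral>\<^sup>+ y. f (x(d := y)) \<partial>lborel)" for x
  have h: "h \<in> borel_measurable (?M d)" unfolding h_def by measurable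
  have T: "?T d \<in> measurable (?M d) (?M d)" by measurable
  have [measurable]: "?T (Suc d) \<in> measurable (\<Pi>\<^sub>M i\<in>insert d {..<d}. lborel) (\<Pi>\<^sub>M i\<in>insert d {..<d}. lborel)"
    unfolding lessThan_Suc[symmetric]
    by (rule measurable_restrict) (auto intro!: borel_measurable_sum)
  have hT: "h (?T d g) = ennreal (L d d) * (\<integral>\<^sup>+ y. f (?T (Suc d) (g(d := y))) \<partial>lborel)" if "g \<in> space (?M d)" for g
  proof -
    let ?c = "\<Sum>j<d. L d j * g j"
    have "?T d g \<in> space (?M d)" by (auto simp: space_PiM)
    then have m: "(\<lambda>y. f ((?T d g)(d := y))) \<in> borel_measurable borel" by measurable
    have e: "(?T d g)(d := ?c + L d d * y) = ?T (Suc d) (g(d := y))" for y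
      by (rule ext) (auto simp: less_Suc_eq intro!: sum.cong)
    have "h (?T d g) = ennreal \<bar>L d d\<bar> * (\<integral>\<^sup>+ y. f ((?T d g)(d := ?c + L d d * y)) \<partial>lborel)"
      unfolding h_def using L m by (intro nn_integral_real_affine) auto
    then show ?thesis using L by (simp only: e abs_of_pos)
  qed
  have m2: "(\<lambda>g. f (?T (Suc d) g)) \<in> borel_measurable (\<Pi>\<^sub>M i\<in>insert d {..<d}. lborel)" by measurable
  then have m3: "(\<lambda>g. \<integral>\<^sup>+ y. f (?T (Suc d) (g(d := y))) \<partial>lborel) \<in> borel_measurable (?M d)" by measurable
  have "(\<integral>\<^sup>+ z. f z \<partial>?M (Suc d)) = (\<integral>\<^sup>+ x. h x \<partial>?M d)"
    unfolding PiM_Suc h_def by (subst lborel_prod.product_nn_integral_insert) auto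
  also have "\<dots> = ennreal (\<Prod>i<d. L i i) * (\<integral>\<^sup>+ g. h (?T d g) \<partial>?M d)"
    by (rule Suc.IH[OF _ h]) (use Suc.prems in auto)
  also have "(\<integral>\<^sup>+ g. h (?T d g) \<partial>?M d) = (\<integral>\<^sup>+ g. ennreal (L d d) * (\<integral>\<^sup>+ y. f (?T (Suc d) (g(d := y))) \<partial>lborel) \<partial>?M d)"
    by (intro nn_integral_cong hT)
  also have "\<dots> = ennreal (L d d) * (\<integral>\<^sup>+ g. (\<integral>\<^sup>+ y. f (?T (Suc d) (g(d := y))) \<partial>lborel) \<partial>?M d)"
    by (rule nn_integral_cmult[OF m3])
  also have "(\<integral>\<^sup>+ g. (\<integral>\<^sup>+ y. f (?T (Suc d) (g(d := y))) \<partial>lborel) \<partial>?M d) = (\<integral>\<^sup>+ g. f (?T (Suc d) g) \<partial>?M (Suc d))"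
    unfolding PiM_Suc using m2 by (subst lborel_prod.product_nn_integral_insert) auto
  also have "ennreal (\<Prod>i<d. L i i) * (ennreal (L d d) * (\<integral>\<^sup>+ g. f (?T (Suc d) g) \<partial>?M (Suc d)))
    = ennreal (\<Prod>i<Suc d. L i i) * (\<integral>\<^sup>+ g. f (?T (Suc d) g) \<partial>?M (Suc d))"
  proof -
    have "ennreal (\<Prod>i<Suc d. L i i) = ennreal (\<Prod>i<d. L i i) * ennreal (L d d)"
      unfolding prod.lessThan_Suc
      by (intro ennreal_mult prod_nonneg ballI less_imp_le L Suc.prems(1)) simp
    then show ?thesis by (simp only: mult.assoc)
  qed
  finally show ?case .
qed

section \<open>Matrices as finitely supported matrices\<close>

definition fm :: "real mat \<Rightarrow> fmat" where
  "fm A = mk (max (dim_row A) (dim_col A)) (\<lambda>i j. if i < dim_row A \<and> j < dim_col A then A $$ (i, j) else 0)"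

lemma ent_fm: "ent (fm A) i j = (if i < dim_row A \<and> j < dim_col A then A $$ (i, j) else 0)"
  by (auto simp: fm_def ent_mk)

lemma fm_mult: "dim_col A = dim_row B \<Longrightarrow> fm (A * B) = fm A * fm B"
proof (rule fmat_eqI)
  fix i j assume d: "dim_col A = dim_row B"
  let ?N = "max (max (dim_row A) (dim_col A)) (max (dim_row B) (dim_col B))"
  have w: "corner ?N (fm A)" by (auto simp: corner_def ent_fm)
  have "ent (fm A * fm B) i j = (\<Sum>l<?N. ent (fm A) i l * ent (fm B) l j)"
    using w by (intro ent_mult_corner) simp
  also have "\<dots> = (\<Sum>l<dim_row B. ent (fm A) i l * ent (fm B) l j)"
    by (rule sum.mono_neutral_right) (auto simp: ent_fm)
  also have "\<dots> = ent (fm (A * B)) i j"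
    using d by (auto simp: ent_fm scalar_prod_def atLeast0LessThan intro!: sum.cong sum.neutral)
  finally show "ent (fm (A * B)) i j = ent (fm A * fm B) i j" by simp
qed

lemma fm_transpose [simp]: "fm (A\<^sup>T) = tp (fm A)"
  by (rule fmat_eqI) (auto simp: ent_fm)

lemma fm_diff: "dim_row A = dim_row B \<Longrightarrow> dim_col A = dim_col B \<Longrightarrow> fm (A - B) = fm A - fm B"
  by (rule fmat_eqI) (auto simp: ent_fm)

lemma fm_zero: "fm (0\<^sub>m a b) = 0"
  by (rule fmat_eqI) (auto simp: ent_fm)

lemma fm_one: "fm (1\<^sub>m n) = proj {..<n}"
  by (rule fmat_eqI) (auto simp: ent_fm)

lemma fm_diag: "fm (mat_diag n l) = diagm n l"
  by (rule fmat_eqI) (auto simp: ent_fm mat_diag_def)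

lemma fm_inject: "A \<in> carrier_mat a b \<Longrightarrow> B \<in> carrier_mat a b \<Longrightarrow> fm A = fm B \<Longrightarrow> A = B"
proof (rule eq_matI)
  fix i j assume *: "A \<in> carrier_mat a b" "B \<in> carrier_mat a b" "i < dim_row B" "j < dim_col B"
  assume "fm A = fm B"
  then have "ent (fm A) i j = ent (fm B) i j" by simp
  then show "A $$ (i, j) = B $$ (i, j)" using * by (simp add: ent_fm)
qed auto

lemma fm_rows: "finite X \<Longrightarrow> {..<dim_row A} \<subseteq> X \<Longrightarrow> proj X * fm A = fm A"
  by (subst proj_fix_iff) (auto simp: ent_fm)

lemma fm_cols: "finite X \<Longrightarrow> {..<dim_col A} \<subseteq> X \<Longrightarrow> fm A * proj X = fm A"
  by (subst fix_proj_iff) (auto simp: ent_fm)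

lemma frob_norm_fm: "frob_norm A = norm (fm A)"
proof -
  let ?N = "max (dim_row A) (dim_col A)"
  have w: "corner ?N (fm A)" by (auto simp: corner_def ent_fm)
  have "(norm (fm A))\<^sup>2 = (\<Sum>ij\<in>{..<?N} \<times> {..<?N}. (ent (fm A) (fst ij) (snd ij))\<^sup>2)"
    unfolding norm_power2_ent[OF w] by (simp add: sum.cartesian_product split_def)
  also have "\<dots> = (\<Sum>ij\<in>{..<dim_row A} \<times> {..<dim_col A}. (ent (fm A) (fst ij) (snd ij))\<^sup>2)"
    by (rule sum.mono_neutral_right) (auto simp: ent_fm)
  also have "\<dots> = (\<Sum>ij\<in>{..<dim_row A} \<times> {..<dim_col A}. (A $$ ij)\<^sup>2)"
    by (intro sum.cong) (auto simp: ent_fm)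
  finally show ?thesis unfolding frob_norm_def L2_set_def by (simp add: real_sqrt_unique)
qed

definition mtx :: "nat \<Rightarrow> fmat \<Rightarrow> real mat" where
  "mtx d G = Matrix.mat d d (\<lambda>(i, j). ent G i j)"

lemma mtx_carrier [simp]: "mtx d G \<in> carrier_mat d d"
  by (simp add: mtx_def)

lemma fm_mtx: "corner d G \<Longrightarrow> fm (mtx d G) = G"
  by (rule fmat_eqI) (auto simp: ent_fm mtx_def corner_def)

text \<open>A vector becomes a matrix supported on column 0, so that quadratic forms are inner
  products of matrices.\<close>

definition cv :: "nat \<Rightarrow> (nat \<Rightarrow> real) \<Rightarrow> fmat" where
  "cv d z = mk (Suc d) (\<lambda>i j. if i < d \<and> j = 0 then z i else 0)"

lemma ent_cv: "ent (cv d z) i j = (if i < d \<and> j = 0 then z i else 0)"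
  by (auto simp: cv_def ent_mk)

lemma cv_fix: "proj {..<d} * cv d z = cv d z" "cv d z * proj {0} = cv d z"
  by (auto simp: proj_fix_iff fix_proj_iff ent_cv)

lemma quad_cv:
  assumes "corner d K"
  shows "inner (K * cv d z) (cv d z) = (\<Sum>i<d. \<Sum>j<d. ent K i j * z i * z j)"
proof -
  have w: "corner (Suc d) (cv d z)" by (auto simp: corner_def ent_cv)
  have "inner (K * cv d z) (cv d z) = (\<Sum>i<Suc d. \<Sum>j<Suc d. ent (K * cv d z) i j * ent (cv d z) i j)"
    by (rule inner_corner) (simp add: w)
  also have "\<dots> = (\<Sum>i<Suc d. \<Sum>j<Suc d. if j = 0 then (if i < d then ent (K * cv d z) i 0 * z i else 0) else 0)"
    by (intro sum.cong) (auto simp: ent_cv)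
  also have "\<dots> = (\<Sum>i<d. ent (K * cv d z) i 0 * z i)" by simp
  also have "\<dots> = (\<Sum>i<d. \<Sum>j<d. ent K i j * z i * z j)"
    by (intro sum.cong) (auto simp: ent_mult_corner[OF disjI1[OF assms]] ent_cv sum_distrib_right sum_distrib_left mult_ac intro!: sum.cong)
  finally show ?thesis .
qed

lemma norm_cv: "(norm (cv d z))\<^sup>2 = (\<Sum>i<d. (z i)\<^sup>2)"
proof -
  have "proj {..<d} = diagm d (\<lambda>_. 1)" by (rule fmat_eqI) auto
  then have "corner d (proj {..<d})" using corner_diagm by metis
  from quad_cv[OF this, of z]
  have "(norm (cv d z))\<^sup>2 = (\<Sum>i<d. \<Sum>j<d. ent (proj {..<d}) i j * z i * z j)"
    by (simp only: cv_fix norm_power2_inner)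
  also have "\<dots> = (\<Sum>i<d. \<Sum>j<d. (if i = j then (z i)\<^sup>2 else 0))"
    by (intro sum.cong refl) (auto simp: power2_eq_square)
  finally have "(norm (cv d z))\<^sup>2 = (\<Sum>i<d. \<Sum>j<d. (if i = j then (z i)\<^sup>2 else 0))" .
  then show ?thesis by simp
qed

lemma mult_lower_cv:
  assumes "corner d L" "upper_tri (tp L)"
  shows "L * cv d g = cv d (\<lambda>i. \<Sum>j<Suc i. ent L i j * g j)"
proof (rule fmat_eqI)
  fix i j
  have "ent (L * cv d g) i j = (\<Sum>l<d. ent L i l * ent (cv d g) l j)"
    by (rule ent_mult_corner) (simp add: assms)
  also have "\<dots> = (if j = 0 then \<Sum>l<d. ent L i l * g l else 0)"
    by (auto simp: ent_cv)
  also have "\<dots> = (if i < d \<and> j = 0 then \<Sum>l<Suc i. ent L i l * g l else 0)"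
  proof (cases "i < d")
    case True
    then have "(\<Sum>l<d. ent L i l * g l) = (\<Sum>l<Suc i. ent L i l * g l)"
      using assms(2) by (intro sum.mono_neutral_right) (auto simp: upper_tri_def)
    then show ?thesis using True by auto
  next
    case False then show ?thesis using ent_zero[OF assms(1), of i] by simp
  qed
  finally show "ent (L * cv d g) i j = ent (cv d (\<lambda>i. \<Sum>j<Suc i. ent L i j * g j)) i j"
    by (simp add: ent_cv)
qed

lemma inner_proj:
  "inner (proj {..<d}) K = (\<Sum>i<d. ent K i i)"
proof -
  have "corner d (proj {..<d})" by (auto simp: corner_def)
  then have "inner (proj {..<d}) K = (\<Sum>i<d. \<Sum>j<d. ent (proj {..<d}) i j * ent K i j)"
    by (intro inner_corner) simp
  also have "\<dots> = (\<Sum>i<d. \<Sum>j<d. if i = j then ent K i i else 0)"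
    by (intro sum.cong) auto
  finally show ?thesis by simp
qed

section \<open>Concentration of the sample covariance\<close>

locale gaussian =
  fixes d :: nat and S :: "real mat" and b :: real
  assumes S: "S \<in> carrier_mat d d" "S\<^sup>T = S"
    and pd: "\<And>x. proj {..<d} * x = x \<Longrightarrow> x * proj {0} = x \<Longrightarrow> x \<noteq> 0 \<Longrightarrow> 0 < inner (fm S * x) x"
    and oS: "opb (fm S) b" and b: "0 < b"
begin

abbreviation "leb \<equiv> Pi\<^sub>M {..<d} (\<lambda>_. lborel :: real measure)"

lemma fm_sym: "tp (fm S) = fm S"
  using S(2) fm_transpose by metis

lemma corner_S: "corner d (fm S)" using S by (auto simp: corner_def ent_fm)

text \<open>Gram-Schmidt in the form of \<open>S\<close> gives an upper triangular \<open>G\<close>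
  with \<open>tp G * S * G\<close> the identity. Its inverse \<open>R = tp G * S\<close> is the
  upper triangular Cholesky factor, from which the inverse and the determinant of \<open>S\<close>
  are read off.\<close>

lemma square_root:
  obtains R G \<Omega> where "upper_tri R" "\<And>i. i < d \<Longrightarrow> 0 < ent R i i" "corner d R" "tp R * R = fm S"
    "mat_inverse S = Some \<Omega>" "\<Omega> \<in> carrier_mat d d" "R * fm \<Omega> * tp R = proj {..<d}"
    "sqrt (Determinant.det S) = (\<Prod>i<d. ent R i i)"
proof -
  let ?J = "proj {..<d}"
  obtain G where G: "?J * G = G" "G * ?J = G" "upper_tri G" "\<And>j. j < d \<Longrightarrow> 0 < ent G j j" "tp G * fm S * G = ?J"
    using gram_schmidt[OF fm_sym pd] by blast
  have cG: "corner d G" using G(1,2) by (auto simp: corner_def proj_fix_iff fix_proj_iff)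
  define R where "R = tp G * fm S"
  have SJ: "fm S * ?J = fm S" by (rule fm_cols) (use S in auto)
  have R: "R * G = ?J" "R * ?J = R" using G(5) SJ by (auto simp: R_def mult.assoc)
  note tri = triangular_left_inverse[OF G(3,4) cG R]
  have R0: "0 < ent R i i" if "i < d" for i
    by (rule zero_less_mult_pos2[OF _ G(4)[OF that]]) (simp add: tri(2) that)
  have cR: "corner d R" unfolding R_def by (intro corner_mult) (simp_all add: cG corner_S)
  let ?G = "mtx d G"
  let ?R = "mtx d R"
  have fG: "fm ?G = G" "fm ?R = R" by (simp_all add: fm_mtx cG cR)
  have RG: "?R * ?G = 1\<^sub>m d"
  proof (rule fm_inject[of _ d d])
    show "?R * ?G \<in> carrier_mat d d" by (rule mult_carrier_mat[of _ d d]) simp_all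
    have "fm (?R * ?G) = fm ?R * fm ?G" by (rule fm_mult) (simp add: mtx_def)
    then show "fm (?R * ?G) = fm (1\<^sub>m d)" by (simp only: fG R fm_one)
  qed simp
  then have GR: "?G * ?R = 1\<^sub>m d" by (intro mat_mult_left_right_inverse[of ?R d ?G]) auto
  then have "fm (?G * ?R) = ?J" by (simp add: fm_one)
  then have GR': "G * R = ?J" by (subst (asm) fm_mult) (simp add: mtx_def, simp add: fG)
  have GG: "?G * ?G\<^sup>T \<in> carrier_mat d d" by (rule mult_carrier_mat[of _ d d]) simp_all
  have RR: "tp R * R = fm S"
  proof -
    have "tp R * R = fm S * (G * R)" by (simp add: R_def fm_sym mult.assoc)
    then show ?thesis unfolding GR' SJ .
  qed
  have inv1: "S * (?G * ?G\<^sup>T) = 1\<^sub>m d"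
  proof (rule fm_inject[of _ d d])
    have "fm (S * (?G * ?G\<^sup>T)) = fm S * (G * tp G)"
    proof -
      have "fm (S * (?G * ?G\<^sup>T)) = fm S * fm (?G * ?G\<^sup>T)" by (rule fm_mult) (use S in \<open>simp add: mtx_def\<close>)
      moreover have "fm (?G * ?G\<^sup>T) = fm ?G * fm (?G\<^sup>T)" by (rule fm_mult) (simp add: mtx_def)
      ultimately show ?thesis by (simp only: fm_transpose fG)
    qed
    also have "\<dots> = tp (G * R)" by (simp add: R_def fm_sym mult.assoc)
    also have "\<dots> = fm (1\<^sub>m d)" by (simp only: GR' tp_proj fm_one)
    finally show "fm (S * (?G * ?G\<^sup>T)) = fm (1\<^sub>m d)" .
  qed (use mult_carrier_mat[OF S(1) GG] in auto)
  then have inv2: "(?G * ?G\<^sup>T) * S = 1\<^sub>m d"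
    by (rule mat_mult_left_right_inverse[OF S(1) GG])
  \<comment> \<open>\<open>mat_inverse\<close> returns an option; failure is excluded because
    \<open>S\<close> is a unit of the matrix ring.\<close>
  obtain \<Omega> where \<Omega>: "mat_inverse S = Some \<Omega>"
  proof (cases "mat_inverse S")
    case None
    have "S \<in> Units (ring_mat TYPE(real) d undefined)"
      unfolding Units_def ring_mat_def using inv1 inv2 S GG
      by (auto intro!: bexI[of _ "?G * ?G\<^sup>T"])
    with mat_inverse(1)[OF S(1) None, where b = undefined] show ?thesis by blast
  qed
  note \<Omega>' = mat_inverse(2)[OF S(1) \<Omega>]
  have c\<Omega>: "\<Omega> \<in> carrier_mat d d" using \<Omega>' by blast
  have f\<Omega>: "fm S * fm \<Omega> = ?J"
  proof -
    have "fm S * fm \<Omega> = fm (S * \<Omega>)" using c\<Omega> S by (intro fm_mult[symmetric]) auto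
    then show ?thesis using \<Omega>' by (simp add: fm_one)
  qed
  have "R * fm \<Omega> * tp R = tp G * (fm S * fm \<Omega>) * (fm S * G)" by (simp add: R_def fm_sym mult.assoc)
  also have "\<dots> = tp G * (?J * fm S) * G" unfolding f\<Omega> by (simp only: mult.assoc)
  also have "?J * fm S = fm S" by (rule fm_rows) (use S in auto)
  finally have ROR: "R * fm \<Omega> * tp R = ?J" using G(5) by simp
  have "S = ?R\<^sup>T * ?R"
  proof (rule fm_inject[of _ d d])
    show "?R\<^sup>T * ?R \<in> carrier_mat d d" by (rule mult_carrier_mat[of _ d d]) simp_all
    have "fm (?R\<^sup>T * ?R) = fm (?R\<^sup>T) * fm ?R" by (rule fm_mult) (simp add: mtx_def)
    then show "fm S = fm (?R\<^sup>T * ?R)" by (simp only: fm_transpose fG RR)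
  qed (rule S)
  then have "Determinant.det S = Determinant.det (?R\<^sup>T) * Determinant.det ?R"
    using det_mult[of "?R\<^sup>T" d ?R] by simp
  also have "Determinant.det (?R\<^sup>T) = Determinant.det ?R" by (rule det_transpose[of _ d]) simp
  also have "Determinant.det ?R = prod_list (diag_mat ?R)"
  proof (rule det_upper_triangular[where n = d])
    show "upper_triangular ?R" using tri(1) by (auto simp: upper_triangular_def mtx_def upper_tri_def)
  qed simp
  also have "prod_list (diag_mat ?R) = (\<Prod>i<d. ent R i i)"
    unfolding prod_list_diag_prod by (simp add: mtx_def atLeast0LessThan)
  finally have "Determinant.det S = (\<Prod>i<d. ent R i i)\<^sup>2" by (simp add: power2_eq_square)
  moreover have "0 \<le> (\<Prod>i<d. ent R i i)" by (intro prod_nonneg ballI less_imp_le R0) simp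
  ultimately have "sqrt (Determinant.det S) = (\<Prod>i<d. ent R i i)" by simp
  then show ?thesis using that[OF tri(1) R0 cR RR \<Omega> c\<Omega> ROR] by blast
qed

text \<open>The substitution by the lower triangular \<open>tp R\<close> cancels the inverse
  covariance in the exponent, and its Jacobian cancels the root of the determinant.\<close>

lemma standard_representation:
  obtains R where "corner d R" "tp R * R = fm S" "upper_tri R"
    "\<And>F. F \<in> borel_measurable leb \<Longrightarrow> (\<integral>\<^sup>+ z. F z \<partial>mvn d S)
      = (\<integral>\<^sup>+ g. F (\<lambda>i\<in>{..<d}. \<Sum>j<Suc i. ent R j i * g j) * ennreal (exp (- (\<Sum>i<d. (g i)\<^sup>2) / 2) / sqrt (2 * pi) ^ d) \<partial>leb)"
proof -
  obtain R G \<Omega> where R: "upper_tri R" "\<And>i. i < d \<Longrightarrow> 0 < ent R i i" "corner d R" "tp R * R = fm S"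
    and \<Omega>: "mat_inverse S = Some \<Omega>" "\<Omega> \<in> carrier_mat d d" "R * fm \<Omega> * tp R = proj {..<d}"
    and det: "sqrt (Determinant.det S) = (\<Prod>i<d. ent R i i)"
    using square_root by blast
  let ?c = "\<Prod>i<d. ent R i i"
  let ?T = "\<lambda>g. \<lambda>i\<in>{..<d}. \<Sum>j<Suc i. ent R j i * g j"
  have c0: "0 < ?c" by (intro prod_pos) (use R(2) in auto)
  have sq: "scalar_prod (Matrix.vec d z) (\<Omega> *\<^sub>v Matrix.vec d z) = (\<Sum>i<d. \<Sum>j<d. ent (fm \<Omega>) i j * z i * z j)" for z
    using \<Omega>(2) by (auto simp: scalar_prod_def atLeast0LessThan ent_fm sum_distrib_left mult_ac intro!: sum.cong)
  have c\<Omega>: "corner d (fm \<Omega>)" using \<Omega>(2) by (auto simp: corner_def ent_fm)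
  have sqT: "scalar_prod (Matrix.vec d (?T g)) (\<Omega> *\<^sub>v Matrix.vec d (?T g)) = (\<Sum>i<d. (g i)\<^sup>2)" for g
  proof -
    have e: "cv d (?T g) = tp R * cv d g"
      by (subst mult_lower_cv) (use R in \<open>auto simp: cv_def intro!: mk_eqI\<close>)
    have "scalar_prod (Matrix.vec d (?T g)) (\<Omega> *\<^sub>v Matrix.vec d (?T g)) = inner (fm \<Omega> * (tp R * cv d g)) (tp R * cv d g)"
      unfolding sq quad_cv[OF c\<Omega>, symmetric] e ..
    also have "\<dots> = inner (R * fm \<Omega> * tp R * cv d g) (cv d g)"
      using inner_mult_left[of R "fm \<Omega> * (tp R * cv d g)" "cv d g"] by (simp add: mult.assoc)
    finally show ?thesis unfolding \<Omega>(3) cv_fix norm_power2_inner[symmetric] norm_cv .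
  qed
  have m: "(\<lambda>z. scalar_prod (Matrix.vec d z) (\<Omega> *\<^sub>v Matrix.vec d z)) \<in> borel_measurable leb"
    unfolding sq by measurable
  have sd: "sqrt ((2 * pi) ^ d * Determinant.det S) = sqrt (2 * pi) ^ d * ?c"
    by (simp only: real_sqrt_mult real_sqrt_power det)
  have cancel: "c * (x / (y * c)) = x / y" if "0 < c" for c x y :: real using that by simp
  define dens where "dens z = ennreal (exp (- (1 / 2) * scalar_prod (Matrix.vec d z) (\<Omega> *\<^sub>v Matrix.vec d z)) / (sqrt (2 * pi) ^ d * ?c))" for z
  have md: "dens \<in> borel_measurable leb" unfolding dens_def using m by measurable
  have mvn: "mvn d S = density leb dens"
    unfolding mvn_def dens_def sd \<Omega>(1) option.sel ..
  have "(\<integral>\<^sup>+ z. F z \<partial>mvn d S) = (\<integral>\<^sup>+ g. F (?T g) * ennreal (exp (- (\<Sum>i<d. (g i)\<^sup>2) / 2) / sqrt (2 * pi) ^ d) \<partial>leb)"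
    if F: "F \<in> borel_measurable leb" for F
  proof -
    have mT: "?T \<in> measurable leb leb"
      by (rule measurable_restrict) (auto intro!: borel_measurable_sum)
    have mFT: "(\<lambda>g. F (?T g) * dens (?T g)) \<in> borel_measurable leb"
      using mT F md by measurable
    have "(\<integral>\<^sup>+ z. F z \<partial>mvn d S) = (\<integral>\<^sup>+ z. dens z * F z \<partial>leb)"
      unfolding mvn by (rule nn_integral_density[OF md F])
    also have "\<dots> = (\<integral>\<^sup>+ z. F z * dens z \<partial>leb)" by (simp only: mult.commute)
    also have "\<dots> = ennreal ?c * (\<integral>\<^sup>+ g. F (?T g) * dens (?T g) \<partial>leb)"
      by (rule lower_triangular_change_of_variables[where L = "\<lambda>i j. ent R j i"]) (use R F md in auto)
    also have "\<dots> = (\<integral>\<^sup>+ g. ennreal ?c * (F (?T g) * dens (?T g)) \<partial>leb)"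
      by (rule nn_integral_cmult[OF mFT, symmetric])
    also have "\<dots> = (\<integral>\<^sup>+ g. F (?T g) * ennreal (exp (- (\<Sum>i<d. (g i)\<^sup>2) / 2) / sqrt (2 * pi) ^ d) \<partial>leb)"
    proof (intro nn_integral_cong)
      fix g
      have "ennreal ?c * dens (?T g) = ennreal (?c * (exp (- (1 / 2) * (\<Sum>i<d. (g i)\<^sup>2)) / (sqrt (2 * pi) ^ d * ?c)))"
        unfolding dens_def sqT using c0 by (subst ennreal_mult) auto
      also have "?c * (exp (- (1 / 2) * (\<Sum>i<d. (g i)\<^sup>2)) / (sqrt (2 * pi) ^ d * ?c)) = exp (- (\<Sum>i<d. (g i)\<^sup>2) / 2) / sqrt (2 * pi) ^ d"
        unfolding cancel[OF c0] by simp
      finally show "ennreal ?c * (F (?T g) * dens (?T g)) = F (?T g) * ennreal (exp (- (\<Sum>i<d. (g i)\<^sup>2) / 2) / sqrt (2 * pi) ^ d)"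
        by (simp only: mult.left_commute[of "ennreal ?c"])
    qed
    finally show ?thesis .
  qed
  then show ?thesis using that R by blast
qed

lemma sets_mvn [measurable_cong, simp]: "sets (mvn d S) = sets leb"
  by (simp add: mvn_def)

text \<open>In standard coordinates the form has the matrix \<open>A\<close>, of norm at most
  \<open>2 * s * b * k\<close>. The hypothesis on \<open>s\<close> makes this at most
  \<open>1 / 4\<close>, which is the smallness that the Gaussian integral needs; the trace of
  \<open>A\<close> yields the mean.\<close>

lemma quadratic_mgf:
  assumes K: "corner d K" "norm K \<le> k" and s: "0 \<le> s" "8 * b * k * s \<le> 1"
  shows "(\<integral>\<^sup>+ z. ennreal (exp (s * (\<Sum>i<d. \<Sum>j<d. ent K i j * z i * z j))) \<partial>mvn d S)
    \<le> ennreal (exp (s * inner (fm S) K + 4 * s\<^sup>2 * b\<^sup>2 * k\<^sup>2))"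
proof -
  obtain R where R: "corner d R" "tp R * R = fm S" "upper_tri R"
    "\<And>F. F \<in> borel_measurable leb \<Longrightarrow> (\<integral>\<^sup>+ z. F z \<partial>mvn d S)
      = (\<integral>\<^sup>+ g. F (\<lambda>i\<in>{..<d}. \<Sum>j<Suc i. ent R j i * g j) * ennreal (exp (- (\<Sum>i<d. (g i)\<^sup>2) / 2) / sqrt (2 * pi) ^ d) \<partial>leb)"
    using standard_representation by blast
  let ?T = "\<lambda>g. \<lambda>i\<in>{..<d}. \<Sum>j<Suc i. ent R j i * g j"
  \<comment> \<open>The integral is available for symmetric matrices, and a quadratic form sees only
    the symmetric part of \<open>K\<close>.\<close>
  define K' where "K' = (1 / 2) *\<^sub>R (K + tp K)"
  have cK': "corner d K'" using K by (simp add: K'_def corner_scale corner_add)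
  define A where "A = (2 * s) *\<^sub>R (R * K' * tp R)"
  have cA: "corner d A" unfolding A_def by (intro corner_scale corner_mult) (simp_all add: R cK')
  have symA: "ent A i j = ent A j i" for i j
  proof -
    have "tp A = A" by (simp add: A_def K'_def mult.assoc add.commute)
    then show ?thesis by (metis ent_tp)
  qed
  have oR: "opb R (sqrt b)"
  proof (rule opb_gram)
    fix X
    have "inner (tp R * (R * X)) X = inner (fm S * X) X" by (simp add: R(2)[symmetric] mult.assoc)
    also have "\<dots> \<le> norm (fm S * X) * norm X" by (rule norm_cauchy_schwarz)
    also have "\<dots> \<le> b * norm X * norm X" by (intro mult_right_mono opbD oS norm_ge_zero)
    finally show "inner (tp R * (R * X)) X \<le> (sqrt b)\<^sup>2 * (norm X)\<^sup>2" using b by (simp add: power2_eq_square[of "norm X"] mult.assoc)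
  qed (use b in simp)
  have k: "0 \<le> k" using K(2) norm_ge_zero order_trans by blast
  have nK': "norm K' \<le> k"
    using norm_triangle_ineq[of K "tp K"] K(2) by (simp add: K'_def)
  have nA: "norm A \<le> 2 * s * (b * k)"
  proof -
    have "norm (R * K' * tp R) \<le> sqrt b * norm (R * K')" by (rule opbD2[OF opb_tp[OF oR]])
    also have "\<dots> \<le> sqrt b * (sqrt b * k)"
      by (intro mult_left_mono order_trans[OF opbD[OF oR]] nK') (use b in auto)
    also have "\<dots> = b * k" using b by (simp add: mult.assoc[symmetric])
    finally show ?thesis using s by (simp add: A_def mult_left_mono)
  qed
  have nA2: "(norm A)\<^sup>2 \<le> 4 * s\<^sup>2 * b\<^sup>2 * k\<^sup>2"
    using power_mono[OF nA norm_ge_zero, of 2] by (simp add: power_mult_distrib)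
  have nA3: "(norm A)\<^sup>2 \<le> 1 / 16"
  proof -
    have "norm A \<le> 1 / 4" using nA s(2) by (simp add: mult_ac)
    from power_mono[OF this norm_ge_zero, of 2] show ?thesis by (simp add: power_divide)
  qed
  have trA: "(\<Sum>i<d. ent A i i) = 2 * (s * inner (fm S) K)"
  proof -
    have JR: "tp R * proj {..<d} = tp R"
      using R(1) by (auto simp: fix_proj_iff ent_zero)
    have "(\<Sum>i<d. ent A i i) = inner (proj {..<d}) A" by (simp add: inner_proj)
    also have "\<dots> = 2 * s * inner (tp R * proj {..<d} * R) K'"
      using inner_mult_left[of "R" "K' * tp R" "proj {..<d}"] inner_mult_right[of K' "tp R" "tp R * proj {..<d}"]
      by (simp add: A_def inner_commute mult.assoc)
    also have "inner (tp R * proj {..<d} * R) K' = inner (fm S) K'" unfolding JR R(2) ..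
    also have "\<dots> = inner (fm S) K"
      using inner_tp[of "fm S" K] fm_sym by (simp add: K'_def inner_add_right)
    finally show ?thesis by simp
  qed
  have quadT: "s * (\<Sum>i<d. \<Sum>j<d. ent K i j * ?T g i * ?T g j) = (\<Sum>i<d. \<Sum>j<d. ent A i j * g i * g j) / 2" for g
  proof -
    have e: "cv d (?T g) = tp R * cv d g"
      by (subst mult_lower_cv) (use R in \<open>auto simp: cv_def intro!: mk_eqI\<close>)
    let ?v = "tp R * cv d g"
    have "inner (tp K * ?v) ?v = inner (K * ?v) ?v"
      using inner_mult_left[of K ?v ?v] by (simp add: inner_commute)
    then have "inner (K' * ?v) ?v = inner (K * ?v) ?v"
      by (simp add: K'_def distrib_right inner_add_left)
    moreover have "inner (A * cv d g) (cv d g) = 2 * s * inner (K' * ?v) ?v"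
      using inner_mult_left[of R "K' * ?v" "cv d g"] by (simp add: A_def mult.assoc)
    ultimately show ?thesis
      unfolding quad_cv[OF K(1), symmetric] quad_cv[OF cA, symmetric] e by simp
  qed
  let ?q = "\<lambda>g. (\<Sum>i<d. \<Sum>j<d. ent A i j * g i * g j) / 2 - (\<Sum>i<d. (g i)\<^sup>2) / 2"
  have gauss_factor: "ennreal (exp x) * ennreal (exp (- y / 2) / c) = ennreal (1 / c) * ennreal (exp (x - y / 2))"
    if "0 < c" for x y c :: real
  proof -
    have "exp (x - y / 2) = exp x * exp (- y / 2)" by (simp add: exp_add[symmetric])
    then show ?thesis using that by (simp add: ennreal_mult[symmetric])
  qed
  have "(\<integral>\<^sup>+ z. ennreal (exp (s * (\<Sum>i<d. \<Sum>j<d. ent K i j * z i * z j))) \<partial>mvn d S)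
    = (\<integral>\<^sup>+ g. ennreal (exp (s * (\<Sum>i<d. \<Sum>j<d. ent K i j * ?T g i * ?T g j))) * ennreal (exp (- (\<Sum>i<d. (g i)\<^sup>2) / 2) / sqrt (2 * pi) ^ d) \<partial>leb)"
    by (rule R(4)) measurable
  also have "\<dots> = (\<integral>\<^sup>+ g. ennreal (1 / sqrt (2 * pi) ^ d) * ennreal (exp (?q g)) \<partial>leb)"
    unfolding quadT by (intro nn_integral_cong gauss_factor) simp
  also have "\<dots> = ennreal (1 / sqrt (2 * pi) ^ d) * (\<integral>\<^sup>+ g. ennreal (exp (?q g)) \<partial>leb)"
    by (rule nn_integral_cmult) measurable
  also have "\<dots> \<le> ennreal (1 / sqrt (2 * pi) ^ d) * ennreal (sqrt (2 * pi) ^ d * exp ((\<Sum>i<d. ent A i i) / 2 + (\<Sum>i<d. \<Sum>j<d. (ent A i j)\<^sup>2)))"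
    by (intro mult_left_mono gaussian_quadratic_integral) (use symA nA3 in \<open>auto simp: norm_power2_ent[OF cA]\<close>)
  also have "\<dots> = ennreal (exp (s * inner (fm S) K + (norm A)\<^sup>2))"
    unfolding trA norm_power2_ent[OF cA] by (subst ennreal_mult[symmetric]) auto
  also have "\<dots> \<le> ennreal (exp (s * inner (fm S) K + 4 * s\<^sup>2 * b\<^sup>2 * k\<^sup>2))"
    using nA2 by (intro ennreal_leI) simp
  finally show ?thesis .
qed

text \<open>The law is given by a density, so its total mass has to be computed; in standard
  coordinates it is a product of one-dimensional normal integrals.\<close>

lemma prob_space_mvn: "prob_space (mvn d S)"
proof
  obtain R where R: 
    "\<And>F. F \<in> borel_measurable leb \<Longrightarrow> (\<integral>\<^sup>+ z. F z \<partial>mvn d S)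
      = (\<integral>\<^sup>+ g. F (\<lambda>i\<in>{..<d}. \<Sum>j<Suc i. ent R j i * g j) * ennreal (exp (- (\<Sum>i<d. (g i)\<^sup>2) / 2) / sqrt (2 * pi) ^ d) \<partial>leb)"
    using standard_representation by blast
  have "emeasure (mvn d S) (space (mvn d S)) = (\<integral>\<^sup>+ z. 1 \<partial>mvn d S)" by simp
  also have "\<dots> = (\<integral>\<^sup>+ g. 1 * ennreal (exp (- (\<Sum>i<d. (g i)\<^sup>2) / 2) / sqrt (2 * pi) ^ d) \<partial>leb)"
    by (rule R) simp
  also have "\<dots> = (\<integral>\<^sup>+ g. (\<Prod>i<d. ennreal (std_normal_density (g i))) \<partial>leb)"
  proof (intro nn_integral_cong)
    fix g :: "nat \<Rightarrow> real"
    have "(\<Prod>i<d. std_normal_density (g i)) = (\<Prod>i<d. 1 / sqrt (2 * pi)) * (\<Prod>i<d. exp (- (g i)\<^sup>2 / 2))"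
      by (simp only: std_normal_density_def prod.distrib)
    also have "\<dots> = exp (- (\<Sum>i<d. (g i)\<^sup>2) / 2) / sqrt (2 * pi) ^ d"
      by (simp add: exp_sum[symmetric] sum_negf sum_divide_distrib[symmetric] power_divide)
    finally show "1 * ennreal (exp (- (\<Sum>i<d. (g i)\<^sup>2) / 2) / sqrt (2 * pi) ^ d) = (\<Prod>i<d. ennreal (std_normal_density (g i)))"
      by (simp add: prod_ennreal)
  qed
  also have "\<dots> = (\<Prod>i<d. (\<integral>\<^sup>+ x. ennreal (std_normal_density x) \<partial>lborel))"
    by (rule lborel_prod.product_nn_integral_prod) auto
  also have "(\<integral>\<^sup>+ x. ennreal (std_normal_density x) \<partial>lborel) = 1"
    by (subst nn_integral_eq_integral) auto
  finally show "emeasure (mvn d S) (space (mvn d S)) = 1" by simp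
qed

lemma sample_cov_inner:
  assumes "corner d K"
  shows "inner (fm (sample_cov n d Z)) K = (\<Sum>i<n. \<Sum>a<d. \<Sum>c<d. ent K a c * Z i a * Z i c) / real n"
proof -
  have "inner (fm (sample_cov n d Z)) K = (\<Sum>a<d. \<Sum>c<d. ent (fm (sample_cov n d Z)) a c * ent K a c)"
    by (rule inner_corner) (simp add: assms)
  also have "\<dots> = (\<Sum>a<d. \<Sum>c<d. \<Sum>i<n. ent K a c * Z i a * Z i c / real n)"
    by (intro sum.cong refl) (simp add: ent_fm sample_cov_def sum_divide_distrib sum_distrib_left sum_distrib_right mult_ac)
  also have "\<dots> = (\<Sum>a<d. \<Sum>i<n. \<Sum>c<d. ent K a c * Z i a * Z i c / real n)"
    by (intro sum.cong refl sum.swap)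
  also have "\<dots> = (\<Sum>i<n. \<Sum>a<d. \<Sum>c<d. ent K a c * Z i a * Z i c / real n)" by (rule sum.swap)
  finally show ?thesis by (simp only: sum_divide_distrib)
qed

lemma prob_space_sample: "prob_space (sample_law n d S)"
  unfolding sample_law_def by (intro prob_space_PiM prob_space_mvn)

lemma sets_sample: "sets (sample_law n d S) = sets (Pi\<^sub>M {..<n} (\<lambda>_. leb))"
  unfolding sample_law_def by (intro sets_PiM_cong) auto

lemma measurable_sample_quad:
  assumes "corner d K"
  shows "(\<lambda>Z. inner (fm (sample_cov n d Z)) K) \<in> borel_measurable (sample_law n d S)"
proof -
  have "(\<lambda>Z. \<Sum>i<n. \<Sum>a<d. \<Sum>c<d. ent K a c * Z i a * Z i c) \<in> borel_measurable (Pi\<^sub>M {..<n} (\<lambda>_. leb))"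
  proof (intro borel_measurable_sum)
    fix i a c assume "i \<in> {..<n}" "a \<in> {..<d}" "c \<in> {..<d}"
    then have [measurable]: "(\<lambda>Z. Z i a) \<in> borel_measurable (Pi\<^sub>M {..<n} (\<lambda>_. leb))" "(\<lambda>Z. Z i c) \<in> borel_measurable (Pi\<^sub>M {..<n} (\<lambda>_. leb))"
      using measurable_compose[OF measurable_component_singleton[of i "{..<n}" "\<lambda>_. leb"] measurable_component_singleton[of a "{..<d}" "\<lambda>_. lborel"]]
        measurable_compose[OF measurable_component_singleton[of i "{..<n}" "\<lambda>_. leb"] measurable_component_singleton[of c "{..<d}" "\<lambda>_. lborel"]]
      by auto
    show "(\<lambda>Z. ent K a c * Z i a * Z i c) \<in> borel_measurable (Pi\<^sub>M {..<n} (\<lambda>_. leb))" by measurable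
  qed
  then have "(\<lambda>Z. (\<Sum>i<n. \<Sum>a<d. \<Sum>c<d. ent K a c * Z i a * Z i c) / real n) \<in> borel_measurable (Pi\<^sub>M {..<n} (\<lambda>_. leb))"
    by (rule borel_measurable_divide) simp
  then show ?thesis unfolding sample_cov_inner[OF assms]
    by (simp only: measurable_cong_sets[OF sets_sample refl])
qed

text \<open>Chernoff's method. The choice \<open>s = t / (8 * b\<^sup>2 * k\<^sup>2)\<close>
  minimises \<open>4 * s\<^sup>2 * b\<^sup>2 * k\<^sup>2 - s * t\<close>, and
  \<open>t \<le> b * k\<close> keeps it within the range of \<open>quadratic_mgf\<close>.\<close>

lemma concentration:
  assumes K: "corner d K" "norm K \<le> k" and t: "0 \<le> t" "t \<le> b * k" and k: "0 < k" and n: "0 < n"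
  shows "emeasure (sample_law n d S) {Z \<in> space (sample_law n d S). t \<le> inner (fm (sample_cov n d Z) - fm S) K}
    \<le> ennreal (exp (- real n * t\<^sup>2 / (16 * b\<^sup>2 * k\<^sup>2)))"
proof -
  interpret mvn: prob_space "mvn d S" by (rule prob_space_mvn)
  interpret P: product_sigma_finite "\<lambda>_::nat. mvn d S" by standard
  let ?P = "sample_law n d S"
  define s where "s = t / (8 * b\<^sup>2 * k\<^sup>2)"
  have s: "0 \<le> s" "8 * b * k * s \<le> 1"
    using t b k by (auto simp: s_def field_simps power2_eq_square)
  let ?q = "\<lambda>z. \<Sum>a<d. \<Sum>c<d. ent K a c * z a * z c"
  have mq: "(\<lambda>z. ennreal (exp (s * ?q z))) \<in> borel_measurable (mvn d S)" by measurable
  let ?E = "{Z \<in> space ?P. t \<le> inner (fm (sample_cov n d Z) - fm S) K}"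
  let ?u = "s * (real n * inner (fm S) K + real n * t)"
  have E: "?E \<in> sets ?P"
    unfolding inner_diff_left using measurable_sample_quad[OF K(1)] by measurable
  have "emeasure ?P ?E = (\<integral>\<^sup>+ Z. indicator ?E Z \<partial>?P)" using E by simp
  also have "\<dots> \<le> (\<integral>\<^sup>+ Z. ennreal (exp (- ?u)) * (\<Prod>i<n. ennreal (exp (s * ?q (Z i)))) \<partial>?P)"
  proof (intro nn_integral_mono)
    fix Z assume "Z \<in> space ?P"
    show "indicator ?E Z \<le> ennreal (exp (- ?u)) * (\<Prod>i<n. ennreal (exp (s * ?q (Z i))))"
    proof (cases "Z \<in> ?E")
      case True
      then have "real n * inner (fm S) K + real n * t \<le> (\<Sum>i<n. ?q (Z i))"
        using n by (simp add: inner_diff_left sample_cov_inner[OF K(1)] field_simps)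
      then have "?u \<le> s * (\<Sum>i<n. ?q (Z i))" using s(1) by (rule mult_left_mono)
      then have "1 \<le> exp (- ?u) * exp (s * (\<Sum>i<n. ?q (Z i)))" by (simp add: exp_add[symmetric])
      also have "exp (s * (\<Sum>i<n. ?q (Z i))) = (\<Prod>i<n. exp (s * ?q (Z i)))"
        by (simp only: sum_distrib_left[of s] exp_sum[OF finite_lessThan])
      finally have "ennreal 1 \<le> ennreal (exp (- ?u) * (\<Prod>i<n. exp (s * ?q (Z i))))" by (rule ennreal_leI)
      also have "\<dots> = ennreal (exp (- ?u)) * (\<Prod>i<n. ennreal (exp (s * ?q (Z i))))"
        by (subst ennreal_mult) (auto intro!: prod_nonneg simp: prod_ennreal)
      finally show ?thesis using True by simp
    qed simp
  qed
  also have "\<dots> = ennreal (exp (- ?u)) * (\<integral>\<^sup>+ Z. (\<Prod>i<n. ennreal (exp (s * ?q (Z i)))) \<partial>?P)"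
    unfolding sample_law_def by (rule nn_integral_cmult) (use mq in measurable)
  also have "(\<integral>\<^sup>+ Z. (\<Prod>i<n. ennreal (exp (s * ?q (Z i)))) \<partial>?P) = (\<Prod>i<n. (\<integral>\<^sup>+ z. ennreal (exp (s * ?q z)) \<partial>mvn d S))"
    unfolding sample_law_def by (rule P.product_nn_integral_prod) (use mq in auto)
  also have "\<dots> \<le> (\<Prod>i<n. ennreal (exp (s * inner (fm S) K + 4 * s\<^sup>2 * b\<^sup>2 * k\<^sup>2)))"
  proof -
    have "x ^ n \<le> y ^ n" if "x \<le> y" for x y :: ennreal
      by (induction n) (auto intro!: mult_mono that)
    then show ?thesis using quadratic_mgf[OF K s] by simp
  qed
  also have "\<dots> = ennreal (exp (real n * (s * inner (fm S) K + 4 * s\<^sup>2 * b\<^sup>2 * k\<^sup>2)))"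
    by (simp add: ennreal_power exp_of_nat_mult)
  finally have "emeasure ?P ?E \<le> ennreal (exp (- ?u)) * ennreal (exp (real n * (s * inner (fm S) K + 4 * s\<^sup>2 * b\<^sup>2 * k\<^sup>2)))"
    by (simp add: mult_left_mono)
  also have "\<dots> = ennreal (exp (- ?u + real n * (s * inner (fm S) K + 4 * s\<^sup>2 * b\<^sup>2 * k\<^sup>2)))"
    by (simp add: ennreal_mult[symmetric] exp_add[symmetric])
  also have "- ?u + real n * (s * inner (fm S) K + 4 * s\<^sup>2 * b\<^sup>2 * k\<^sup>2) = real n * (4 * s\<^sup>2 * b\<^sup>2 * k\<^sup>2 - s * t)"
    by (simp add: algebra_simps)
  also have "4 * s\<^sup>2 * b\<^sup>2 * k\<^sup>2 - s * t = - (t\<^sup>2 / (16 * b\<^sup>2 * k\<^sup>2))"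
    using b k by (simp add: s_def field_simps power2_eq_square)
  finally show ?thesis by simp
qed

end

section \<open>Discretisation\<close>

text \<open>With weights \<open>1 - t\<close> and \<open>t\<close> the mixed terms cancel and the
  two squared norms average to at most the right-hand side, as \<open>t * (1 - t)\<close> is at most
  a quarter. So they cannot both exceed it.\<close>

lemma convex_split:
  fixes w v :: "'a::real_inner"
  assumes "0 \<le> t" "t \<le> 1"
  shows "(norm (w + t *\<^sub>R v))\<^sup>2 \<le> (norm w)\<^sup>2 + (norm v)\<^sup>2 / 4 \<or>
    (norm (w + (t - 1) *\<^sub>R v))\<^sup>2 \<le> (norm w)\<^sup>2 + (norm v)\<^sup>2 / 4"
proof (rule ccontr)
  let ?c = "(norm w)\<^sup>2 + (norm v)\<^sup>2 / 4"
  assume "\<not> ?thesis"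
  then have "?c < (norm (w + t *\<^sub>R v))\<^sup>2" "?c < (norm (w + (t - 1) *\<^sub>R v))\<^sup>2" by auto
  then have "(1 - t) * ?c + t * ?c < (1 - t) * (norm (w + t *\<^sub>R v))\<^sup>2 + t * (norm (w + (t - 1) *\<^sub>R v))\<^sup>2"
    (is "?l < _")
    using assms by (cases "t = 0"; cases "t = 1") (auto intro!: add_strict_mono mult_strict_left_mono)
  also have "\<dots> = (norm w)\<^sup>2 + t * (1 - t) * (norm v)\<^sup>2"
    by (simp add: power2_norm_eq_inner inner_add_left inner_add_right inner_commute[of v w] algebra_simps)
  also have "t * (1 - t) * (norm v)\<^sup>2 \<le> 1 / 4 * (norm v)\<^sup>2"
  proof (rule mult_right_mono)
    have "0 \<le> (t - 1 / 2)\<^sup>2" by simp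
    then show "t * (1 - t) \<le> 1 / 4" by (simp add: power2_eq_square algebra_simps)
  qed simp
  also have "?l = ?c" by (simp only: distrib_right[symmetric]) simp
  finally show False by simp
qed

text \<open>Entries are rounded one after another, up or down, whichever keeps the squared norm
  below its average: the method of conditional expectations.\<close>

lemma rounding:
  fixes v :: "'i \<Rightarrow> 'a::real_inner" and x :: "'i \<Rightarrow> real"
  assumes "finite I"
  shows "\<exists>z :: 'i \<Rightarrow> int. (\<forall>i\<in>I. \<bar>x i - of_int (z i)\<bar> \<le> 1) \<and>
    (norm (\<Sum>i\<in>I. (x i - of_int (z i)) *\<^sub>R v i))\<^sup>2 \<le> (\<Sum>i\<in>I. (norm (v i))\<^sup>2) / 4"
  using assms
proof (induction I)
  case (insert i I)
  then obtain z :: "'i \<Rightarrow> int" where z: "\<forall>i\<in>I. \<bar>x i - of_int (z i)\<bar> \<le> 1"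
    "(norm (\<Sum>i\<in>I. (x i - of_int (z i)) *\<^sub>R v i))\<^sup>2 \<le> (\<Sum>i\<in>I. (norm (v i))\<^sup>2) / 4" by blast
  let ?w = "\<Sum>i\<in>I. (x i - of_int (z i)) *\<^sub>R v i"
  define t where "t = x i - of_int \<lfloor>x i\<rfloor>"
  have t: "0 \<le> t" "t \<le> 1" unfolding t_def by linarith+
  obtain u :: int where u: "\<bar>x i - of_int u\<bar> \<le> 1" "(norm (?w + (x i - of_int u) *\<^sub>R v i))\<^sup>2 \<le> (norm ?w)\<^sup>2 + (norm (v i))\<^sup>2 / 4"
  proof (cases "(norm (?w + t *\<^sub>R v i))\<^sup>2 \<le> (norm ?w)\<^sup>2 + (norm (v i))\<^sup>2 / 4")
    case True
    then show ?thesis using that[of "\<lfloor>x i\<rfloor>"] t by (simp add: t_def)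
  next
    case False
    have e: "x i - of_int (\<lfloor>x i\<rfloor> + 1) = t - 1" by (simp add: t_def)
    then show ?thesis using that[of "\<lfloor>x i\<rfloor> + 1", unfolded e] convex_split[OF t, of ?w "v i"] False t by (simp add: abs_le_iff)
  qed
  have "(\<Sum>j\<in>I. (x j - of_int ((z(i := u)) j)) *\<^sub>R v j) = ?w"
    using insert.hyps by (intro sum.cong) auto
  then have "(norm (\<Sum>j\<in>insert i I. (x j - of_int ((z(i := u)) j)) *\<^sub>R v j))\<^sup>2 \<le> (\<Sum>j\<in>insert i I. (norm (v j))\<^sup>2) / 4"
    using insert.hyps u(2) z(2) by (simp add: add.commute add_divide_distrib)
  then show ?case using z(1) u(1) by (intro exI[of _ "z(i := u)"]) auto
qed simp

section \<open>Lattices of sparse factors\<close>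

definition grid :: "nat set \<Rightarrow> nat \<Rightarrow> real \<Rightarrow> (nat \<times> nat \<Rightarrow> int) \<Rightarrow> fmat" where
  "grid T R h z = (\<Sum>ij\<in>T \<times> {..<R}. (h * of_int (z ij)) *\<^sub>R unitm (fst ij) (snd ij))"

lemma ent_sum: "ent (\<Sum>i\<in>I. f i) a b = (\<Sum>i\<in>I. ent (f i) a b)"
  by (induction I rule: infinite_finite_induct) auto

lemma ent_sum_unitm:
  assumes "finite T"
  shows "ent (\<Sum>ij\<in>T \<times> {..<R}. c ij *\<^sub>R unitm (fst ij) (snd ij)) a b = (if a \<in> T \<and> b < R then c (a, b) else 0)"
proof -
  have "ent (\<Sum>ij\<in>T \<times> {..<R}. c ij *\<^sub>R unitm (fst ij) (snd ij)) a b
    = (\<Sum>ij\<in>T \<times> {..<R}. if ij = (a, b) then c (a, b) else 0)"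
    unfolding ent_sum by (intro sum.cong) auto
  also have "\<dots> = (if a \<in> T \<and> b < R then c (a, b) else 0)"
    using assms by (subst sum.delta) auto
  finally show ?thesis .
qed

lemma ent_grid: "finite T \<Longrightarrow> ent (grid T R h z) a b = (if a \<in> T \<and> b < R then h * of_int (z (a, b)) else 0)"
  unfolding grid_def by (rule ent_sum_unitm)

lemma supported_expansion:
  assumes "finite T" "proj T * A = A" "A * proj {..<R} = A"
  shows "A = (\<Sum>ij\<in>T \<times> {..<R}. ent A (fst ij) (snd ij) *\<^sub>R unitm (fst ij) (snd ij))"
  using assms(2,3) by (intro fmat_eqI) (auto simp: ent_sum_unitm[OF assms(1), of "\<lambda>ij. ent A (fst ij) (snd ij)"] proj_fix_iff[OF assms(1)] fix_proj_iff)

lemma norm_power2_supported: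
  assumes "finite T" "proj T * A = A" "A * proj {..<R} = A"
  shows "(norm A)\<^sup>2 = (\<Sum>ij\<in>T \<times> {..<R}. (ent A (fst ij) (snd ij))\<^sup>2)"
proof -
  let ?N = "fdim A"
  have z: "ent A i j = 0" if "i \<notin> T \<or> \<not> j < R" for i j
    using assms that by (auto simp: proj_fix_iff fix_proj_iff)
  have "(norm A)\<^sup>2 = (\<Sum>ij\<in>{..<?N} \<times> {..<?N}. (ent A (fst ij) (snd ij))\<^sup>2)"
    unfolding norm_power2_ent[OF corner_fdim] by (simp add: sum.cartesian_product split_def)
  also have "\<dots> = (\<Sum>ij\<in>({..<?N} \<times> {..<?N}) \<inter> (T \<times> {..<R}). (ent A (fst ij) (snd ij))\<^sup>2)"
    by (rule sum.mono_neutral_right) (use z in \<open>auto, blast+\<close>)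
  also have "\<dots> = (\<Sum>ij\<in>T \<times> {..<R}. (ent A (fst ij) (snd ij))\<^sup>2)"
    by (rule sum.mono_neutral_left)
      (use assms(1) in \<open>auto dest: corner_nz1[OF corner_fdim] corner_nz2[OF corner_fdim]\<close>)
  finally show ?thesis .
qed

lemma sum_unitm_norm:
  assumes "finite T" "proj {..<R} * X = X"
  shows "(\<Sum>ij\<in>T \<times> {..<R}. (norm (unitm (fst ij) (snd ij) * X))\<^sup>2) = real (card T) * (norm X)\<^sup>2"
proof -
  let ?N = "max R (fdim X)"
  have w: "corner ?N X" by (simp add: corner_iff)
  have r: "(norm (unitm i j * X))\<^sup>2 = (\<Sum>l<?N. (ent X j l)\<^sup>2)" for i j
  proof -
    let ?M = "max (Suc i) ?N"
    have "corner ?M (unitm i j * X)" using ent_zero[OF w] by (auto simp: corner_def ent_unitm_mult)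
    then have "(norm (unitm i j * X))\<^sup>2 = (\<Sum>a<?M. \<Sum>l<?M. (ent (unitm i j * X) a l)\<^sup>2)"
      by (rule norm_power2_ent)
    also have "\<dots> = (\<Sum>a<?M. if a = i then (\<Sum>l<?M. (ent X j l)\<^sup>2) else 0)"
      by (intro sum.cong) (auto simp: ent_unitm_mult)
    also have "\<dots> = (\<Sum>l<?M. (ent X j l)\<^sup>2)" by simp
    also have "\<dots> = (\<Sum>l<?N. (ent X j l)\<^sup>2)"
      by (rule sum.mono_neutral_right) (auto simp: not_less intro!: ent_zero[OF w])
    finally show ?thesis .
  qed
  have "(\<Sum>ij\<in>T \<times> {..<R}. (norm (unitm (fst ij) (snd ij) * X))\<^sup>2) = (\<Sum>i\<in>T. \<Sum>j<R. \<Sum>l<?N. (ent X j l)\<^sup>2)"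
    unfolding r by (simp add: sum.cartesian_product')
  also have "(\<Sum>j<R. \<Sum>l<?N. (ent X j l)\<^sup>2) = (\<Sum>j<?N. \<Sum>l<?N. (ent X j l)\<^sup>2)"
    using assms(2) by (intro sum.mono_neutral_left) (auto simp: proj_fix_iff)
  finally show ?thesis using norm_power2_ent[OF w] by simp
qed

text \<open>The rounded directions are the multiples by \<open>h\<close> of
  \<open>unitm i j * X\<close>, so what is kept small is the error of the product with
  \<open>X\<close>. Its squared bound gains a factor \<open>R\<close> over the one that follows from
  the entrywise error of \<open>A\<close>.\<close>

lemma round_factor:
  assumes T: "finite T" and A: "proj T * A = A" "A * proj {..<R} = A" and X: "proj {..<R} * X = X" and h: "0 < h"
  obtains z where "(norm ((A - grid T R h z) * X))\<^sup>2 \<le> h\<^sup>2 * real (card T) * (norm X)\<^sup>2 / 4"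
    "(norm (A - grid T R h z))\<^sup>2 \<le> h\<^sup>2 * real (card T * R)"
proof -
  let ?I = "T \<times> {..<R}"
  have fI: "finite ?I" using T by simp
  obtain z :: "nat \<times> nat \<Rightarrow> int" where z: "\<forall>ij\<in>?I. \<bar>ent A (fst ij) (snd ij) / h - of_int (z ij)\<bar> \<le> 1"
    "(norm (\<Sum>ij\<in>?I. (ent A (fst ij) (snd ij) / h - of_int (z ij)) *\<^sub>R (h *\<^sub>R (unitm (fst ij) (snd ij) * X))))\<^sup>2
      \<le> (\<Sum>ij\<in>?I. (norm (h *\<^sub>R (unitm (fst ij) (snd ij) * X)))\<^sup>2) / 4"
    using rounding[OF fI, of "\<lambda>ij. ent A (fst ij) (snd ij) / h" "\<lambda>ij. h *\<^sub>R (unitm (fst ij) (snd ij) * X)"] by blast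
  have diff: "A - grid T R h z = (\<Sum>ij\<in>?I. (ent A (fst ij) (snd ij) - h * of_int (z ij)) *\<^sub>R unitm (fst ij) (snd ij))"
    by (subst (1) supported_expansion[OF T A]) (simp only: grid_def sum_subtractf[symmetric] scaleR_left_diff_distrib)
  have "(A - grid T R h z) * X = (\<Sum>ij\<in>?I. (ent A (fst ij) (snd ij) / h - of_int (z ij)) *\<^sub>R (h *\<^sub>R (unitm (fst ij) (snd ij) * X)))"
    unfolding diff sum_distrib_right using h by (intro sum.cong refl) (simp add: left_diff_distrib)
  then have "(norm ((A - grid T R h z) * X))\<^sup>2 \<le> (\<Sum>ij\<in>?I. (norm (h *\<^sub>R (unitm (fst ij) (snd ij) * X)))\<^sup>2) / 4"
    using z(2) by simp
  also have "\<dots> = h\<^sup>2 * (\<Sum>ij\<in>?I. (norm (unitm (fst ij) (snd ij) * X))\<^sup>2) / 4"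
    by (simp add: power_mult_distrib sum_distrib_left)
  finally have 1: "(norm ((A - grid T R h z) * X))\<^sup>2 \<le> h\<^sup>2 * real (card T) * (norm X)\<^sup>2 / 4"
    unfolding sum_unitm_norm[OF T X] by (simp add: mult.assoc)
  have sup: "proj T * (A - grid T R h z) = A - grid T R h z" "(A - grid T R h z) * proj {..<R} = A - grid T R h z"
    using A by (auto simp: proj_fix_iff fix_proj_iff T ent_grid)
  have "(norm (A - grid T R h z))\<^sup>2 = (\<Sum>ij\<in>?I. (ent (A - grid T R h z) (fst ij) (snd ij))\<^sup>2)"
    by (rule norm_power2_supported[OF T sup])
  also have "\<dots> \<le> (\<Sum>ij\<in>?I. h\<^sup>2)"
  proof (rule sum_mono)
    fix ij assume ij: "ij \<in> ?I"
    then have "\<bar>ent A (fst ij) (snd ij) / h - of_int (z ij)\<bar> * h \<le> 1 * h" using z(1) h by (intro mult_right_mono) auto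
    moreover have "\<bar>ent A (fst ij) (snd ij) / h - of_int (z ij)\<bar> * h = \<bar>(ent A (fst ij) (snd ij) / h - of_int (z ij)) * h\<bar>"
      using h by (simp add: abs_mult)
    moreover have "(ent A (fst ij) (snd ij) / h - of_int (z ij)) * h = ent (A - grid T R h z) (fst ij) (snd ij)"
      using ij h T by (auto simp: ent_grid left_diff_distrib)
    ultimately show "(ent (A - grid T R h z) (fst ij) (snd ij))\<^sup>2 \<le> h\<^sup>2"
      using h by (simp add: abs_le_square_iff[symmetric])
  qed
  finally have "(norm (A - grid T R h z))\<^sup>2 \<le> h\<^sup>2 * real (card T * R)"
    by (simp add: card_cartesian_product mult.commute)
  with 1 show ?thesis by (rule that)
qed

text \<open>Gram-Schmidt that tolerates dependent columns: a column without a new direction leaves a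
  zero column in \<open>Q\<close>, and \<open>I\<close> records the others.\<close>

lemma orthonormal_basis_of_columns:
  assumes "proj T * A = A" "A * proj {..<R} = A"
  shows "\<exists>Q I. I \<subseteq> {..<R} \<and> proj T * Q = Q \<and> Q * proj {..<R} = Q \<and> tp Q * Q = proj I \<and> Q * (tp Q * A) = A"
  using assms
proof (induction R arbitrary: A)
  case 0
  have "proj {} = 0" by (rule fmat_eqI) simp
  with 0 show ?case by (intro exI[of _ 0] exI[of _ "{}"]) auto
next
  case (Suc R)
  let ?A = "A * proj {..<R}"
  define a where "a = A * unitm R 0"
  have "proj T * ?A = ?A" using Suc.prems by (simp add: mult.assoc[symmetric])
  then obtain Q I where Q: "I \<subseteq> {..<R}" "proj T * Q = Q" "Q * proj {..<R} = Q" "tp Q * Q = proj I" "Q * (tp Q * ?A) = ?A"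
    using Suc.IH[of ?A] by (auto simp: mult.assoc)
  have fI: "finite I" using Q(1) finite_subset by blast
  have Q': "Q * proj {..<Suc R} = Q" by (rule fix_proj_subset[OF _ _ Q(3)]) auto
  have uu: "unitm R 0 * unitm 0 R = unitm R R" by (rule fmat_eqI) (auto simp: ent_unitm_mult)
  have A_split: "A = ?A + a * unitm 0 R"
    using Suc.prems(2) by (simp add: a_def proj_Suc distrib_left mult.assoc uu)
  have a_fix: "proj T * a = a" "a * proj {0} = a"
    using Suc.prems(1) by (auto simp: a_def mult.assoc[symmetric] fix_proj_iff ent_mult_unitm)
  define g0 where "g0 = a - Q * (tp Q * a)"
  show ?case
  proof (cases "g0 = 0")
    case True
    then have "Q * (tp Q * a) = a" by (simp add: g0_def)
    then have "Q * (tp Q * (?A + a * unitm 0 R)) = ?A + a * unitm 0 R"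
      using Q(5) by (simp add: distrib_left mult.assoc[symmetric])
    with A_split have "Q * (tp Q * A) = A" by simp
    then show ?thesis using Q(1,2,4) Q' by (intro exI[of _ Q] exI[of _ I]) (auto intro: less_SucI)
  next
    case False
    define c where "c = norm g0"
    have c: "0 < c" using False by (simp add: c_def)
    define g where "g = (1 / c) *\<^sub>R g0"
    \<comment> \<open>The Gram entries of the columns of \<open>Q\<close> outside \<open>I\<close>
      are zero, so these columns vanish.\<close>
    have QI: "proj I * tp Q = tp Q"
    proof -
      have "norm (Q - Q * proj I) = 0"
      proof -
        have "(norm (Q - Q * proj I))\<^sup>2 = inner (tp (Q - Q * proj I) * (Q - Q * proj I)) (proj {..<R})"
          using inner_mult_left[of "Q - Q * proj I" "proj {..<R}" "Q - Q * proj I"] Q(3) Q(1) fI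
          by (simp add: norm_power2_inner inner_commute left_diff_distrib mult.assoc proj_mult_proj Int_absorb2)
        also have "tp (Q - Q * proj I) * (Q - Q * proj I) = 0"
        proof -
          have e: "tp Q * (Q * X) = proj I * X" for X using Q(4) by (simp add: mult.assoc[symmetric])
          show ?thesis using fI by (simp add: left_diff_distrib right_diff_distrib mult.assoc e Q(4))
        qed
        finally show ?thesis by simp
      qed
      then have "Q * proj I = Q" by simp
      from arg_cong[OF this, of tp] show ?thesis by simp
    qed
    have Qg0: "tp Q * g0 = 0"
    proof -
      have "tp Q * g0 = tp Q * a - (tp Q * Q) * (tp Q * a)" by (simp add: g0_def right_diff_distrib mult.assoc)
      also have "\<dots> = tp Q * a - (proj I * tp Q) * a" by (simp only: Q(4) mult.assoc)
      finally show ?thesis by (simp add: QI)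
    qed
    then have Qg: "tp Q * g = 0" by (simp add: g_def)
    have gQ: "tp g * Q = 0" using arg_cong[OF Qg, of tp] by simp
    have g0fix: "proj T * g0 = g0" "g0 * proj {0} = g0"
      using a_fix Q(2) by (simp_all add: g0_def right_diff_distrib left_diff_distrib mult.assoc[symmetric]) (simp add: mult.assoc)
    have gg: "tp g * g = unitm 0 0"
    proof -
      have "tp g0 * g0 = c\<^sup>2 *\<^sub>R unitm 0 0" using col_gram[OF g0fix(2) g0fix(2)] by (simp add: c_def power2_norm_eq_inner)
      then show ?thesis using c by (simp add: g_def power2_eq_square)
    qed
    have ga: "g * (tp g * a) = g0"
    proof -
      have "a = g0 + Q * (tp Q * a)" by (simp add: g0_def)
      then have "tp g * a = tp g * (g0 + Q * (tp Q * a))" by (rule arg_cong)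
      also have "\<dots> = tp g * g0 + (tp g * Q) * (tp Q * a)" by (simp add: distrib_left mult.assoc)
      also have "\<dots> = c *\<^sub>R (tp g * g)" using c by (simp add: gQ) (simp add: g_def)
      finally have "g * (tp g * a) = c *\<^sub>R (g * unitm 0 0)" by (simp add: gg)
      moreover have "g * unitm 0 0 = g"
        using g0fix(2) by (intro fmat_eqI) (auto simp: ent_mult_unitm g_def fix_proj_iff)
      ultimately show ?thesis using c by (simp add: g_def)
    qed
    define Q1 where "Q1 = Q + g * unitm 0 R"
    have QR: "Q * unitm R 0 = 0"
      using Q(3) by (intro fmat_eqI) (auto simp: ent_mult_unitm fix_proj_iff)
    have RQ: "unitm 0 R * tp Q = 0" using arg_cong[OF QR, of tp] by simp
    have gu: "g * unitm 0 0 = g"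
        using g0fix(2) by (intro fmat_eqI) (auto simp: ent_mult_unitm g_def fix_proj_iff)
    have u00: "unitm 0 R * unitm R 0 = unitm 0 0" by (rule fmat_eqI) (auto simp: ent_unitm_mult)
    have QQ: "Q1 * tp Q1 = Q * tp Q + g * tp g"
    proof -
      have "Q1 * tp Q1 = Q * tp Q + (Q * unitm R 0) * tp g + g * (unitm 0 R * tp Q) + g * (unitm 0 R * unitm R 0) * tp g"
        by (simp add: Q1_def distrib_left distrib_right mult.assoc add_ac)
      then show ?thesis unfolding QR RQ u00 gu by simp
    qed
    have A1: "Q * (tp Q * (a * X)) = (a - g0) * X" for X
      by (simp add: g0_def mult.assoc)
    have gA: "tp g * ?A = 0"
    proof -
      have "tp g * ?A = (tp g * Q) * (tp Q * ?A)" using Q(5) by (metis mult.assoc)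
      then show ?thesis by (simp add: gQ)
    qed
    have "Q1 * (tp Q1 * A) = (Q * tp Q + g * tp g) * (?A + a * unitm 0 R)"
      unfolding QQ[symmetric] A_split[symmetric] by (simp add: mult.assoc)
    also have "\<dots> = Q * (tp Q * ?A) + g * (tp g * ?A) + Q * (tp Q * (a * unitm 0 R)) + (g * (tp g * a)) * unitm 0 R"
      by (simp add: distrib_left distrib_right mult.assoc)
    also have "\<dots> = ?A + a * unitm 0 R"
      unfolding Q(5) gA ga A1 by (simp add: left_diff_distrib)
    finally have 1: "Q1 * (tp Q1 * A) = A" using A_split by simp
    have "tp Q1 * Q1 = tp Q * Q + (tp Q * g) * unitm 0 R + unitm R 0 * (tp g * Q) + unitm R 0 * (tp g * g) * unitm 0 R"
      by (simp add: Q1_def distrib_left distrib_right mult.assoc add_ac)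
    also have "\<dots> = proj I + unitm R 0 * unitm 0 0 * unitm 0 R" unfolding Qg gQ gg Q(4) by simp
    also have "\<dots> = proj (insert R I)"
      using Q(1) fI by (intro fmat_eqI) (auto simp: ent_mult_unitm)
    finally have 2: "tp Q1 * Q1 = proj (insert R I)" .
    have 3: "proj T * Q1 = Q1" using Q(2) g0fix(1) by (simp add: Q1_def distrib_left mult.assoc[symmetric] g_def)
    have "unitm 0 R * proj {..<Suc R} = unitm 0 R" by (auto simp: fix_proj_iff)
    then have 4: "Q1 * proj {..<Suc R} = Q1" using Q' by (simp add: Q1_def distrib_right mult.assoc)
    show ?thesis using 1 2 3 4 Q(1) by (intro exI[of _ Q1] exI[of _ "insert R I"]) (auto intro: less_SucI)
  qed
qed

text \<open>Integer points of the ball of radius \<open>5 * sqrt (card I)\<close>, five being the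
  bound \<open>5 / 4\<close> on the rounded factors over the mesh \<open>1 / 4\<close>, both up to
  common scaling. The box turns a sum over it into a product of one-dimensional sums.\<close>

definition lattice_ball :: "'i set \<Rightarrow> ('i \<Rightarrow> int) set" where
  "lattice_ball I = {z \<in> I \<rightarrow>\<^sub>E {- int (25 * card I)..int (25 * card I)}. (\<Sum>i\<in>I. (of_int (z i) :: real)\<^sup>2) \<le> 25 * real (card I)}"

lemma finite_lattice_ball: "finite I \<Longrightarrow> finite (lattice_ball I)"
  unfolding lattice_ball_def by (rule finite_subset[OF _ finite_PiE[of I "\<lambda>_. {- int (25 * card I)..int (25 * card I)}"]]) auto

lemma int_abs_le_square: "\<bar>u\<bar> \<le> (u :: int)\<^sup>2"
proof -
  have "\<bar>u\<bar> * 1 \<le> \<bar>u\<bar> * \<bar>u\<bar>" if "u \<noteq> 0" using that by (intro mult_left_mono) auto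
  then show ?thesis by (cases "u = 0") (auto simp: power2_eq_square)
qed

lemma geometric_int_sum: "(\<Sum>z\<in>{- int b..int b}. (1 / 2 :: real) ^ nat \<bar>z\<bar>) = 3 - 2 * (1 / 2) ^ b"
proof (induction b)
  case (Suc b)
  have "{- int (Suc b)..int (Suc b)} = insert (- int (Suc b)) (insert (int (Suc b)) {- int b..int b})" by auto
  with Suc show ?case by (simp add: nat_add_distrib)
qed simp

text \<open>Counting by weights: on the ball \<open>exp (25 * card I)\<close> outweighs the decay in
  the squared norm, and the weights sum over each coordinate to at most 3, hence to at most
  \<open>exp 2\<close>.\<close>

lemma card_lattice_ball:
  assumes I: "finite I"
  shows "real (card (lattice_ball I)) \<le> exp (27 * real (card I))"
proof -
  let ?N = "card I"
  let ?B = "{- int (25 * ?N)..int (25 * ?N)}"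
  have "real (card (lattice_ball I)) = (\<Sum>z\<in>lattice_ball I. 1)" by simp
  also have "\<dots> \<le> (\<Sum>z\<in>lattice_ball I. exp (25 * real ?N) * (\<Prod>i\<in>I. (1 / 2) ^ nat \<bar>z i\<bar>))"
  proof (rule sum_mono)
    fix z assume z: "z \<in> lattice_ball I"
    have "exp (- (of_int u)\<^sup>2) \<le> (1 / 2 :: real) ^ nat \<bar>u\<bar>" for u :: int
    proof -
      have "real (nat \<bar>u\<bar>) \<le> (of_int u)\<^sup>2"
      proof -
        have "(of_int \<bar>u\<bar> :: real) \<le> of_int (u\<^sup>2)" by (rule of_int_le_iff[THEN iffD2, OF int_abs_le_square])
        then show ?thesis by simp
      qed
      then have "exp (- (of_int u)\<^sup>2) \<le> exp (- real (nat \<bar>u\<bar>))" by simp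
      also have "\<dots> = exp (- 1) ^ nat \<bar>u\<bar>" by (simp add: exp_of_nat_mult[symmetric])
      also have "\<dots> \<le> (1 / 2) ^ nat \<bar>u\<bar>"
      proof (rule power_mono)
        have "2 \<le> exp (1::real)" using exp_ge_add_one_self[of 1] by simp
        then show "exp (- 1) \<le> (1 / 2 :: real)" by (simp add: exp_minus field_simps)
      qed simp
      finally show ?thesis .
    qed
    then have "(\<Prod>i\<in>I. exp (- (of_int (z i))\<^sup>2)) \<le> (\<Prod>i\<in>I. (1 / 2 :: real) ^ nat \<bar>z i\<bar>)"
      by (intro prod_mono) auto
    then have "exp (25 * real ?N) * exp (- (\<Sum>i\<in>I. (of_int (z i))\<^sup>2)) \<le> exp (25 * real ?N) * (\<Prod>i\<in>I. (1 / 2 :: real) ^ nat \<bar>z i\<bar>)"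
      using I by (intro mult_left_mono) (simp_all add: exp_sum[symmetric] sum_negf)
    moreover have "1 \<le> exp (25 * real ?N) * exp (- (\<Sum>i\<in>I. (of_int (z i))\<^sup>2))"
      using z by (simp add: lattice_ball_def exp_add[symmetric])
    ultimately show "1 \<le> exp (25 * real ?N) * (\<Prod>i\<in>I. (1 / 2 :: real) ^ nat \<bar>z i\<bar>)" by linarith
  qed
  also have "\<dots> \<le> (\<Sum>z\<in>I \<rightarrow>\<^sub>E ?B. exp (25 * real ?N) * (\<Prod>i\<in>I. (1 / 2) ^ nat \<bar>z i\<bar>))"
    by (rule sum_mono2) (use I in \<open>auto simp: lattice_ball_def intro!: finite_PiE mult_nonneg_nonneg prod_nonneg\<close>)
  also have "\<dots> = exp (25 * real ?N) * (\<Prod>i\<in>I. \<Sum>z\<in>?B. (1 / 2) ^ nat \<bar>z\<bar>)"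
    unfolding sum_distrib_left[symmetric] using I by (subst prod_sum_PiE) auto
  also have "(\<Prod>i\<in>I. \<Sum>z\<in>?B. (1 / 2 :: real) ^ nat \<bar>z\<bar>) \<le> (\<Prod>i\<in>I. exp 2)"
  proof (intro prod_mono conjI)
    have "3 \<le> exp (2::real)" using exp_ge_add_one_self[of 2] by simp
    then show "(\<Sum>z\<in>?B. (1 / 2 :: real) ^ nat \<bar>z\<bar>) \<le> exp 2" unfolding geometric_int_sum by (smt (verit) zero_le_power divide_nonneg_nonneg)
  qed (auto intro!: sum_nonneg)
  also have "exp (25 * real ?N) * (\<Prod>i\<in>I. exp 2) = exp (27 * real ?N)"
    by (simp add: exp_of_nat_mult[symmetric] exp_add[symmetric])
  finally show ?thesis by simp
qed

lemma grid_restrict: "finite T \<Longrightarrow> grid T R h (restrict z (T \<times> {..<R})) = grid T R h z"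
  by (rule fmat_eqI) (simp add: ent_grid)

lemma in_lattice_ball:
  assumes T: "finite T" and h: "0 < h" and le: "(norm (grid T R h z))\<^sup>2 \<le> 25 * h\<^sup>2 * real (card T * R)"
  shows "restrict z (T \<times> {..<R}) \<in> lattice_ball (T \<times> {..<R})"
proof -
  let ?I = "T \<times> {..<R}"
  have fI: "finite ?I" using T by simp
  have "(norm (grid T R h z))\<^sup>2 = (\<Sum>ij\<in>?I. (ent (grid T R h z) (fst ij) (snd ij))\<^sup>2)"
    by (rule norm_power2_supported[OF T]) (auto simp: proj_fix_iff fix_proj_iff T ent_grid)
  also have "\<dots> = (\<Sum>ij\<in>?I. h\<^sup>2 * (of_int (z ij))\<^sup>2)"
    by (intro sum.cong) (auto simp: ent_grid T power_mult_distrib)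
  finally have "h\<^sup>2 * (\<Sum>ij\<in>?I. (of_int (z ij))\<^sup>2) \<le> h\<^sup>2 * (25 * real (card ?I))"
    using le by (simp add: sum_distrib_left card_cartesian_product mult_ac)
  then have s: "(\<Sum>ij\<in>?I. (of_int (z ij) :: real)\<^sup>2) \<le> 25 * real (card ?I)"
    using h by (simp only: mult_le_cancel_left_pos zero_less_power)
  have "- int (25 * card ?I) \<le> z ij \<and> z ij \<le> int (25 * card ?I)" if "ij \<in> ?I" for ij
  proof -
    have "(of_int (z ij) :: real)\<^sup>2 \<le> (\<Sum>ij\<in>?I. (of_int (z ij) :: real)\<^sup>2)"
      by (rule member_le_sum[OF that _ fI]) simp
    with s have "(of_int ((z ij)\<^sup>2) :: real) \<le> of_int (int (25 * card ?I))" by simp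
    then have "(z ij)\<^sup>2 \<le> int (25 * card ?I)" by (simp only: of_int_le_iff)
    moreover note int_abs_le_square[of "z ij"]
    ultimately show ?thesis by linarith
  qed
  then show ?thesis using s by (auto simp: lattice_ball_def PiE_iff)
qed

text \<open>The left factor stands for an orthonormal basis, of norm up to \<open>sqrt R\<close>,
  the right one for a matrix of norm at most one. The meshes differ by \<open>sqrt R\<close>
  accordingly, so that both integer parts fall into the same ball.\<close>

definition net_point :: "nat set \<Rightarrow> nat \<Rightarrow> (nat \<times> nat \<Rightarrow> int) \<Rightarrow> (nat \<times> nat \<Rightarrow> int) \<Rightarrow> fmat" where
  "net_point T R z w = grid T R (1 / (4 * sqrt (real (card T)))) z * tp (grid T R (1 / (4 * sqrt (real (card T * R)))) w)"

lemma grid_supported: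
  assumes "finite T" shows "proj T * grid T R h z = grid T R h z" "grid T R h z * proj {..<R} = grid T R h z"
  using assms by (auto simp: proj_fix_iff fix_proj_iff ent_grid)

text \<open>With an orthonormal basis as left factor, the right factor inherits the norm of the
  product. Both rounding errors are again sparse products of rank at most \<open>R\<close>, so they
  belong to the class that is being approximated.\<close>

lemma net_approximation:
  assumes T: "finite T" "T \<noteq> {}" and R: "0 < R"
    and A: "proj T * A = A" "A * proj {..<R} = A" and B: "proj T * B = B" "B * proj {..<R} = B"
    and le: "norm (A * tp B) \<le> 1"
  obtains z w A1 B1 A2 B2 where "z \<in> lattice_ball (T \<times> {..<R})" "w \<in> lattice_ball (T \<times> {..<R})"
    "norm (net_point T R z w) \<le> 2" "A * tp B = net_point T R z w + A1 * tp B1 + A2 * tp B2"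
    "proj T * A1 = A1" "A1 * proj {..<R} = A1" "proj T * B1 = B1" "B1 * proj {..<R} = B1"
    "proj T * A2 = A2" "A2 * proj {..<R} = A2" "proj T * B2 = B2" "B2 * proj {..<R} = B2"
    "norm (A1 * tp B1) \<le> 1 / 8" "norm (A2 * tp B2) \<le> 5 / 32"
proof -
  let ?k = "card T"
  have k: "0 < ?k" using T by (simp add: card_gt_0_iff)
  obtain Q I where Q: "I \<subseteq> {..<R}" "proj T * Q = Q" "Q * proj {..<R} = Q" "tp Q * Q = proj I" "Q * (tp Q * A) = A"
    using orthonormal_basis_of_columns[OF A] by blast
  have fI: "finite I" using Q(1) finite_subset by blast
  have oQ: "opb Q 1" by (rule opb_orthonormal[OF fI Q(4)])
  define F where "F = B * (tp A * Q)"
  have F: "proj T * F = F" "F * proj {..<R} = F" using B Q by (simp_all add: F_def mult.assoc[symmetric]) (simp add: mult.assoc)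
  have QF: "A * tp B = Q * tp F" using Q(5) by (simp add: F_def mult.assoc[symmetric])
  have nF: "norm F \<le> 1"
  proof -
    have "tp F = tp Q * (A * tp B)" by (simp add: F_def mult.assoc)
    then have "norm F = norm (tp Q * (A * tp B))" using norm_tp by metis
    also have "\<dots> \<le> 1" using opbD[OF opb_tp[OF oQ], of "A * tp B"] le by simp
    finally show ?thesis .
  qed
  have nQ: "(norm Q)\<^sup>2 \<le> real R"
  proof -
    have "(norm Q)\<^sup>2 = inner (Q * proj {..<R}) Q" using Q(3) by (simp add: norm_power2_inner)
    also have "\<dots> = inner (proj {..<R}) (proj I)" by (simp only: inner_mult_left Q(4))
    also have "\<dots> = (\<Sum>i<R. if i \<in> I then 1 else 0)" using fI by (simp add: inner_proj)
    also have "\<dots> \<le> (\<Sum>i<R. 1)" by (intro sum_mono) auto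
    finally show ?thesis by simp
  qed
  define h where "h = 1 / (4 * sqrt (real ?k))"
  define h' where "h' = 1 / (4 * sqrt (real (?k * R)))"
  have h: "0 < h" "h\<^sup>2 = 1 / (16 * real ?k)" using k by (auto simp: h_def power_divide power_mult_distrib)
  have h': "0 < h'" "h'\<^sup>2 = 1 / (16 * real (?k * R))" using k R by (auto simp: h'_def power_divide power_mult_distrib)
  have JF: "proj {..<R} * tp F = tp F" using arg_cong[OF F(2), of tp] by simp
  obtain z where z: "(norm ((Q - grid T R h z) * tp F))\<^sup>2 \<le> h\<^sup>2 * real ?k * (norm (tp F))\<^sup>2 / 4"
    "(norm (Q - grid T R h z))\<^sup>2 \<le> h\<^sup>2 * real (?k * R)"
    using round_factor[OF T(1) Q(2,3) JF h(1)] by blast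
  let ?Q = "grid T R h z"
  have JQ: "proj {..<R} * tp ?Q = tp ?Q" using arg_cong[OF grid_supported(2)[OF T(1), of R h z], of tp] by simp
  \<comment> \<open>The second factor is rounded against the already rounded first one, so no cross
    term appears. The error is \<open>1 / 8\<close> times \<open>5 / 4\<close>.\<close>
  obtain w where w: "(norm ((F - grid T R h' w) * tp ?Q))\<^sup>2 \<le> h'\<^sup>2 * real ?k * (norm (tp ?Q))\<^sup>2 / 4"
    "(norm (F - grid T R h' w))\<^sup>2 \<le> h'\<^sup>2 * real (?k * R)"
    using round_factor[OF T(1) F JQ h'(1)] by blast
  let ?F = "grid T R h' w"
  have e1: "norm ((Q - ?Q) * tp F) \<le> 1 / 8"
  proof (rule power2_le_imp_le)
    have "h\<^sup>2 * real ?k * (norm (tp F))\<^sup>2 / 4 = (norm F)\<^sup>2 / 64" using k by (simp add: h)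
    also have "\<dots> \<le> 1 / 64" using nF by (simp add: power_le_one)
    finally have "(norm ((Q - ?Q) * tp F))\<^sup>2 \<le> 1 / 64" by (rule order_trans[OF z(1)])
    then show "(norm ((Q - ?Q) * tp F))\<^sup>2 \<le> (1 / 8)\<^sup>2" by (simp add: power_divide)
  qed simp
  have dQ: "norm (Q - ?Q) \<le> sqrt (real R) / 4"
  proof (rule power2_le_imp_le)
    show "(norm (Q - ?Q))\<^sup>2 \<le> (sqrt (real R) / 4)\<^sup>2" using z(2) k by (simp add: h power_divide)
  qed simp
  have nQ': "norm ?Q \<le> 5 / 4 * sqrt (real R)"
  proof -
    have "norm ?Q \<le> norm Q + norm (Q - ?Q)" by (metis add.commute norm_triangle_sub norm_minus_commute)
    moreover have "norm Q \<le> sqrt (real R)" by (rule power2_le_imp_le) (use nQ in simp_all)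
    ultimately show ?thesis using dQ by simp
  qed
  have nQ2: "(norm ?Q)\<^sup>2 \<le> 25 / 16 * real R"
    using power_mono[OF nQ' norm_ge_zero, of 2] by (simp add: power_mult_distrib power_divide)
  have dF: "norm (F - ?F) \<le> 1 / 4"
  proof (rule power2_le_imp_le)
    show "(norm (F - ?F))\<^sup>2 \<le> (1 / 4)\<^sup>2" using w(2) k R by (simp add: h' power_divide)
  qed simp
  have nF': "(norm ?F)\<^sup>2 \<le> 25 / 16"
  proof -
    have "norm ?F \<le> norm F + norm (F - ?F)" by (metis add.commute norm_triangle_sub norm_minus_commute)
    then have "norm ?F \<le> 5 / 4" using nF dF by simp
    from power_mono[OF this norm_ge_zero, of 2] show ?thesis by (simp add: power_divide)
  qed
  have e2: "norm (?Q * tp (F - ?F)) \<le> 5 / 32"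
  proof (rule power2_le_imp_le)
    have "norm (?Q * tp (F - ?F)) = norm ((F - ?F) * tp ?Q)" using norm_tp[of "(F - ?F) * tp ?Q"] by simp
    then have "(norm (?Q * tp (F - ?F)))\<^sup>2 \<le> h'\<^sup>2 * real ?k * (norm ?Q)\<^sup>2 / 4" using w(1) by simp
    also have "\<dots> = (norm ?Q)\<^sup>2 / (64 * real R)" using k R by (simp add: h')
    also have "\<dots> \<le> (25 / 16 * real R) / (64 * real R)" using nQ2 by (intro divide_right_mono) auto
    finally show "(norm (?Q * tp (F - ?F)))\<^sup>2 \<le> (5 / 32)\<^sup>2" using R by (simp add: power_divide)
  qed simp
  have np: "net_point T R (restrict z (T \<times> {..<R})) (restrict w (T \<times> {..<R})) = ?Q * tp ?F"
    unfolding net_point_def by (simp only: grid_restrict[OF T(1)] h_def h'_def)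
  have split: "A * tp B = ?Q * tp ?F + (Q - ?Q) * tp F + ?Q * tp (F - ?F)"
    unfolding QF by (simp add: left_diff_distrib right_diff_distrib)
  have "norm (?Q * tp ?F) \<le> 2"
  proof -
    have "?Q * tp ?F = A * tp B - ((Q - ?Q) * tp F + ?Q * tp (F - ?F))" using split by simp
    then have "norm (?Q * tp ?F) \<le> norm (A * tp B) + norm ((Q - ?Q) * tp F + ?Q * tp (F - ?F))" by (metis norm_triangle_ineq4)
    also have "norm ((Q - ?Q) * tp F + ?Q * tp (F - ?F)) \<le> 1 / 8 + 5 / 32" by (intro norm_triangle_le add_mono e1 e2)
    finally show ?thesis using le by simp
  qed
  moreover have "restrict z (T \<times> {..<R}) \<in> lattice_ball (T \<times> {..<R})"
    by (rule in_lattice_ball[OF T(1) h(1)]) (use nQ2 k in \<open>simp add: h\<close>)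
  moreover have "restrict w (T \<times> {..<R}) \<in> lattice_ball (T \<times> {..<R})"
    by (rule in_lattice_ball[OF T(1) h'(1)]) (use nF' k R in \<open>simp add: h'\<close>)
  moreover have "proj T * (Q - ?Q) = Q - ?Q" "(Q - ?Q) * proj {..<R} = Q - ?Q"
    "proj T * (F - ?F) = F - ?F" "(F - ?F) * proj {..<R} = F - ?F"
    using Q F grid_supported[OF T(1)] by (simp_all add: left_diff_distrib right_diff_distrib)
  ultimately show ?thesis
    using that[of "restrict z (T \<times> {..<R})" "restrict w (T \<times> {..<R})" "Q - ?Q" F ?Q "F - ?F"]
      split e1 e2 F grid_supported[OF T(1), of R h z] unfolding np by blast
qed

text \<open>Let \<open>f\<close> be the supremum over the unit ball of sparse products. The
  approximation gives \<open>f \<le> t + (1 / 8 + 5 / 32) * f\<close>, and \<open>32 / 23\<close> is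
  below 2.\<close>

lemma net_reduction:
  assumes T: "finite T" and R: "0 < R" and t: "0 \<le> t"
    and net: "\<And>z w. z \<in> lattice_ball (T \<times> {..<R}) \<Longrightarrow> w \<in> lattice_ball (T \<times> {..<R}) \<Longrightarrow>
      norm (net_point T R z w) \<le> 2 \<Longrightarrow> inner W (net_point T R z w) \<le> t"
  shows "sparse_small T R (2 * t) W"
proof (cases "T = {}")
  case True
  have "proj {} = 0" by (rule fmat_eqI) simp
  then show ?thesis using True by (simp add: sparse_small_def)
next
  case ne: False
  define sup where "sup = (\<lambda>A. proj T * A = A \<and> A * proj {..<R} = A)"
  define Q where "Q = {A * tp B | A B. sup A \<and> sup B \<and> norm (A * tp B) \<le> 1}"
  define f where "f = Sup (inner W ` Q)"
  \<comment> \<open>The supremum is finite beforehand, which is what permits solving an inequality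
    that contains it on both sides.\<close>
  have bdd: "bdd_above (inner W ` Q)"
  proof (rule bdd_aboveI2)
    fix K assume "K \<in> Q"
    then have "norm K \<le> 1" by (auto simp: Q_def)
    then have "norm W * norm K \<le> norm W * 1" by (intro mult_left_mono) auto
    then show "inner W K \<le> norm W" using norm_cauchy_schwarz[of W K] by simp
  qed
  have le_f: "inner W K \<le> f" if "K \<in> Q" for K
    unfolding f_def using that bdd by (intro cSup_upper) auto
  have zero: "0 \<in> Q" unfolding Q_def sup_def by (auto intro!: exI[of _ 0])
  have f0: "0 \<le> f" using le_f[OF zero] by simp
  have scale: "inner W (A * tp B) \<le> f * norm (A * tp B)" if AB: "sup A" "sup B" for A B
  proof (cases "A * tp B = 0")
    case False
    let ?c = "norm (A * tp B)"
    have c: "0 < ?c" using False by simp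
    have "sup ((1 / ?c) *\<^sub>R A)" using AB(1) by (simp add: sup_def)
    moreover have "norm (((1 / ?c) *\<^sub>R A) * tp B) \<le> 1" using c by simp
    ultimately have "((1 / ?c) *\<^sub>R A) * tp B \<in> Q" unfolding Q_def using AB(2) by blast
    from le_f[OF this] show ?thesis using c by (simp add: field_simps)
  qed simp
  have "f \<le> t + 9 / 32 * f"
    unfolding f_def
  proof (rule cSup_least)
    show "inner W ` Q \<noteq> {}" using zero by auto
    fix y assume "y \<in> inner W ` Q"
    then obtain K A B where K: "K = A * tp B" "sup A" "sup B" "norm (A * tp B) \<le> 1" and y: "y = inner W K"
      by (auto simp: Q_def)
    obtain z w A1 B1 A2 B2 where n: "z \<in> lattice_ball (T \<times> {..<R})" "w \<in> lattice_ball (T \<times> {..<R})"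
      "norm (net_point T R z w) \<le> 2" "A * tp B = net_point T R z w + A1 * tp B1 + A2 * tp B2"
      "sup A1" "sup B1" "sup A2" "sup B2"
      "norm (A1 * tp B1) \<le> 1 / 8" "norm (A2 * tp B2) \<le> 5 / 32"
      using net_approximation[OF T ne R, of A B] K unfolding sup_def by metis
    have "inner W K = inner W (net_point T R z w) + inner W (A1 * tp B1) + inner W (A2 * tp B2)"
      unfolding K(1) n(4) by (simp add: inner_add_right)
    also have "\<dots> \<le> t + f * (1 / 8) + f * (5 / 32)"
      by (intro add_mono net n(1-3) order_trans[OF scale] mult_left_mono f0 n)
    also have "\<dots> = t + 9 / 32 * f" by simp
    finally show "y \<le> t + 9 / 32 * Sup (inner W ` Q)" by (simp add: f_def y)
  qed
  then have "f \<le> 2 * t" using t f0 by simp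
  then have "f * x \<le> 2 * t * x" if "0 \<le> x" for x using that by (rule mult_right_mono)
  then show ?thesis
    unfolding sparse_small_def using scale unfolding sup_def by (meson norm_ge_zero order_trans)
qed

text \<open>Smallness is a condition on uncountably many matrices, so the exceptional set is built
  from the finite net and is measurable. Each support contributes pairs of lattice points, whence
  \<open>54 = 2 * 27\<close>; net points have norm at most 2, whence
  \<open>64 = 16 * 2\<^sup>2\<close>.\<close>

lemma (in gaussian) good_event:
  assumes TT: "finite \<T>" "\<And>T. T \<in> \<T> \<Longrightarrow> T \<subseteq> {..<d} \<and> card T \<le> k" and R: "0 < R" and n: "0 < n"
    and t: "0 \<le> t" "t \<le> 2 * b"
  shows "\<exists>bad\<in>sets (sample_law n d S).
    emeasure (sample_law n d S) bad \<le> ennreal (real (card \<T>) * exp (54 * real (k * R)) * exp (- real n * t\<^sup>2 / (64 * b\<^sup>2))) \<and>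
    (\<forall>Z\<in>space (sample_law n d S) - bad. \<forall>T\<in>\<T>. sparse_small T R (2 * t) (fm (sample_cov n d Z) - fm S))"
proof -
  let ?P = "sample_law n d S"
  let ?B = "\<lambda>T. lattice_ball (T \<times> {..<R})"
  have finT: "finite T" if "T \<in> \<T>" for T using TT(2)[OF that] finite_subset by blast
  define \<Theta> where "\<Theta> = {(T, z, w). T \<in> \<T> \<and> z \<in> ?B T \<and> w \<in> ?B T \<and> norm (net_point T R z w) \<le> 2}"
  define E where "E = (\<lambda>(T, z, w). {Z \<in> space ?P. t \<le> inner (fm (sample_cov n d Z) - fm S) (net_point T R z w)})"
  define e where "e = exp (- real n * t\<^sup>2 / (64 * b\<^sup>2))"
  have sub: "\<Theta> \<subseteq> (SIGMA T:\<T>. ?B T \<times> ?B T)" by (auto simp: \<Theta>_def)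
  have finS: "finite (SIGMA T:\<T>. ?B T \<times> ?B T)"
    using TT(1) finT by (intro finite_SigmaI finite_cartesian_product finite_lattice_ball) auto
  have fin: "finite \<Theta>" using sub finS by (rule finite_subset)
  have card: "real (card \<Theta>) \<le> real (card \<T>) * exp (54 * real (k * R))"
  proof -
    have "real (card \<Theta>) \<le> real (card (SIGMA T:\<T>. ?B T \<times> ?B T))" using card_mono[OF finS sub] by simp
    also have "\<dots> = (\<Sum>T\<in>\<T>. real (card (?B T)) * real (card (?B T)))"
      using TT(1) finT by (subst card_SigmaI) (auto simp: card_cartesian_product intro!: finite_lattice_ball)
    also have "\<dots> \<le> (\<Sum>T\<in>\<T>. exp (27 * real (k * R)) * exp (27 * real (k * R)))"
    proof -
      have "real (card (?B T)) \<le> exp (27 * real (k * R))" if T: "T \<in> \<T>" for T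
      proof -
        have "real (card (?B T)) \<le> exp (27 * real (card (T \<times> {..<R})))"
        by (rule card_lattice_ball) (simp add: finT[OF T])
      also have "\<dots> \<le> exp (27 * real (k * R))"
        using TT(2)[OF T] by (simp add: card_cartesian_product mult_right_mono)
      finally show ?thesis .
      qed
      then show ?thesis by (intro sum_mono mult_mono) auto
    qed
    also have "\<dots> = real (card \<T>) * exp (54 * real (k * R))" by (simp add: exp_add[symmetric])
    finally show ?thesis .
  qed
  have corner: "corner d (net_point T R z w)" if "T \<in> \<T>" for T z w
  proof -
    have "proj T * net_point T R z w = net_point T R z w" "net_point T R z w * proj T = net_point T R z w"
    proof -
      note g = grid_supported(1)[OF finT[OF that]]
      show "proj T * net_point T R z w = net_point T R z w" by (simp add: net_point_def mult.assoc[symmetric] g)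
      have "tp (grid T R h w) * proj T = tp (grid T R h w)" for h using arg_cong[OF g[of R h w], of tp] by simp
      then show "net_point T R z w * proj T = net_point T R z w" by (simp add: net_point_def mult.assoc)
    qed
    then have z0: "ent (net_point T R z w) i j = 0" if "i \<notin> T \<or> j \<notin> T" for i j
      using that unfolding proj_fix_iff[OF finT[OF \<open>T \<in> \<T>\<close>]] fix_proj_iff[OF finT[OF \<open>T \<in> \<T>\<close>]] by blast
    have "i \<notin> T" if "d \<le> i" for i using TT(2)[OF \<open>T \<in> \<T>\<close>] that by auto
    then show ?thesis unfolding corner_def using z0 by blast
  qed
  have EE: "E \<theta> \<in> sets ?P \<and> emeasure ?P (E \<theta>) \<le> ennreal e" if "\<theta> \<in> \<Theta>" for \<theta>
  proof -
    obtain T z w where th1: "\<theta> = (T, z, w)" by (cases \<theta>) auto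
    with that have th: "\<theta> = (T, z, w)" "T \<in> \<T>" "norm (net_point T R z w) \<le> 2" by (auto simp: \<Theta>_def)
    have "E \<theta> \<in> sets ?P"
      unfolding E_def th(1) prod.case inner_diff_left using measurable_sample_quad[OF corner[OF th(2)]] by measurable
    moreover have "emeasure ?P (E \<theta>) \<le> ennreal (exp (- real n * t\<^sup>2 / (16 * b\<^sup>2 * 2\<^sup>2)))"
      unfolding E_def th(1) prod.case by (rule concentration[OF corner[OF th(2)] th(3) t(1) _ _ n]) (use t in auto)
    ultimately show ?thesis by (simp add: e_def mult.commute)
  qed
  show ?thesis
  proof (intro bexI conjI ballI)
    show "(\<Union>\<theta>\<in>\<Theta>. E \<theta>) \<in> sets ?P" using fin EE by auto
    have "emeasure ?P (\<Union>\<theta>\<in>\<Theta>. E \<theta>) \<le> (\<Sum>\<theta>\<in>\<Theta>. emeasure ?P (E \<theta>))"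
      using fin EE by (intro emeasure_subadditive_finite) auto
    also have "\<dots> \<le> (\<Sum>\<theta>\<in>\<Theta>. ennreal e)" using EE by (intro sum_mono) auto
    also have "\<dots> = ennreal (real (card \<Theta>) * e)" by (simp add: ennreal_mult e_def ennreal_of_nat_eq_real_of_nat)
    also have "\<dots> \<le> ennreal (real (card \<T>) * exp (54 * real (k * R)) * e)"
      using card by (intro ennreal_leI mult_right_mono) (auto simp: e_def)
    finally show "emeasure ?P (\<Union>\<theta>\<in>\<Theta>. E \<theta>) \<le> ennreal (real (card \<T>) * exp (54 * real (k * R)) * exp (- real n * t\<^sup>2 / (64 * b\<^sup>2)))"
      by (simp add: e_def)
    fix Z T assume Z: "Z \<in> space ?P - (\<Union>\<theta>\<in>\<Theta>. E \<theta>)" and T: "T \<in> \<T>"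
    show "sparse_small T R (2 * t) (fm (sample_cov n d Z) - fm S)"
    proof (rule net_reduction[OF finT[OF T] R t(1)])
      fix z w assume "z \<in> ?B T" "w \<in> ?B T" "norm (net_point T R z w) \<le> 2"
      then have "(T, z, w) \<in> \<Theta>" using T by (simp add: \<Theta>_def)
      then have "Z \<notin> E (T, z, w)" using Z by blast
      then show "inner (fm (sample_cov n d Z) - fm S) (net_point T R z w) \<le> t"
        using Z by (auto simp: E_def)
    qed
  qed
qed

section \<open>Effective sparsity and truncation\<close>

text \<open>The right-hand side increases on the positive points up to \<open>d\<close>, so the
  supremum of the admissible points is admissible itself and \<open>GREATEST\<close> is
  attained.\<close>

lemma eff_x_maximal:
  fixes s lam q :: real and d n r :: nat
  assumes q: "0 \<le> q" and s: "0 < s" and r: "0 < r" and d: "0 < d"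
  defines "f \<equiv> \<lambda>x. s * (real n * lam\<^sup>2 / (real r + ln (exp 1 * real d / x))) powr (q / 2)"
  shows "0 \<le> eff_x q s n d r lam" "eff_x q s n d r lam \<le> real d"
    "\<And>y. eff_x q s n d r lam < y \<Longrightarrow> y \<le> real d \<Longrightarrow> f y < y"
    "\<And>x y. 0 < x \<Longrightarrow> x \<le> y \<Longrightarrow> y \<le> real d \<Longrightarrow> f x \<le> f y"
proof -
  define P where "P = (\<lambda>x. 0 \<le> x \<and> x \<le> real d \<and> x \<le> f x)"
  have f0: "0 \<le> f x" for x unfolding f_def using s by simp
  have mono: "f x \<le> f y" if "0 < x" "x \<le> y" "y \<le> real d" for x y
  proof -
    have "1 \<le> ln (exp 1 * real d / y)"
    proof -
      have "exp 1 \<le> exp 1 * real d / y" using that by (simp add: field_simps)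
      then show ?thesis using that d by (subst ln_ge_iff) auto
    qed
    moreover have "ln (exp 1 * real d / y) \<le> ln (exp 1 * real d / x)"
      using that d by (intro ln_mono) (auto simp: frac_le)
    ultimately show ?thesis unfolding f_def using s q
      by (intro mult_left_mono powr_mono2 divide_left_mono mult_pos_pos divide_nonneg_nonneg) auto
  qed
  let ?A = "{x. P x}"
  have bdd: "bdd_above ?A" by (rule bdd_aboveI[of _ "real d"]) (simp add: P_def)
  have P0: "P 0" using f0[of 0] by (simp add: P_def)
  define z where "z = Sup ?A"
  have up: "x \<le> z" if "P x" for x unfolding z_def using bdd that by (intro cSup_upper) auto
  have z0: "0 \<le> z" using up[OF P0] .
  have ne: "?A \<noteq> {}" using P0 by blast
  have zd: "z \<le> real d" unfolding z_def by (rule cSup_least[OF ne]) (simp add: P_def)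
  have "z \<le> f z"
  proof (cases "z = 0")
    case True then show ?thesis using f0[of 0] by simp
  next
    case False
    have "x \<le> f z" if "P x" for x
    proof (cases "x = 0")
      case True then show ?thesis using f0[of z] by simp
    next
      case False
      then have "f x \<le> f z" using that up[OF that] zd by (intro mono) (auto simp: P_def)
      then show ?thesis using that by (simp add: P_def)
    qed
    then show ?thesis using P0 unfolding z_def by (intro cSup_least) auto
  qed
  then have Pz: "P z" using z0 zd by (simp add: P_def)
  have "eff_x q s n d r lam = z"
    unfolding eff_x_def using Pz up unfolding P_def f_def by (intro Greatest_equality) auto
  then show "0 \<le> eff_x q s n d r lam" "eff_x q s n d r lam \<le> real d"
    "\<And>y. eff_x q s n d r lam < y \<Longrightarrow> y \<le> real d \<Longrightarrow> f y < y"
    using z0 zd up unfolding P_def by (auto simp: not_le[symmetric]) (smt (verit, best))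
  show "\<And>x y. 0 < x \<Longrightarrow> x \<le> y \<Longrightarrow> y \<le> real d \<Longrightarrow> f x \<le> f y" by (rule mono)
qed

text \<open>Above the ceiling the defining inequality fails, unless the ceiling is already
  \<open>d\<close>. Inverted, the failure bounds \<open>s\<close> in the form in which the
  truncation uses it.\<close>

lemma eff_k_props:
  fixes s lam q :: real and d n r :: nat
  assumes q: "0 \<le> q" and s: "0 < s" and r: "0 < r" and d: "0 < d" and n: "0 < n" and lam: "0 < lam"
  defines "k \<equiv> eff_k q s n d r lam"
  shows "k \<le> d" and "0 < k \<Longrightarrow> k = d \<or> s \<le> real k * ((real r + ln (exp 1 * real d / real k)) / (real n * lam\<^sup>2)) powr (q / 2)"
proof -
  define f where "f = (\<lambda>x. s * (real n * lam\<^sup>2 / (real r + ln (exp 1 * real d / x))) powr (q / 2))"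
  let ?x = "eff_x q s n d r lam"
  note m = eff_x_maximal[OF q s r d, where n = n and lam = lam]
  have xk: "?x \<le> real k" "real k < ?x + 1" using m(1) unfolding k_def eff_k_def by linarith+
  show kd: "k \<le> d" using m(2) xk(2) by linarith
  assume k0: "0 < k"
  show "k = d \<or> s \<le> real k * ((real r + ln (exp 1 * real d / real k)) / (real n * lam\<^sup>2)) powr (q / 2)"
  proof (cases "k = d")
    case False
    then have kd': "real k < real d" using kd by simp
    \<comment> \<open>\<open>eff_x\<close> may equal \<open>k\<close>, where maximality is silent;
      the inequality at \<open>k\<close> is a limit of those at larger points.\<close>
    have "f (real k) \<le> y" if "real k < y" "y < real d" for y
    proof -
      have "f (real k) \<le> f y" unfolding f_def using that k0 by (intro m(4)) auto
      also have "f y < y" unfolding f_def using that xk(1) by (intro m(3)) auto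
      finally show ?thesis by simp
    qed
    then have fk: "f (real k) \<le> real k" by (rule dense_ge_bounded[OF kd'])
    define a where "a = (real r + ln (exp 1 * real d / real k)) / (real n * lam\<^sup>2)"
    have "0 \<le> ln (exp 1 * real d / real k)"
    proof (rule ln_ge_zero)
      have "1 * 1 \<le> exp 1 * (real d / real k)" using kd' k0 by (intro mult_mono) auto
      then show "1 \<le> exp 1 * real d / real k" by simp
    qed
    then have a: "0 < a" using r n lam by (simp add: a_def)
    have "s * (1 / a) powr (q / 2) \<le> real k" using fk by (simp add: f_def a_def)
    moreover have "(1 / a) powr (q / 2) * a powr (q / 2) = 1"
      using a by (subst powr_mult[symmetric]) auto
    ultimately have "s \<le> real k * a powr (q / 2)"
      using mult_right_mono[of "s * (1 / a) powr (q / 2)" "real k" "a powr (q / 2)"] by (simp add: mult.assoc)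
    then show ?thesis by (simp add: a_def)
  qed simp
qed

section \<open>Tails of weakly sparse rows\<close>

lemma power_tail_step:
  fixes \<beta> :: real
  assumes j: "0 < j" and \<beta>: "0 < \<beta>"
  shows "\<beta> * real (Suc j) powr (- (\<beta> + 1)) \<le> real j powr (- \<beta>) - real (Suc j) powr (- \<beta>)"
proof -
  let ?t = "real (Suc j)"
  have t: "0 < ?t" "1 < ?t" using j by auto
  have "ln (1 - 1 / ?t) \<le> - (1 / ?t)" using t by (intro order_trans[OF ln_le_minus_one]) auto
  then have "\<beta> * (1 / ?t) \<le> \<beta> * - ln (1 - 1 / ?t)" using \<beta> by (intro mult_left_mono) auto
  then have "1 + \<beta> / ?t \<le> exp (- \<beta> * ln (1 - 1 / ?t))"
    using exp_ge_add_one_self[of "- \<beta> * ln (1 - 1 / ?t)"] by simp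
  also have "\<dots> = (1 - 1 / ?t) powr (- \<beta>)" using t by (simp add: powr_def)
  finally have "?t powr (- \<beta>) * (1 + \<beta> / ?t) \<le> ?t powr (- \<beta>) * (1 - 1 / ?t) powr (- \<beta>)"
    by (intro mult_left_mono) auto
  also have "\<dots> = (?t * (1 - 1 / ?t)) powr (- \<beta>)" using t by (subst powr_mult) auto
  also have "?t * (1 - 1 / ?t) = real j" by (simp add: field_simps)
  finally have "?t powr (- \<beta>) + ?t powr (- \<beta>) * \<beta> / ?t \<le> real j powr (- \<beta>)" by (simp add: distrib_left)
  moreover have "?t powr (- (\<beta> + 1)) = ?t powr (- \<beta>) / ?t"
  proof -
    have "?t powr (- \<beta> - 1) = ?t powr (- \<beta>) / ?t powr 1" by (rule powr_diff)
    moreover have "- (\<beta> + 1) = - \<beta> - 1" by simp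
    moreover have "?t powr 1 = ?t" by (rule powr_one) (use t in simp)
    ultimately show ?thesis by (simp only:)
  qed
  ultimately show ?thesis by (simp add: mult.commute)
qed

text \<open>Summing the telescoping step, the discrete form of integrating a power over a
  tail.\<close>

lemma power_tail:
  fixes \<beta> :: real
  assumes k: "0 < k" and \<beta>: "0 < \<beta>"
  shows "(\<Sum>j\<in>{k..<p}. (real k / real (Suc j)) powr (\<beta> + 1)) \<le> real k / \<beta>"
proof -
  have "\<beta> * (\<Sum>j\<in>{k..<p}. real (Suc j) powr (- (\<beta> + 1))) \<le> real k powr (- \<beta>)"
  proof (cases "k \<le> p")
    case True
    then have "\<beta> * (\<Sum>j\<in>{k..<p}. real (Suc j) powr (- (\<beta> + 1))) \<le> real k powr (- \<beta>) - real p powr (- \<beta>)"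
    proof (induction p rule: dec_induct)
      case (step p)
      then show ?case using power_tail_step[OF _ \<beta>, of p] k by (simp add: distrib_left)
    qed simp
    then show ?thesis by (smt (verit) powr_ge_zero)
  qed simp
  then have "real k powr (\<beta> + 1) * (\<beta> * (\<Sum>j\<in>{k..<p}. real (Suc j) powr (- (\<beta> + 1)))) \<le> real k powr (\<beta> + 1) * real k powr (- \<beta>)"
    by (rule mult_left_mono) simp
  also have "real k powr (\<beta> + 1) * real k powr (- \<beta>) = real k" using k by (simp add: powr_add[symmetric])
  finally have "\<beta> * (real k powr (\<beta> + 1) * (\<Sum>j\<in>{k..<p}. real (Suc j) powr (- (\<beta> + 1)))) \<le> real k"
    by (simp add: mult.left_commute)
  moreover have "(\<Sum>j\<in>{k..<p}. (real k / real (Suc j)) powr (\<beta> + 1)) = real k powr (\<beta> + 1) * (\<Sum>j\<in>{k..<p}. real (Suc j) powr (- (\<beta> + 1)))"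
    unfolding sum_distrib_left
  proof (intro sum.cong refl)
    fix j
    have "(real k / real (Suc j)) powr (\<beta> + 1) = real k powr (\<beta> + 1) / real (Suc j) powr (\<beta> + 1)"
      by (rule powr_divide)
    then show "(real k / real (Suc j)) powr (\<beta> + 1) = real k powr (\<beta> + 1) * real (Suc j) powr (- (\<beta> + 1))"
      by (simp only: powr_minus divide_inverse)
  qed
  ultimately show ?thesis using \<beta> by (simp add: field_simps)
qed

section \<open>Sorted rows and truncation\<close>

abbreviation row_norm :: "real mat \<Rightarrow> nat \<Rightarrow> real" where
  "row_norm A i \<equiv> vec_l2 (Matrix.row A i)"

lemma row_norm_power2: "i < dim_row A \<Longrightarrow> (row_norm A i)\<^sup>2 = (\<Sum>j<dim_col A. (A $$ (i, j))\<^sup>2)"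
  by (simp add: vec_l2_def L2_set_def sum_nonneg)

lemma row_norm_nonneg: "0 \<le> row_norm A i"
  by (simp add: vec_l2_def)

lemma row_norm_0_iff: "i < dim_row A \<Longrightarrow> row_norm A i = 0 \<longleftrightarrow> (\<forall>j<dim_col A. A $$ (i, j) = 0)"
  using row_norm_power2[of i A] by (auto simp: sum_nonneg_eq_0_iff)

lemma sorted_row_order:
  "\<exists>\<pi>. bij_betw \<pi> {..<dim_row A} {..<dim_row A} \<and>
    (\<forall>j<dim_row A. sorted_row_norms A ! j = row_norm A (\<pi> j)) \<and>
    (\<forall>i j. i \<le> j \<longrightarrow> j < dim_row A \<longrightarrow> row_norm A (\<pi> j) \<le> row_norm A (\<pi> i))"
proof -
  let ?p = "dim_row A"
  let ?f = "row_norm A"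
  define xs where "xs = rev (sort_key ?f [0..<?p])"
  have "sort (map ?f [0..<?p]) = map ?f (sort_key ?f [0..<?p])"
    by (rule properties_for_sort) simp_all
  then have s: "sorted_row_norms A = map ?f xs" by (simp add: sorted_row_norms_def xs_def rev_map)
  have l: "length xs = ?p" by (simp add: xs_def)
  have "bij_betw ((!) xs) {..<?p} {..<?p}"
    by (rule bij_betw_nth) (auto simp: xs_def atLeast0LessThan)
  moreover have "sorted_row_norms A ! j = ?f (xs ! j)" if "j < ?p" for j using that l by (simp add: s)
  moreover have "?f (xs ! j) \<le> ?f (xs ! i)" if "i \<le> j" "j < ?p" for i j
  proof -
    have "sorted (map ?f (rev xs))" by (simp add: xs_def)
    then have "sorted (rev (map ?f xs))" by (simp add: rev_map)
    from sorted_rev_nth_mono[OF this that(1)] show ?thesis using that l by simp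
  qed
  ultimately show ?thesis by blast
qed

lemma weak_norm_ge: "j < dim_row A \<Longrightarrow> real (Suc j) * (sorted_row_norms A ! j) powr q \<le> weak_norm q A"
proof -
  assume j: "j < dim_row A"
  let ?g = "\<lambda>j. real (Suc j) * (sorted_row_norms A ! j) powr q"
  have "?g j \<in> ?g ` {..<dim_row A}" using j by blast
  then have "?g j \<le> Max (?g ` {..<dim_row A})" by (intro Max_ge finite_imageI finite_lessThan)
  then show ?thesis by (simp only: weak_norm_def)
qed

text \<open>Sorting puts the nonzero rows first, the maximum sits at the last of them, and
  \<open>0 powr 0 = 0\<close> discards the rest.\<close>

lemma weak_norm_0:
  assumes "0 < dim_row A"
  shows "weak_norm 0 A = real (card {i. i < dim_row A \<and> row_norm A i \<noteq> 0})"
proof -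
  let ?p = "dim_row A"
  obtain \<pi> where \<pi>': "bij_betw \<pi> {..<?p} {..<?p} \<and>
    (\<forall>j<?p. sorted_row_norms A ! j = row_norm A (\<pi> j)) \<and>
    (\<forall>i j. i \<le> j \<longrightarrow> j < ?p \<longrightarrow> row_norm A (\<pi> j) \<le> row_norm A (\<pi> i))"
    using sorted_row_order[of A] by (rule exE)
  note \<pi> = \<pi>'[THEN conjunct1] \<pi>'[THEN conjunct2, THEN conjunct1, rule_format] \<pi>'[THEN conjunct2, THEN conjunct2, rule_format]
  let ?J = "{j. j < ?p \<and> row_norm A (\<pi> j) \<noteq> 0}"
  let ?N = "card ?J"
  have "bij_betw \<pi> ?J {i. i < ?p \<and> row_norm A i \<noteq> 0}"
    using \<pi>(1) unfolding bij_betw_def by (auto simp: inj_on_def set_eq_iff)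
  then have N: "?N = card {i. i < ?p \<and> row_norm A i \<noteq> 0}" by (rule bij_betw_same_card)
  have down: "i \<in> ?J" if "j \<in> ?J" "i \<le> j" for i j
    using that \<pi>(3)[of i j] row_norm_nonneg[of A "\<pi> j"] by auto
  have finJ: "finite ?J" by simp
  have J: "?J = {..<?N}"
  proof -
    have "j < ?N" if "j \<in> ?J" for j
    proof -
      have "{..j} \<subseteq> ?J" using down[OF that] by auto
      from card_mono[OF finJ this] show ?thesis by simp
    qed
    then have "?J \<subseteq> {..<?N}" by auto
    then show ?thesis by (rule card_subset_eq[rotated]) auto
  qed
  have v: "real (Suc j) * (sorted_row_norms A ! j) powr 0 = (if j < ?N then real (Suc j) else 0)" if "j < ?p" for j
  proof -
    have "j \<in> ?J \<longleftrightarrow> j < ?N" using J by blast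
    then show ?thesis using that \<pi>(2)[OF that] by auto
  qed
  have Np: "?N \<le> ?p" using card_mono[of "{..<?p}" ?J] by auto
  have "weak_norm 0 A = Max ((\<lambda>j. if j < ?N then real (Suc j) else 0) ` {..<?p})"
    unfolding weak_norm_def by (intro arg_cong[of _ _ Max] image_cong refl v) simp
  also have "\<dots> = real ?N"
  proof (rule Max_eqI)
    fix y assume "y \<in> (\<lambda>j. if j < ?N then real (Suc j) else 0) ` {..<?p}"
    then show "y \<le> real ?N" by (auto split: if_splits)
  next
    show "real ?N \<in> (\<lambda>j. if j < ?N then real (Suc j) else 0) ` {..<?p}"
    proof (cases ?N)
      case 0 then show ?thesis using assms by (auto intro!: image_eqI[of _ _ 0])
    next
      case (Suc N') then show ?thesis using Np by (auto intro!: image_eqI[of _ _ N'])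
    qed
  qed simp
  finally show ?thesis using N by simp
qed

text \<open>The \<open>k\<close> largest rows are kept. Beyond them the weak norm makes the squared
  row norms decay with exponent \<open>2 / q\<close>, which exceeds one because
  \<open>q < 2\<close>, so the tail is summable and of order \<open>k * a\<close>.\<close>

lemma truncation:
  fixes A :: "real mat"
  assumes A: "A \<in> carrier_mat p r" and k: "0 < k" "k \<le> p" and r: "0 < r" and q: "0 \<le> q" "q < 2"
    and wn: "weak_norm q A \<le> s" and a: "0 < a" and s: "k = p \<or> s \<le> real k * a powr (q / 2)"
  shows "\<exists>I U0. I \<subseteq> {..<p} \<and> card I = k \<and> proj I * U0 = U0 \<and> U0 * proj {..<r} = U0 \<and>
    (\<forall>i\<in>I. \<exists>j. ent U0 i j \<noteq> 0) \<and>
    norm (U0 - fm A) \<le> (sqrt (q / (2 - q)) + 1) * sqrt (real k * a)"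
proof -
  have dims: "dim_row A = p" "dim_col A = r" using A by auto
  obtain \<pi> where \<pi>': "bij_betw \<pi> {..<p} {..<p} \<and>
    (\<forall>j<p. sorted_row_norms A ! j = row_norm A (\<pi> j)) \<and>
    (\<forall>i j. i \<le> j \<longrightarrow> j < p \<longrightarrow> row_norm A (\<pi> j) \<le> row_norm A (\<pi> i))"
    using sorted_row_order[of A, unfolded dims] by (rule exE)
  note \<pi> = \<pi>'[THEN conjunct1] \<pi>'[THEN conjunct2, THEN conjunct1, rule_format] \<pi>'[THEN conjunct2, THEN conjunct2, rule_format]
  define I where "I = \<pi> ` {..<k}"
  have inj: "inj_on \<pi> {..<p}" using \<pi>(1) by (rule bij_betw_imp_inj_on)
  have Ip: "I \<subseteq> {..<p}" using \<pi>(1) k(2) unfolding I_def bij_betw_def by auto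
  have fI: "finite I" by (simp add: I_def)
  have cI: "card I = k" unfolding I_def using k(2) by (subst card_image) (auto intro: inj_on_subset[OF inj])
  have Ic: "{..<p} - I = \<pi> ` {k..<p}"
  proof -
    have "\<pi> ` {..<p} - \<pi> ` {..<k} = \<pi> ` ({..<p} - {..<k})"
      using k(2) by (intro inj_on_image_set_diff[OF inj, symmetric]) auto
    moreover have "{..<p} - {..<k} = {k..<p}" by auto
    ultimately show ?thesis using \<pi>(1) by (simp add: I_def bij_betw_def)
  qed
  have wb: "real (Suc j) * row_norm A (\<pi> j) powr q \<le> s" if "j < p" for j
    using weak_norm_ge[of j A q] wn that \<pi>(2)[OF that] dims by simp
  have tail: "(\<Sum>j\<in>{k..<p}. (row_norm A (\<pi> j))\<^sup>2) \<le> q / (2 - q) * (real k * a)"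
  proof (cases "k = p")
    case True then show ?thesis using q a by simp
  next
    case False
    then have s': "s \<le> real k * a powr (q / 2)" using s by simp
    show ?thesis
    \<comment> \<open>The exponent \<open>2 / q\<close> has no meaning for \<open>q = 0\<close>;
      there the rows beyond \<open>k\<close> are exactly zero.\<close>
    proof (cases "q = 0")
      case True
      have "row_norm A (\<pi> j) = 0" if "j \<in> {k..<p}" for j
      proof (rule ccontr)
        assume "row_norm A (\<pi> j) \<noteq> 0"
        then have "real (Suc j) \<le> s" using wb[of j] that True by simp
        also have "\<dots> \<le> real k" using s' True a by simp
        finally show False using that by simp
      qed
      then show ?thesis using True by simp
    next
      case False
      then have q0: "0 < q" using q by simp
      \<comment> \<open>The decay exponent is \<open>\<beta> + 1\<close>, and
        \<open>1 / \<beta>\<close> is the factor \<open>q / (2 - q)\<close> of the claim.\<close>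
      define \<beta> where "\<beta> = 2 / q - 1"
      have \<beta>: "0 < \<beta>" using q q0 by (simp add: \<beta>_def)
      have "(row_norm A (\<pi> j))\<^sup>2 \<le> a * (real k / real (Suc j)) powr (\<beta> + 1)" if j: "j \<in> {k..<p}" for j
      proof (cases "row_norm A (\<pi> j) = 0")
        case False
        let ?x = "row_norm A (\<pi> j)"
        have x: "0 < ?x" using False row_norm_nonneg[of A "\<pi> j"] by simp
        have "real (Suc j) * ?x powr q \<le> real k * a powr (q / 2)" using wb[of j] j s' by simp
        then have "?x powr q \<le> real k / real (Suc j) * a powr (q / 2)" by (simp add: field_simps)
        then have "(?x powr q) powr (2 / q) \<le> (real k / real (Suc j) * a powr (q / 2)) powr (2 / q)"
          using q0 by (intro powr_mono2) auto
        also have "\<dots> = (real k / real (Suc j)) powr (2 / q) * a"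
          using a q0 by (subst powr_mult) (auto simp: powr_powr)
        also have "(?x powr q) powr (2 / q) = ?x\<^sup>2" using x q0 by (simp add: powr_powr powr_realpow)
        finally show ?thesis by (simp add: \<beta>_def mult.commute)
      qed (use a in simp)
      then have "(\<Sum>j\<in>{k..<p}. (row_norm A (\<pi> j))\<^sup>2) \<le> (\<Sum>j\<in>{k..<p}. a * (real k / real (Suc j)) powr (\<beta> + 1))"
        by (rule sum_mono)
      also have "\<dots> \<le> a * (real k / \<beta>)"
        unfolding sum_distrib_left[symmetric] using a by (intro mult_left_mono power_tail k(1) \<beta>) auto
      also have "1 / \<beta> = q / (2 - q)" using q0 q by (simp add: \<beta>_def field_simps)
      then have "a * (real k / \<beta>) = q / (2 - q) * (real k * a)" by (simp add: divide_inverse mult_ac)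
      finally show ?thesis .
    qed
  qed
  have res: "(norm (fm A - proj I * fm A))\<^sup>2 \<le> q / (2 - q) * (real k * a)"
  proof -
    let ?D = "fm A - proj I * fm A"
    have eD: "ent ?D i j = (if i \<in> I then 0 else ent (fm A) i j)" for i j using fI by (simp add: ent_proj_mult)
    have "proj {..<p} * ?D = ?D" "?D * proj {..<r} = ?D"
      by (auto simp: proj_fix_iff fix_proj_iff eD ent_fm dims simp del: ent_diff)
    then have "(norm ?D)\<^sup>2 = (\<Sum>ij\<in>{..<p} \<times> {..<r}. (ent ?D (fst ij) (snd ij))\<^sup>2)"
      by (intro norm_power2_supported) auto
    also have "\<dots> = (\<Sum>i<p. \<Sum>j<r. (ent ?D i j)\<^sup>2)" by (simp add: sum.cartesian_product')
    also have "\<dots> = (\<Sum>i<p. if i \<in> I then 0 else (row_norm A i)\<^sup>2)"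
      unfolding eD by (intro sum.cong refl) (auto simp: row_norm_power2 dims ent_fm)
    also have "\<dots> = (\<Sum>i\<in>{..<p} - I. (row_norm A i)\<^sup>2)"
      by (rule sum.mono_neutral_cong_right) auto
    also have "\<dots> = (\<Sum>j\<in>{k..<p}. (row_norm A (\<pi> j))\<^sup>2)"
      unfolding Ic by (subst sum.reindex) (auto intro: inj_on_subset[OF inj])
    finally show ?thesis using tail by simp
  qed
  \<comment> \<open>Exactly \<open>k\<close> rows have to be nonzero, so vanishing rows among the
    kept ones receive \<eta> in column 0. At most \<open>k\<close> such entries cost no more than
    \<open>sqrt (real k * a)\<close>, the order of the tail.\<close>
  define \<eta> where "\<eta> = sqrt (real k * a) / real k"
  have \<eta>: "0 < \<eta>" using k a by (simp add: \<eta>_def)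
  define Z where "Z = {i \<in> I. \<forall>j. ent (fm A) i j = 0}"
  have fZ: "finite Z" using fI by (simp add: Z_def)
  define N where "N = (\<Sum>i\<in>Z. \<eta> *\<^sub>R unitm i 0)"
  have eN: "ent N i j = (if i \<in> Z \<and> j = 0 then \<eta> else 0)" for i j
  proof -
    have "ent N i j = (\<Sum>l\<in>Z. if l = i then (if j = 0 then \<eta> else 0) else 0)"
      unfolding N_def ent_sum by (intro sum.cong) auto
    then show ?thesis using fZ by simp
  qed
  define U0 where "U0 = proj I * fm A + N"
  have eU: "ent U0 i j = (if i \<in> I then ent (fm A) i j else 0) + (if i \<in> Z \<and> j = 0 then \<eta> else 0)" for i j
    using fI by (simp add: U0_def ent_proj_mult eN)
  have nN: "norm N \<le> sqrt (real k * a)"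
  proof -
    have "norm (unitm i 0) = 1" for i by (simp add: norm_eq_sqrt_inner inner_unitm)
    then have "norm N \<le> (\<Sum>i\<in>Z. \<eta>)"
      unfolding N_def using \<eta> by (intro order_trans[OF norm_sum] sum_mono) simp
    also have "\<dots> \<le> real k * \<eta>" using card_mono[OF fI, of Z] cI \<eta> by (auto simp: Z_def intro!: mult_right_mono)
    also have "\<dots> = sqrt (real k * a)" using k by (simp add: \<eta>_def)
    finally show ?thesis .
  qed
  have "norm (U0 - fm A) \<le> norm N + norm (fm A - proj I * fm A)"
    using norm_triangle_ineq4[of N "fm A - proj I * fm A"] by (simp add: U0_def algebra_simps)
  also have "norm (fm A - proj I * fm A) \<le> sqrt (q / (2 - q)) * sqrt (real k * a)"
    unfolding real_sqrt_mult[symmetric] using res by (rule real_le_rsqrt)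
  finally have "norm (U0 - fm A) \<le> (sqrt (q / (2 - q)) + 1) * sqrt (real k * a)"
    using nN by (simp add: distrib_right)
  moreover have "proj I * U0 = U0" using fI by (auto simp: proj_fix_iff eU Z_def)
  moreover have "U0 * proj {..<r} = U0" using r by (auto simp: fix_proj_iff eU ent_fm dims)
  moreover have "\<exists>j. ent U0 i j \<noteq> 0" if "i \<in> I" for i
  proof (cases "i \<in> Z")
    case True
    then have "ent U0 i 0 = \<eta>" by (simp add: eU Z_def)
    then show ?thesis using \<eta> by (intro exI[of _ 0]) simp
  next
    case False
    then show ?thesis using that by (auto simp: eU Z_def)
  qed
  ultimately show ?thesis using Ip cI by blast
qed

section \<open>The population model\<close>

lemma psd_cauchy:
  assumes sym: "tp S = S" and psd: "\<And>X. 0 \<le> inner (S * X) X"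
  shows "(inner (S * X) Y)\<^sup>2 \<le> inner (S * X) X * inner (S * Y) Y"
proof -
  let ?a = "inner (S * X) X" and ?b = "inner (S * X) Y" and ?c = "inner (S * Y) Y"
  have ba: "inner (S * Y) X = ?b" using inner_mult_left[of S Y X] sym by (simp add: inner_commute)
  have q: "0 \<le> ?a - 2 * t * ?b + t\<^sup>2 * ?c" for t
    using psd[of "X - t *\<^sub>R Y"] ba
    by (simp add: right_diff_distrib inner_diff_left inner_diff_right power2_eq_square algebra_simps)
  show ?thesis
  proof (cases "?c = 0")
    case True
    have "?b = 0"
    proof (rule ccontr)
      assume "?b \<noteq> 0"
      \<comment> \<open>A degenerate form is linear in \<open>t\<close>; this \<open>t\<close> gives
        it the value \<open>- 1\<close>, against positivity.\<close>
      then have "?a - 2 * ((?a + 1) / (2 * ?b)) * ?b + ((?a + 1) / (2 * ?b))\<^sup>2 * ?c = - 1"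
        using True by (simp add: field_simps)
      then show False using q[of "(?a + 1) / (2 * ?b)"] by linarith
    qed
    then show ?thesis using True by simp
  next
    case False
    then have c: "0 < ?c" using psd[of Y] by simp
    have "?a - 2 * (?b / ?c) * ?b + (?b / ?c)\<^sup>2 * ?c = ?a - ?b\<^sup>2 / ?c"
      using c by (simp add: field_simps power2_eq_square)
    then have "?b\<^sup>2 / ?c \<le> ?a" using q[of "?b / ?c"] by simp
    then show ?thesis using c by (simp add: pos_divide_le_eq)
  qed
qed

lemma square_cancel: "(x::real)\<^sup>2 * x\<^sup>2 \<le> x\<^sup>2 * y \<Longrightarrow> 0 \<le> y \<Longrightarrow> x\<^sup>2 \<le> y"
  using mult_le_cancel_left_pos[of "x\<^sup>2" "x\<^sup>2" y] by (cases "x = 0") auto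

lemma inner_columns:
  assumes "corner N Y"
  shows "inner X Y = (\<Sum>j<N. inner (X * unitm j 0) (Y * unitm j 0))"
proof -
  have "inner (X * unitm j 0) (Y * unitm j 0) = inner X (Y * unitm j j)" for j
  proof -
    have u: "unitm j 0 * unitm 0 j = unitm j j" by (rule fmat_eqI) (auto simp: ent_unitm_mult)
    show ?thesis using inner_mult_right[of X "unitm j 0" "Y * unitm j 0"] by (simp add: mult.assoc u)
  qed
  then have "(\<Sum>j<N. inner (X * unitm j 0) (Y * unitm j 0)) = inner X (Y * (\<Sum>j<N. unitm j j))"
    by (simp add: inner_sum_right sum_distrib_left)
  also have "(\<Sum>j<N. unitm j j) = proj {..<N}"
    by (rule fmat_eqI) (auto simp: ent_sum intro!: sum.neutral)
  also have "Y * proj {..<N} = Y" using ent_zero[OF assms] by (auto simp: fix_proj_iff)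
  finally show ?thesis by simp
qed

section \<open>Vectors, operator norms and joint coordinates\<close>

lemma column_cv: "x * proj {0} = x \<Longrightarrow> proj {..<d} * x = cv d (\<lambda>i. ent x i 0)"
  by (rule fmat_eqI) (auto simp: ent_proj_mult ent_cv fix_proj_iff)

lemma fm_mult_vec: "fm A * cv (dim_col A) z = cv (dim_row A) (\<lambda>i. vec_index (A *\<^sub>v Matrix.vec (dim_col A) z) i)"
proof (rule fmat_eqI)
  fix i j
  let ?N = "max (dim_row A) (dim_col A)"
  have w: "corner ?N (fm A)" by (auto simp: corner_def ent_fm)
  have "ent (fm A * cv (dim_col A) z) i j = (\<Sum>l<?N. ent (fm A) i l * ent (cv (dim_col A) z) l j)"
    using w by (intro ent_mult_corner) simp
  also have "\<dots> = (\<Sum>l<dim_col A. ent (fm A) i l * ent (cv (dim_col A) z) l j)"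
    by (rule sum.mono_neutral_right) (auto simp: ent_cv)
  also have "\<dots> = ent (cv (dim_row A) (\<lambda>i. vec_index (A *\<^sub>v Matrix.vec (dim_col A) z) i)) i j"
    by (auto simp: ent_fm ent_cv scalar_prod_def atLeast0LessThan intro!: sum.cong)
  finally show "ent (fm A * cv (dim_col A) z) i j = ent (cv (dim_row A) (\<lambda>i. vec_index (A *\<^sub>v Matrix.vec (dim_col A) z) i)) i j" .
qed

lemma vec_l2_cv: "vec_l2 v = norm (cv (dim_vec v) (vec_index v))"
  by (simp add: vec_l2_def L2_set_def norm_cv[symmetric])

text \<open>\<open>op_norm\<close> is a real supremum and controls vectors only once its set is
  known to be bounded; the Frobenius norm provides that bound.\<close>

lemma opb_op_norm: "opb (fm A) (op_norm A)"
proof (rule opb_columns)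
  let ?V = "{vec_l2 (A *\<^sub>v v) | v. v \<in> carrier_vec (dim_col A) \<and> vec_l2 v \<le> 1}"
  have img: "vec_l2 (A *\<^sub>v Matrix.vec (dim_col A) z) = norm (fm A * cv (dim_col A) z)" for z
    unfolding fm_mult_vec vec_l2_cv by simp
  have nv: "vec_l2 (Matrix.vec d z) = norm (cv d z)" for d z
    unfolding vec_l2_cv by (simp add: cv_def) (rule arg_cong[of _ _ norm], rule mk_eqI, auto)
  have bdd: "bdd_above ?V"
  proof (rule bdd_aboveI)
    fix y assume "y \<in> ?V"
    then obtain v where v: "y = vec_l2 (A *\<^sub>v v)" "v \<in> carrier_vec (dim_col A)" "vec_l2 v \<le> 1" by auto
    have vv: "v = Matrix.vec (dim_col A) (vec_index v)" using v(2) by auto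
    have "y = norm (fm A * cv (dim_col A) (vec_index v))" unfolding v(1) using img vv by metis
    also have "\<dots> \<le> norm (fm A) * norm (cv (dim_col A) (vec_index v))" by (rule norm_mult_ineq)
    also have "\<dots> \<le> norm (fm A) * 1"
      using v nv[of "dim_col A" "vec_index v"] vv by (intro mult_left_mono) auto
    finally show "y \<le> norm (fm A)" by simp
  qed
  have up: "norm (fm A * cv (dim_col A) z) \<le> op_norm A" if "norm (cv (dim_col A) z) \<le> 1" for z
    unfolding op_norm_def
  proof (rule cSup_upper[OF _ bdd])
    show "norm (fm A * cv (dim_col A) z) \<in> ?V"
      using that nv img[of z, symmetric] by (intro CollectI exI[of _ "Matrix.vec (dim_col A) z"]) auto
  qed
  have "cv (dim_col A) (\<lambda>_. 0) = 0" by (rule fmat_eqI) (simp add: ent_cv)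
  then show 0: "0 \<le> op_norm A" using up[of "\<lambda>_. 0"] by simp
  fix x assume x: "x * proj {0} = x"
  let ?z = "\<lambda>i. ent x i 0"
  let ?y = "cv (dim_col A) ?z"
  have y: "?y = proj {..<dim_col A} * x" by (rule column_cv[OF x, symmetric])
  have fx: "fm A * x = fm A * ?y"
    using fm_cols[of "{..<dim_col A}" A] by (simp add: y mult.assoc[symmetric])
  have "norm (fm A * ?y) \<le> op_norm A * norm ?y"
  proof (cases "?y = 0")
    case False
    let ?c = "norm ?y"
    have c: "0 < ?c" using False by simp
    have s: "cv (dim_col A) (\<lambda>i. ?z i / ?c) = (1 / ?c) *\<^sub>R ?y" by (rule fmat_eqI) (simp add: ent_cv)
    have "norm (fm A * ((1 / ?c) *\<^sub>R ?y)) \<le> op_norm A"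
      unfolding s[symmetric] by (rule up) (use c in \<open>simp add: s\<close>)
    then show ?thesis using c by (simp add: field_simps)
  qed simp
  also have "norm ?y \<le> norm x" unfolding y by (rule norm_proj_le) simp
  finally show "norm (fm A * x) \<le> op_norm A * norm x" unfolding fx using 0 by (simp add: mult_left_mono)
qed

text \<open>Moves the \<open>Y\<close> coordinates to the indices from \<open>p\<close> on, where they sit in the joint covariance.\<close>
definition row_shift :: "nat \<Rightarrow> nat \<Rightarrow> fmat" where
  "row_shift p m = mk (p + m) (\<lambda>i j. if i = j + p \<and> j < m then 1 else 0)"

lemma ent_shift: "ent (row_shift p m) i j = (if i = j + p \<and> j < m then 1 else 0)"
  by (auto simp: row_shift_def ent_mk)

lemma ent_shift_mult: "ent (row_shift p m * A) i j = (if p \<le> i \<and> i < p + m then ent A (i - p) j else 0)"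
proof -
  have "ent (row_shift p m * A) i j = (\<Sum>l<p+m. ent (row_shift p m) i l * ent A l j)"
    by (rule ent_mult_corner) (simp add: row_shift_def corner_mk)
  also have "\<dots> = (\<Sum>l<p+m. if l = i - p then (if p \<le> i \<and> i < p + m then ent A (i - p) j else 0) else 0)"
    by (intro sum.cong) (auto simp: ent_shift)
  finally show ?thesis by auto
qed

lemma ent_mult_shift: "ent (A * row_shift p m) i j = (if j < m then ent A i (j + p) else 0)"
proof -
  have "ent (A * row_shift p m) i j = (\<Sum>l<p+m. ent A i l * ent (row_shift p m) l j)"
    by (rule ent_mult_corner) (simp add: row_shift_def corner_mk)
  also have "\<dots> = (\<Sum>l<p+m. if l = j + p then (if j < m then ent A i (j + p) else 0) else 0)"
    by (intro sum.cong) (auto simp: ent_shift)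
  finally show ?thesis by auto
qed

lemma shift_gram: "tp (row_shift p m) * row_shift p m = proj {..<m}"
  by (rule fmat_eqI) (auto simp: ent_mult_shift ent_shift)

lemma shift_proj: "row_shift p m * tp (row_shift p m) = proj {p..<p + m}"
  by (rule fmat_eqI) (auto simp: ent_shift_mult ent_shift)

lemma proj_shift: "proj {p..<p + m} * row_shift p m = row_shift p m"
  by (auto simp: proj_fix_iff ent_shift)

lemma norm_mult_tp_shift: "X * proj {..<m} = X \<Longrightarrow> norm (X * tp (row_shift p m)) = norm X"
  using inner_mult_right[of X "tp (row_shift p m)" "X * tp (row_shift p m)"]
  by (simp add: norm_eq_sqrt_inner mult.assoc shift_gram)

lemma block_dims [simp]:
  assumes "S \<in> carrier_mat (p + m) (p + m)"
  shows "block_x p S \<in> carrier_mat p p" "block_xy p S \<in> carrier_mat p m" "block_y p S \<in> carrier_mat m m"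
  using assms by (auto simp: block_x_def block_xy_def block_y_def split_block_def Let_def)

lemma fm_blocks:
  assumes "S \<in> carrier_mat (p + m) (p + m)"
  shows "fm (block_x p S) = proj {..<p} * fm S * proj {..<p}"
    "fm (block_xy p S) = proj {..<p} * fm S * row_shift p m"
    "fm (block_y p S) = tp (row_shift p m) * fm S * row_shift p m"
proof -
  have d: "dim_row S = p + m" "dim_col S = p + m" using assms by auto
  show "fm (block_x p S) = proj {..<p} * fm S * proj {..<p}"
    by (rule fmat_eqI) (auto simp: block_x_def split_block_def Let_def ent_fm ent_mult_proj ent_proj_mult d)
  show "fm (block_xy p S) = proj {..<p} * fm S * row_shift p m"
    by (rule fmat_eqI) (auto simp: block_xy_def split_block_def Let_def ent_fm ent_mult_shift ent_proj_mult d add.commute)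
  show "fm (block_y p S) = tp (row_shift p m) * fm S * row_shift p m"
  proof (rule fmat_eqI)
    fix i j
    have "ent (tp (row_shift p m) * fm S) i l = (if i < m then ent (fm S) (i + p) l else 0)" for l
      using ent_mult_shift[of "tp (fm S)" p m l i] ent_tp[of "tp (row_shift p m) * fm S" l i] by (auto split: if_splits)
    then show "ent (fm (block_y p S)) i j = ent (tp (row_shift p m) * fm S * row_shift p m) i j"
      by (auto simp: block_y_def split_block_def Let_def ent_fm ent_mult_shift d add.commute)
  qed
qed

lemma fm_first_cols: "r \<le> dim_col U \<Longrightarrow> fm (first_cols r U) = fm U * proj {..<r}"
  by (rule fmat_eqI) (auto simp: first_cols_def ent_fm ent_mult_proj)

section \<open>The population covariance in joint coordinates\<close>

locale cca_model =
  fixes p m r :: nat and M q s_u s_v lam \<kappa> :: real and S U V :: "real mat" and l :: "nat \<Rightarrow> real"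
  assumes P: "(S, U, V, l) \<in> param_space q s_u s_v p m r lam \<kappa> M"
    and pm: "0 < p" "0 < m" "0 < r" "r \<le> min p m" and M: "1 < M"
begin

definition "fS = fm S"
definition "fU = fm U"
definition "fV = row_shift p m * fm V"
abbreviation "PX \<equiv> proj {..<p}"
abbreviation "PY \<equiv> proj {p..<p + m}"
abbreviation "E \<equiv> row_shift p m"
definition "d0 = min p m"

lemma S_carrier: "S \<in> carrier_mat (p + m) (p + m)" and S_sym: "S\<^sup>T = S"
  and S_psd: "\<And>v. v \<in> carrier_vec (p + m) \<Longrightarrow> 0 \<le> scalar_prod v (S *\<^sub>v v)"
  using P by (auto simp: param_space_def covariance_matrix_def)

lemma UV_carrier: "U \<in> carrier_mat p d0" "V \<in> carrier_mat m d0"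
  using P by (auto simp: param_space_def cca_decomposition_def Let_def d0_def)

lemma wc: "well_conditioned M (block_x p S)" "well_conditioned M (block_y p S)"
  using P by (auto simp: param_space_def)

lemma fS_sym: "tp fS = fS" unfolding fS_def using S_sym fm_transpose by metis

lemma fS_fix: "proj {..<p + m} * fS = fS" "fS * proj {..<p + m} = fS"
  unfolding fS_def by (intro fm_rows fm_cols; use S_carrier in auto)+

lemma psd: "0 \<le> inner (fS * X) X"
proof -
  have col: "0 \<le> inner (fS * x) x" if x: "x * proj {0} = x" for x
  proof -
    let ?z = "\<lambda>i. ent x i 0"
    let ?d = "p + m"
    have "inner (fS * x) x = inner (fS * (proj {..<?d} * x)) (proj {..<?d} * x)"
      using fS_fix inner_mult_left[of "proj {..<?d}" "fS * x" x]
      by (simp add: mult.assoc[symmetric])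
    also have "\<dots> = inner (fS * cv ?d ?z) (cv ?d ?z)" by (simp only: column_cv[OF x])
    also have "\<dots> = (\<Sum>i<?d. \<Sum>j<?d. ent fS i j * ?z i * ?z j)"
      by (rule quad_cv) (use S_carrier in \<open>auto simp: fS_def corner_def ent_fm\<close>)
    also have "\<dots> = scalar_prod (Matrix.vec ?d ?z) (S *\<^sub>v Matrix.vec ?d ?z)"
      using S_carrier by (auto simp: scalar_prod_def atLeast0LessThan fS_def ent_fm sum_distrib_left mult_ac intro!: sum.cong)
    also have "0 \<le> \<dots>" by (rule S_psd) simp
    finally show ?thesis .
  qed
  have "inner (fS * X) X = (\<Sum>j<fdim X. inner (fS * X * unitm j 0) (X * unitm j 0))"
    by (rule inner_columns) (rule corner_fdim)
  also have "0 \<le> \<dots>"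
  proof (rule sum_nonneg)
    fix j
    have "X * unitm j 0 * proj {0} = X * unitm j 0" by (auto simp: fix_proj_iff ent_mult_unitm)
    from col[OF this] show "0 \<le> inner (fS * X * unitm j 0) (X * unitm j 0)" by (simp add: mult.assoc)
  qed
  finally show ?thesis .
qed

text \<open>\<open>Q\<close> embeds the coordinates of one side. For the lower bound,
  \<open>w\<close> is built with the inverse block so that \<open>fS * w\<close> pairs with
  \<open>Y\<close> to its squared norm; Cauchy-Schwarz in the form of \<open>fS\<close> then bounds
  this by the form at \<open>Y\<close>, without eigenvalues.\<close>

lemma coercive_aux:
  assumes Q: "tp Q * Q = proj {..<k}" and B: "B \<in> carrier_mat k k" "fm B = tp Q * fS * Q" and wcB: "well_conditioned M B"
    and Y: "Q * (tp Q * Y) = Y"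
  shows "(norm Y)\<^sup>2 / M \<le> inner (fS * Y) Y" "inner (fS * Y) Y \<le> M * (norm Y)\<^sup>2"
proof -
  obtain T where T: "op_norm B \<le> M" "mat_inverse B = Some T" "op_norm T \<le> M"
    using wcB by (auto simp: well_conditioned_def)
  have TB: "B * T = 1\<^sub>m k" "T \<in> carrier_mat k k" using mat_inverse(2)[OF B(1) T(2)] by auto
  have oT: "opb (fm T) M" and oB: "opb (fm B) M" using opb_op_norm opb_mono T(1,3) by blast+
  have oQ: "opb Q 1" by (rule opb_orthonormal[OF _ Q]) simp
  have BT: "fm B * fm T = proj {..<k}"
  proof -
    have "fm B * fm T = fm (B * T)" by (rule fm_mult[symmetric]) (use B TB in auto)
    then show ?thesis by (simp add: TB fm_one)
  qed
  define y where "y = tp Q * Y"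
  have y: "Q * y = Y" using Y by (simp add: y_def)
  have fy: "proj {..<k} * y = y"
  proof -
    have "proj {..<k} * y = tp Q * (Q * y)" using Q by (simp add: mult.assoc[symmetric])
    then show ?thesis by (simp add: y) (simp add: y_def)
  qed
  have ny: "norm y = norm Y"
  proof -
    have "(norm Y)\<^sup>2 = inner y (tp Q * Y)" using inner_mult_left[of Q y Y] by (simp add: norm_power2_inner y)
    then have "(norm Y)\<^sup>2 = (norm y)\<^sup>2" by (simp add: norm_power2_inner y_def)
    then show ?thesis by simp
  qed
  have quad: "inner (fS * (Q * u)) (Q * v) = inner (fm B * u) v" for u v
    using inner_mult_left[of "tp Q" "fS * (Q * u)" v] by (simp add: B(2) mult.assoc)
  have "inner (fS * Y) Y = inner (fm B * y) y" using quad[of y y] y by simp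
  also have "\<dots> \<le> norm (fm B * y) * norm y" by (rule norm_cauchy_schwarz)
  also have "\<dots> \<le> M * norm y * norm y" by (intro mult_right_mono opbD oB norm_ge_zero)
  finally show "inner (fS * Y) Y \<le> M * (norm Y)\<^sup>2" by (simp add: ny power2_eq_square mult.assoc)
  define w where "w = Q * (fm T * y)"
  have a: "inner (fS * w) Y = (norm Y)\<^sup>2"
    using quad[of "fm T * y" y] by (simp add: w_def y mult.assoc[symmetric] BT fy norm_power2_inner[symmetric] ny)
  have c: "inner (fS * w) w \<le> M * (norm Y)\<^sup>2"
  proof -
    have "inner (fS * w) w = inner y (fm T * y)"
      using quad[of "fm T * y" "fm T * y"] by (simp add: w_def mult.assoc[symmetric] BT fy)
    also have "\<dots> \<le> norm y * norm (fm T * y)" by (rule norm_cauchy_schwarz)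
    also have "\<dots> \<le> norm y * (M * norm y)" by (intro mult_left_mono opbD oT norm_ge_zero)
    finally show ?thesis by (simp add: ny power2_eq_square mult_ac)
  qed
  have "((norm Y)\<^sup>2)\<^sup>2 \<le> inner (fS * w) w * inner (fS * Y) Y"
    using psd_cauchy[OF fS_sym psd, of w Y] by (simp add: a)
  also have "\<dots> \<le> M * (norm Y)\<^sup>2 * inner (fS * Y) Y" by (intro mult_right_mono c psd)
  finally have "(norm Y)\<^sup>2 * (norm Y)\<^sup>2 \<le> (norm Y)\<^sup>2 * (M * inner (fS * Y) Y)"
    by (simp add: power2_eq_square[of "(norm Y)\<^sup>2"] mult_ac)
  moreover have "0 \<le> M * inner (fS * Y) Y" using M psd by simp
  ultimately have "(norm Y)\<^sup>2 \<le> M * inner (fS * Y) Y"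
    by (rule square_cancel)
  then show "(norm Y)\<^sup>2 / M \<le> inner (fS * Y) Y" using M by (simp add: pos_divide_le_eq mult.commute)
qed

lemma coercive_x:
  assumes "PX * Y = Y" shows "(norm Y)\<^sup>2 / M \<le> inner (fS * Y) Y" "inner (fS * Y) Y \<le> M * (norm Y)\<^sup>2"
  using coercive_aux[of PX p "block_x p S" Y] assms S_carrier fm_blocks(1)[OF S_carrier] wc
  by (simp_all add: fS_def)

lemma coercive_y:
  assumes "PY * Y = Y" shows "(norm Y)\<^sup>2 / M \<le> inner (fS * Y) Y" "inner (fS * Y) Y \<le> M * (norm Y)\<^sup>2"
  using coercive_aux[of E m "block_y p S" Y] assms S_carrier fm_blocks(3)[OF S_carrier] wc
  by (simp_all add: fS_def shift_gram mult.assoc[symmetric] shift_proj)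

lemma PXY: "proj {..<p + m} = PX + PY"
  by (rule fmat_eqI) auto

lemma norm_split: "(norm (PX * X))\<^sup>2 + (norm (PY * X))\<^sup>2 \<le> (norm X)\<^sup>2"
proof -
  have "(norm (PX * X))\<^sup>2 + (norm (PY * X))\<^sup>2 = inner (PX * X + PY * X) X"
    by (simp add: norm_power2_inner inner_mult_left inner_add_left inner_add_right inner_commute)
  also have "\<dots> = inner (proj {..<p + m} * X) X" by (simp add: PXY distrib_right)
  also have "\<dots> \<le> norm (proj {..<p + m} * X) * norm X" by (rule norm_cauchy_schwarz)
  also have "\<dots> \<le> norm X * norm X" by (intro mult_right_mono norm_proj_le) auto
  finally show ?thesis by (simp add: power2_eq_square)
qed

lemma quad_split:
  fixes X defines "u \<equiv> PX * X" and "v \<equiv> PY * X"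
  shows "inner (fS * X) X = inner (fS * u) u + inner (fS * v) v + 2 * inner (fS * v) u"
proof -
  have uv: "u + v = proj {..<p + m} * X" by (simp add: u_def v_def PXY distrib_right)
  have "inner (fS * X) X = inner (fS * (u + v)) (u + v)"
    unfolding uv using fS_fix inner_mult_left[of "proj {..<p + m}" "fS * X" X]
    by (simp add: mult.assoc[symmetric])
  moreover have "inner (fS * u) v = inner (fS * v) u"
    using inner_mult_left[of fS u v] fS_sym by (simp add: inner_commute)
  ultimately show ?thesis by (simp add: distrib_left inner_add_left inner_add_right)
qed

text \<open>Positivity at \<open>?u - ?v\<close> bounds the cross term by the diagonal ones, whence
  the factor 2 over the block bounds.\<close>

lemma quad_upper: "inner (fS * X) X \<le> 2 * M * (norm X)\<^sup>2"
proof -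
  let ?u = "PX * X" and ?v = "PY * X"
  have s: "inner (fS * ?u) ?v = inner (fS * ?v) ?u"
    using inner_mult_left[of fS ?u ?v] fS_sym by (simp add: inner_commute)
  have "0 \<le> inner (fS * (?u - ?v)) (?u - ?v)" by (rule psd)
  then have "2 * inner (fS * ?v) ?u \<le> inner (fS * ?u) ?u + inner (fS * ?v) ?v"
    using s by (simp add: right_diff_distrib inner_diff_left inner_diff_right)
  then have "inner (fS * X) X \<le> 2 * (inner (fS * ?u) ?u + inner (fS * ?v) ?v)"
    using quad_split[of X] by simp
  also have "\<dots> \<le> 2 * (M * (norm ?u)\<^sup>2 + M * (norm ?v)\<^sup>2)"
    by (intro mult_left_mono add_mono coercive_x(2) coercive_y(2)) auto
  also have "\<dots> = 2 * M * ((norm ?u)\<^sup>2 + (norm ?v)\<^sup>2)" by (simp add: distrib_left)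
  also have "\<dots> \<le> 2 * M * (norm X)\<^sup>2" using M by (intro mult_left_mono norm_split) auto
  finally show ?thesis .
qed

text \<open>Cauchy-Schwarz for the form of \<open>fS\<close>, taken between \<open>X\<close> and
  \<open>fS * X\<close>, turns the bound on the form into one on the operator.\<close>

lemma oS: "opb fS (2 * M)"
proof -
  have "norm (fS * X) \<le> 2 * M * norm X" for X
  proof -
    let ?Y = "fS * X"
    have "((norm ?Y)\<^sup>2)\<^sup>2 \<le> inner (fS * X) X * inner (fS * ?Y) ?Y"
      using psd_cauchy[OF fS_sym psd, of X ?Y] by (simp add: norm_power2_inner)
    also have "\<dots> \<le> (2 * M * (norm X)\<^sup>2) * (2 * M * (norm ?Y)\<^sup>2)"
      using M by (intro mult_mono quad_upper psd) auto
    finally have "(norm ?Y)\<^sup>2 * (norm ?Y)\<^sup>2 \<le> (norm ?Y)\<^sup>2 * (2 * M * norm X)\<^sup>2"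
      by (simp add: power2_eq_square[of "(norm ?Y)\<^sup>2"] power_mult_distrib power2_eq_square[of M] mult_ac)
    then have "(norm ?Y)\<^sup>2 \<le> (2 * M * norm X)\<^sup>2" by (rule square_cancel) simp
    then show ?thesis by (rule power2_le_imp_le) (use M in simp)
  qed
  then show ?thesis using M by (simp add: opb_def)
qed

lemma fU: "PX * fU = fU" "fU * proj {..<d0} = fU" "tp fU * (fS * fU) = proj {..<d0}"
proof -
  have c: "U \<in> carrier_mat p d0" by (rule UV_carrier)
  show 1: "PX * fU = fU" "fU * proj {..<d0} = fU" unfolding fU_def using c by (auto intro!: fm_rows fm_cols)
  have "U\<^sup>T * block_x p S * U = 1\<^sub>m d0"
    using P by (auto simp: param_space_def cca_decomposition_def Let_def d0_def)
  then have "fm (U\<^sup>T * block_x p S * U) = proj {..<d0}" by (simp add: fm_one)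
  then have "tp fU * (PX * fS * PX) * fU = proj {..<d0}"
    using c S_carrier block_dims[OF S_carrier]
    by (simp add: fm_mult fm_blocks(1)[OF S_carrier] fU_def fS_def mult.assoc)
  moreover have "tp fU * PX = tp fU" using arg_cong[OF 1(1), of tp] by simp
  ultimately show "tp fU * (fS * fU) = proj {..<d0}" using 1(1) by (simp add: mult.assoc[symmetric]) (simp add: mult.assoc)
qed

lemma fV: "PY * fV = fV" "fV * proj {..<d0} = fV" "tp fV * (fS * fV) = proj {..<d0}"
proof -
  have c: "V \<in> carrier_mat m d0" by (rule UV_carrier)
  show "PY * fV = fV" unfolding fV_def by (simp add: mult.assoc[symmetric] proj_shift)
  have "fm V * proj {..<d0} = fm V" by (rule fm_cols) (use c in auto)
  then show "fV * proj {..<d0} = fV" by (simp add: fV_def mult.assoc)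
  have "V\<^sup>T * block_y p S * V = 1\<^sub>m d0"
    using P by (auto simp: param_space_def cca_decomposition_def Let_def d0_def)
  then have "fm (V\<^sup>T * block_y p S * V) = proj {..<d0}" by (simp add: fm_one)
  then show "tp fV * (fS * fV) = proj {..<d0}"
    using c S_carrier block_dims[OF S_carrier]
    by (simp add: fm_mult fm_blocks(3)[OF S_carrier] fV_def fS_def mult.assoc)
qed

lemma fSxy: "PX * fS * PY = PX * (fS * (fU * diagm d0 l * tp fV) * fS) * PY"
proof -
  have c: "U \<in> carrier_mat p d0" "V \<in> carrier_mat m d0" by (rule UV_carrier)+
  have "block_xy p S = block_x p S * (U * mat_diag d0 l * V\<^sup>T) * block_y p S"
    using P by (auto simp: param_space_def cca_decomposition_def Let_def d0_def)
  then have "fm (block_xy p S) = fm (block_x p S * (U * mat_diag d0 l * V\<^sup>T) * block_y p S)" by simp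
  also have "\<dots> = fm (block_x p S) * (fm U * diagm d0 l * tp (fm V)) * fm (block_y p S)"
  proof -
    have "fm (U * mat_diag d0 l * V\<^sup>T) = fm (U * mat_diag d0 l) * fm (V\<^sup>T)"
      by (rule fm_mult) (use c in \<open>simp add: mat_diag_def\<close>)
    also have "fm (U * mat_diag d0 l) = fm U * fm (mat_diag d0 l)"
      by (rule fm_mult) (use c in \<open>simp add: mat_diag_def\<close>)
    finally have "fm (U * mat_diag d0 l * V\<^sup>T) = fm U * diagm d0 l * tp (fm V)" by (simp add: fm_diag)
    then show ?thesis using c block_dims[OF S_carrier] by (simp add: fm_mult)
  qed
  finally have "PX * fS * E = PX * fS * PX * (fm U * diagm d0 l * tp (fm V)) * (tp E * fS * E)"
    by (simp add: fm_blocks[OF S_carrier] fS_def mult.assoc)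
  then have "PX * fS * E * tp E = PX * fS * PX * (fm U * diagm d0 l * tp (fm V)) * (tp E * fS * E) * tp E" by simp
  then have "PX * fS * (E * tp E) = PX * fS * (PX * fU) * diagm d0 l * tp fV * fS * (E * tp E)"
    by (simp add: fV_def fU_def mult.assoc)
  then show ?thesis unfolding fU(1) shift_proj by (simp add: mult.assoc)
qed

lemma l_props: "\<And>i. i < d0 \<Longrightarrow> 0 \<le> l i \<and> l i < 1" "\<And>i j. i \<le> j \<Longrightarrow> j < d0 \<Longrightarrow> l j \<le> l i"
  "\<And>i. i < r \<Longrightarrow> lam \<le> l i \<and> l i \<le> \<kappa> * lam" "\<kappa> * lam < 1" "0 < lam"
  using P by (auto simp: param_space_def cca_decomposition_def Let_def d0_def)

lemma weak: "weak_norm q (first_cols r U) \<le> s_u" "weak_norm q (first_cols r V) \<le> s_v"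
  using P by (auto simp: param_space_def)

text \<open>Bessel's inequality for the semi-inner product of \<open>fS\<close>, in which the
  columns of \<open>Q\<close> are orthonormal.\<close>

lemma bessel:
  assumes "tp Q * (fS * Q) = proj {..<k}"
  shows "(norm (tp Q * (fS * X)))\<^sup>2 \<le> inner (fS * X) X"
proof -
  let ?w = "tp Q * (fS * X)"
  have "(norm ?w)\<^sup>2 = inner (fS * X) (Q * ?w)"
    using inner_mult_left[of "tp Q" "fS * X" ?w] by (simp add: norm_power2_inner)
  then have "((norm ?w)\<^sup>2)\<^sup>2 \<le> inner (fS * X) X * inner (fS * (Q * ?w)) (Q * ?w)"
    using psd_cauchy[OF fS_sym psd, of X "Q * ?w"] by simp
  also have "inner (fS * (Q * ?w)) (Q * ?w) = inner (proj {..<k} * ?w) ?w"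
    using inner_mult_left[of "tp Q" "fS * (Q * ?w)" ?w] assms[symmetric] by (simp add: mult.assoc)
  also have "inner (fS * X) X * inner (proj {..<k} * ?w) ?w \<le> inner (fS * X) X * (norm ?w)\<^sup>2"
  proof (rule mult_left_mono[OF _ psd])
    have "inner (proj {..<k} * ?w) ?w \<le> norm (proj {..<k} * ?w) * norm ?w" by (rule norm_cauchy_schwarz)
    also have "\<dots> \<le> norm ?w * norm ?w" by (intro mult_right_mono norm_proj_le) auto
    finally show "inner (proj {..<k} * ?w) ?w \<le> (norm ?w)\<^sup>2" by (simp add: power2_eq_square)
  qed
  finally have "(norm ?w)\<^sup>2 * (norm ?w)\<^sup>2 \<le> (norm ?w)\<^sup>2 * inner (fS * X) X"
    by (simp only: power2_eq_square[of "(norm ?w)\<^sup>2"] mult.commute)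
  then show ?thesis by (rule square_cancel) (rule psd)
qed

text \<open>By Bessel on both sides the cross term is at most \<open>l 0\<close> times the geometric
  mean of the block forms. Only strictness matters: it makes the Gaussian density meaningful, and
  the margin \<open>1 - l 0\<close> enters no constant.\<close>

lemma positive_definite:
  assumes "proj {..<p + m} * x = x" "x \<noteq> 0"
  shows "0 < inner (fS * x) x"
proof -
  let ?u = "PX * x" and ?v = "PY * x"
  define \<alpha> where "\<alpha> = inner (fS * ?u) ?u"
  define \<beta> where "\<beta> = inner (fS * ?v) ?v"
  have ab: "0 \<le> \<alpha>" "0 \<le> \<beta>" by (simp_all add: \<alpha>_def \<beta>_def psd)
  have d0: "0 < d0" using pm by (simp add: d0_def)
  have l0: "0 \<le> l 0" "l 0 < 1" using l_props(1)[OF d0] by auto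
  have oL: "opb (diagm d0 l) (l 0)"
  proof (rule opb_diagm)
    fix i assume "i < d0"
    then show "\<bar>l i\<bar> \<le> l 0" using l_props(1)[of i] l_props(2)[of 0 i] by simp
  qed (use l0 in simp)
  have "inner (fS * ?v) ?u = inner (PX * fS * PY * x) x"
    using inner_mult_left[of PX "fS * ?v" x] by (simp add: mult.assoc)
  also have "\<dots> = inner (fS * fU * diagm d0 l * tp fV * fS * ?v) ?u"
    unfolding fSxy using inner_mult_left[of PX "fS * fU * diagm d0 l * tp fV * fS * ?v" x] by (simp add: mult.assoc)
  also have "\<dots> = inner (diagm d0 l * (tp fV * (fS * ?v))) (tp fU * (fS * ?u))"
    using inner_mult_left[of "fS * fU" "diagm d0 l * (tp fV * (fS * ?v))" ?u] fS_sym by (simp add: mult.assoc)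
  finally have "\<bar>inner (fS * ?v) ?u\<bar> \<le> norm (diagm d0 l * (tp fV * (fS * ?v))) * norm (tp fU * (fS * ?u))"
    using Cauchy_Schwarz_ineq2 by simp
  also have "\<dots> \<le> (l 0 * sqrt \<beta>) * sqrt \<alpha>"
  proof (intro mult_mono)
    show "norm (diagm d0 l * (tp fV * (fS * ?v))) \<le> l 0 * sqrt \<beta>"
      using bessel[OF fV(3), of ?v] l0
      by (intro order_trans[OF opbD[OF oL]] mult_left_mono) (auto simp: \<beta>_def intro: real_le_rsqrt)
    show "norm (tp fU * (fS * ?u)) \<le> sqrt \<alpha>"
      using bessel[OF fU(3), of ?u] by (auto simp: \<alpha>_def intro: real_le_rsqrt)
  qed (use ab l0 in auto)
  also have "\<dots> \<le> l 0 * ((\<alpha> + \<beta>) / 2)"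
  proof -
    have "sqrt \<beta> * sqrt \<alpha> \<le> (\<alpha> + \<beta>) / 2"
      using ab arith_geo_mean_sqrt[of \<alpha> \<beta>] by (simp add: real_sqrt_mult mult.commute)
    then show ?thesis using l0 by (simp add: mult.assoc mult_left_mono)
  qed
  finally have "\<bar>inner (fS * ?v) ?u\<bar> \<le> l 0 * ((\<alpha> + \<beta>) / 2)" .
  then have "(1 - l 0) * (\<alpha> + \<beta>) \<le> inner (fS * x) x"
    unfolding quad_split[of x] \<alpha>_def[symmetric] \<beta>_def[symmetric] by (simp add: algebra_simps abs_le_iff)
  moreover have "0 < \<alpha> + \<beta>"
  proof -
    have "x = ?u + ?v" using assms(1) by (simp add: PXY distrib_right)
    then have "?u \<noteq> 0 \<or> ?v \<noteq> 0" using assms(2) by auto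
    then have "0 < (norm ?u)\<^sup>2 / M + (norm ?v)\<^sup>2 / M"
      using M by (auto intro: add_pos_nonneg add_nonneg_pos)
    also have "\<dots> \<le> \<alpha> + \<beta>" unfolding \<alpha>_def \<beta>_def by (intro add_mono coercive_x(1) coercive_y(1)) auto
    finally show ?thesis .
  qed
  ultimately show ?thesis using l0 by (smt (verit) mult_pos_pos)
qed

lemma gaussian: "gaussian (p + m) S (2 * M)"
proof
  show "opb (fm S) (2 * M)" using oS by (simp add: fS_def)
  show "0 < inner (fm S * x) x" if "proj {..<p + m} * x = x" "x \<noteq> 0" for x
    using positive_definite[OF that] by (simp add: fS_def)
qed (use S_carrier S_sym M in auto)

end

section \<open>The estimator on a typical sample\<close>

lemma fm_of_ent:
  assumes "proj {..<a} * X = X" "X * proj {..<b} = X"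
  shows "fm (Matrix.mat a b (\<lambda>(i, j). ent X i j)) = X"
  using assms by (intro fmat_eqI) (auto simp: ent_fm proj_fix_iff fix_proj_iff)

lemma mat_trace_fm: "mat_trace X = inner (proj {..<dim_row X}) (fm X)" if "dim_row X = dim_col X"
  unfolding inner_proj mat_trace_def using that by (simp add: ent_fm)

lemma trace_block_xy:
  assumes S: "S \<in> carrier_mat (p + m) (p + m)" and A: "A \<in> carrier_mat p r" and B: "B \<in> carrier_mat m r"
  shows "mat_trace (A\<^sup>T * block_xy p S * B) = inner (fm S) (fm A * tp (row_shift p m * fm B))"
proof -
  note bd = block_dims[OF S]
  have "mat_trace (A\<^sup>T * block_xy p S * B) = inner (proj {..<r}) (fm (A\<^sup>T * block_xy p S * B))"
    using A B by (subst mat_trace_fm) auto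
  also have "fm (A\<^sup>T * block_xy p S * B) = tp (fm A) * (proj {..<p} * fm S * row_shift p m) * fm B"
    using A B bd by (simp add: fm_mult fm_blocks(2)[OF S] mult.assoc)
  also have "\<dots> = tp (proj {..<p} * fm A) * fm S * (row_shift p m * fm B)" by (simp add: mult.assoc)
  also have "proj {..<p} * fm A = fm A" by (rule fm_rows) (use A in auto)
  also have "inner (proj {..<r}) (tp (fm A) * fm S * (row_shift p m * fm B)) = inner (fm A * proj {..<r}) (fm S * (row_shift p m * fm B))"
    using inner_mult_left[of "fm A" "proj {..<r}" "fm S * (row_shift p m * fm B)"] by (simp add: mult.assoc)
  also have "fm A * proj {..<r} = fm A" by (rule fm_cols) (use A in auto)
  also have "inner (fm A) (fm S * (row_shift p m * fm B)) = inner (fm S) (fm A * tp (row_shift p m * fm B))"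
    using inner_mult_right[of "fm S" "row_shift p m * fm B" "fm A"] by (simp add: inner_commute)
  finally show ?thesis .
qed

definition data_matrix :: "nat \<Rightarrow> nat \<Rightarrow> (nat \<Rightarrow> nat \<Rightarrow> real) \<Rightarrow> fmat" where
  "data_matrix n d Z = mk (max n d) (\<lambda>i a. if i < n \<and> a < d then Z i a / sqrt (real n) else 0)"

lemma sample_cov_gram: "fm (sample_cov n d Z) = tp (data_matrix n d Z) * data_matrix n d Z"
proof (rule fmat_eqI)
  fix a c
  let ?D = "data_matrix n d Z"
  have e: "ent ?D i a = (if i < n \<and> a < d then Z i a / sqrt (real n) else 0)" for i a
    by (auto simp: data_matrix_def ent_mk)
  have "ent (tp ?D * ?D) a c = (\<Sum>i<max n d. ent (tp ?D) a i * ent ?D i c)"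
    by (rule ent_mult_corner) (simp add: data_matrix_def corner_mk)
  also have "\<dots> = (\<Sum>i<n. ent (tp ?D) a i * ent ?D i c)"
    by (rule sum.mono_neutral_right) (auto simp: e)
  also have "\<dots> = ent (fm (sample_cov n d Z)) a c"
    by (auto simp: e ent_fm sample_cov_def sum_divide_distrib intro!: sum.cong)
  finally show "ent (fm (sample_cov n d Z)) a c = ent (tp ?D * ?D) a c" by simp
qed

text \<open>If \<open>G\<close> annihilated a nonzero row \<open>u\<close> of \<open>U0\<close>,
  then \<open>u = u * (J - G)\<close> would be strictly shorter than itself.\<close>

lemma nonzero_rows_preserved:
  assumes U0: "U0 * J = U0" and near: "norm (J - G) < 1" and i: "ent U0 i j \<noteq> 0"
  shows "\<exists>j. ent (U0 * G) i j \<noteq> 0"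
proof (rule ccontr)
  assume "\<not> ?thesis"
  then have z: "unitm 0 i * (U0 * G) = 0" by (intro fmat_eqI) (auto simp: ent_unitm_mult)
  let ?u = "unitm 0 i * U0"
  have "?u = ?u * (J - G)" using z U0 by (simp add: right_diff_distrib mult.assoc)
  then have "norm ?u \<le> norm ?u * norm (J - G)" by (metis norm_mult_ineq)
  moreover have "?u \<noteq> 0"
  proof
    assume "?u = 0"
    then have "ent ?u 0 j = 0" by simp
    with i show False by (simp add: ent_unitm_mult)
  qed
  then have "norm ?u * norm (J - G) < norm ?u * 1" using near by (intro mult_strict_left_mono) auto
  ultimately show False by simp
qed

lemma weak_norm_0_fm:
  assumes "0 < dim_row A" "weak_norm 0 A = real k"
  defines "I \<equiv> {i. i < dim_row A \<and> row_norm A i \<noteq> 0}"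
  shows "card I = k" "I \<subseteq> {..<dim_row A}" "proj I * fm A = fm A"
proof -
  show "card I = k" using weak_norm_0[OF assms(1)] assms(2) by (simp add: I_def)
  show "I \<subseteq> {..<dim_row A}" by (auto simp: I_def)
  have "finite I" by (simp add: I_def)
  then show "proj I * fm A = fm A" by (auto simp: proj_fix_iff ent_fm I_def row_norm_0_iff)
qed

lemma shift_image_fix:
  assumes "finite J" "J \<subseteq> {..<m}" "proj J * X = X"
  shows "proj ((\<lambda>j. j + p) ` J) * (row_shift p m * X) = row_shift p m * X"
  using assms by (auto simp: proj_fix_iff ent_shift_mult) (metis image_eqI le_add_diff_inverse2)

lemma proj_mult_fix: "finite S \<Longrightarrow> proj S * X = X \<Longrightarrow> proj S * (X * Y) = X * Y"
  by (simp add: mult.assoc[symmetric])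

lemma weak_norm_0_of_ent:
  assumes p: "0 < p" and I: "I \<subseteq> {..<p}" "card I = k" "proj I * X = X" "X * proj {..<r} = X"
    and nz: "\<And>i. i \<in> I \<Longrightarrow> \<exists>j. ent X i j \<noteq> 0"
  shows "weak_norm 0 (Matrix.mat p r (\<lambda>(i, j). ent X i j)) = real k"
proof -
  let ?A = "Matrix.mat p r (\<lambda>(i, j). ent X i j)"
  have fI: "finite I" using I(1) finite_subset by blast
  have "{i. i < dim_row ?A \<and> row_norm ?A i \<noteq> 0} = I"
  proof (rule subset_antisym; rule subsetI)
    fix i assume "i \<in> {i. i < dim_row ?A \<and> row_norm ?A i \<noteq> 0}"
    then have "i < dim_row ?A" "\<exists>j<dim_col ?A. ?A $$ (i, j) \<noteq> 0" using row_norm_0_iff[of i ?A] by auto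
    then show "i \<in> I" using I(3) fI by (auto simp: proj_fix_iff)
  next
    fix i assume i: "i \<in> I"
    then obtain j where j: "ent X i j \<noteq> 0" using nz by blast
    then have "j < r" using I(4) by (auto simp: fix_proj_iff)
    moreover have "i < p" using i I(1) by auto
    ultimately have "\<exists>j<dim_col ?A. ?A $$ (i, j) \<noteq> 0" using j by (intro exI[of _ j]) simp
    then show "i \<in> {i. i < dim_row ?A \<and> row_norm ?A i \<noteq> 0}" using row_norm_0_iff[of i ?A] i I(1) by auto
  qed
  then show ?thesis using weak_norm_0[of ?A] p I(2) by simp
qed

section \<open>Splitting at rank \<open>r\<close> and the error on one sample\<close>

context cca_model
begin

abbreviation "J \<equiv> proj {..<r}"

lemma r_d0: "r \<le> d0" using pm by (simp add: d0_def)

lemma proj_r_d0: "proj {..<d0} * J = J" "J * proj {..<d0} = J" "J * proj {r..<d0} = 0" "proj {r..<d0} * J = 0"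
  "proj {..<d0} * proj {r..<d0} = proj {r..<d0}"
proof -
  have e: "{..<d0} \<inter> {..<r} = {..<r}" "{..<r} \<inter> {..<d0} = {..<r}" "{..<r} \<inter> {r..<d0} = {}" "{r..<d0} \<inter> {..<r} = {}"
    "{..<d0} \<inter> {r..<d0} = {r..<d0}"
    using r_d0 by auto
  have "proj {} = 0" by (rule fmat_eqI) simp
  then show "proj {..<d0} * J = J" "J * proj {..<d0} = J" "J * proj {r..<d0} = 0" "proj {r..<d0} * J = 0"
    "proj {..<d0} * proj {r..<d0} = proj {r..<d0}"
    by (simp_all only: proj_mult_proj finite_lessThan finite_atLeastLessThan e)
qed

lemma split_gram:
  assumes "tp Q * (fS * Q) = proj {..<d0}"
  shows "tp (Q * J) * (fS * (Q * J)) = J" "tp (Q * proj {r..<d0}) * (fS * (Q * proj {r..<d0})) = proj {r..<d0}"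
    "tp (Q * proj {r..<d0}) * (fS * (Q * J)) = 0"
proof -
  have e: "tp (Q * X) * (fS * (Q * Y)) = tp X * (proj {..<d0} * Y)" for X Y
    by (simp add: assms[symmetric] mult.assoc)
  show "tp (Q * J) * (fS * (Q * J)) = J" "tp (Q * proj {r..<d0}) * (fS * (Q * proj {r..<d0})) = proj {r..<d0}"
    "tp (Q * proj {r..<d0}) * (fS * (Q * J)) = 0"
    unfolding e by (simp_all add: proj_r_d0)
qed

definition "L2 = diagm d0 (\<lambda>i. if r \<le> i then l i else 0)"

lemma split_L: "fU * diagm d0 l * tp fV = (fU * J) * diagm r l * tp (fV * J) + (fU * proj {r..<d0}) * L2 * tp (fV * proj {r..<d0})"
proof -
  have "diagm d0 l = J * diagm r l * J + proj {r..<d0} * L2 * proj {r..<d0}"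
    using r_d0 by (intro fmat_eqI) (auto simp: L2_def ent_mult_proj ent_proj_mult)
  then have "fU * diagm d0 l * tp fV = fU * (J * diagm r l * J + proj {r..<d0} * L2 * proj {r..<d0}) * tp fV" by simp
  then show ?thesis by (simp add: distrib_left distrib_right mult.assoc)
qed

lemma oL2:
  assumes "next_corr p m r l \<le> c * lam" "0 \<le> c"
  shows "opb L2 (c * lam)"
  unfolding L2_def
proof (rule opb_diagm)
  fix i assume i: "i < d0"
  have "l i \<le> c * lam" if "r \<le> i"
    using l_props(2)[OF that i] assms(1) i that by (simp add: next_corr_def d0_def split: if_splits)
  then show "\<bar>if r \<le> i then l i else 0\<bar> \<le> c * lam"
    using l_props(1)[OF i] l_props(5) assms(2) by auto
qed (use l_props(5) assms(2) in simp)

text \<open>Carries the deterministic bound over to matrices of the original sizes. The support of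
  the estimator is known only after sampling, hence \<open>good\<close> ranges over all supports of
  the prescribed sizes.\<close>

lemma estimation:
  assumes n: "0 < n"
    and sol: "cca_solution p m r ku kv (sample_cov n (p + m) Z) A B"
    and Iu: "Iu \<subseteq> {..<p}" "card Iu = ku" "proj Iu * U0 = U0" "U0 * J = U0" "\<And>i. i \<in> Iu \<Longrightarrow> \<exists>j. ent U0 i j \<noteq> 0"
      "norm (U0 - fm (first_cols r U)) \<le> \<tau>"
    and Iv: "Iv \<subseteq> {..<m}" "card Iv = kv" "proj Iv * V0 = V0" "V0 * J = V0" "\<And>i. i \<in> Iv \<Longrightarrow> \<exists>j. ent V0 i j \<noteq> 0"
      "norm (V0 - fm (first_cols r V)) \<le> \<tau>"
    and good: "\<And>I2 J2. I2 \<subseteq> {..<p} \<Longrightarrow> card I2 = ku \<Longrightarrow> J2 \<subseteq> {..<m} \<Longrightarrow> card J2 = kv \<Longrightarrow>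
      sparse_small (Iu \<union> I2 \<union> (\<lambda>j. j + p) ` (Iv \<union> J2)) (2 * r) \<delta> (fm (sample_cov n (p + m) Z) - fm S)"
    and \<delta>: "0 \<le> \<delta>" "\<delta> \<le> lam * \<tau>" and \<tau>: "\<tau> \<le> 1 / (28 * (2 * M)\<^sup>2)" and \<kappa>: "1 \<le> \<kappa>"
    and c: "0 \<le> c" "c \<le> 1 / (128 * (2 * M) ^ 8)" and nc: "next_corr p m r l \<le> c * lam"
  shows "norm (fm A * tp (fm B) - fm (first_cols r U) * tp (fm (first_cols r V))) \<le> 6000 * \<kappa> * (2 * M) ^ 8 * \<tau>"
proof -
  let ?S = "sample_cov n (p + m) Z"
  let ?H = "fm ?S"
  let ?D = "data_matrix n (p + m) Z"
  have cS: "?S \<in> carrier_mat (p + m) (p + m)" by (simp add: sample_cov_def)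
  have feas: "cca_feasible p m r ku kv ?S A B"
    and opt: "\<And>A' B'. cca_feasible p m r ku kv ?S A' B' \<Longrightarrow> mat_trace (A'\<^sup>T * block_xy p ?S * B') \<le> mat_trace (A\<^sup>T * block_xy p ?S * B)"
    using sol by (auto simp: cca_solution_def)
  have A: "A \<in> carrier_mat p r" and B: "B \<in> carrier_mat m r" and AA: "A\<^sup>T * block_x p ?S * A = 1\<^sub>m r" and BB: "B\<^sup>T * block_y p ?S * B = 1\<^sub>m r"
    and wA: "weak_norm 0 A = real ku" and wB: "weak_norm 0 B = real kv"
    using feas by (auto simp: cca_feasible_def)
  define IA where "IA = {i. i < dim_row A \<and> row_norm A i \<noteq> 0}"
  define IB where "IB = {i. i < dim_row B \<and> row_norm B i \<noteq> 0}"
  have IA: "card IA = ku" "IA \<subseteq> {..<p}" "proj IA * fm A = fm A"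
    using weak_norm_0_fm[of A ku] A pm wA by (auto simp: IA_def)
  have IB: "card IB = kv" "IB \<subseteq> {..<m}" "proj IB * fm B = fm B"
    using weak_norm_0_fm[of B kv] B pm wB by (auto simp: IB_def)
  have fin: "finite Iu" "finite Iv" "finite IA" "finite IB"
    using Iu(1) Iv(1) IA(2) IB(2) finite_subset by blast+
  define T where "T = Iu \<union> IA \<union> (\<lambda>j. j + p) ` (Iv \<union> IB)"
  have finT: "finite T" using fin by (simp add: T_def)
  have gT: "sparse_small T (2 * r) \<delta> (?H - fS)"
    unfolding T_def fS_def by (rule good[OF IA(2,1) IB(2,1)])
  define fA where "fA = fm A"
  define fB where "fB = E * fm B"
  have gram_x: "tp (fm C) * (?H * fm C) = fm (C\<^sup>T * block_x p ?S * C)" if "C \<in> carrier_mat p r" for C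
  proof -
    have PC: "PX * fm C = fm C" by (rule fm_rows) (use that in auto)
    have "fm (C\<^sup>T * block_x p ?S * C) = tp (PX * fm C) * ?H * (PX * fm C)"
      using that block_dims[OF cS] by (simp add: fm_mult fm_blocks(1)[OF cS] mult.assoc)
    then show ?thesis unfolding PC by (simp add: mult.assoc)
  qed
  have gram_y: "tp (E * fm C) * (?H * (E * fm C)) = fm (C\<^sup>T * block_y p ?S * C)" if "C \<in> carrier_mat m r" for C
    using that block_dims[OF cS] by (simp add: fm_mult fm_blocks(3)[OF cS] mult.assoc)
  have fA: "PX * fA = fA" "proj T * fA = fA" "fA * J = fA" "tp fA * (?H * fA) = J"
  proof -
    show "PX * fA = fA" unfolding fA_def by (rule fm_rows) (use A in auto)
    show "proj T * fA = fA" unfolding fA_def by (rule proj_subset_fix[OF finT _ IA(3)]) (auto simp: T_def)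
    show "fA * J = fA" unfolding fA_def by (rule fm_cols) (use A in auto)
    show "tp fA * (?H * fA) = J" unfolding fA_def gram_x[OF A] AA fm_one ..
  qed
  have fB: "PY * fB = fB" "proj T * fB = fB" "fB * J = fB" "tp fB * (?H * fB) = J"
  proof -
    show "PY * fB = fB" unfolding fB_def by (simp add: mult.assoc[symmetric] proj_shift)
    show "proj T * fB = fB" unfolding fB_def
      by (rule proj_subset_fix[OF finT _ shift_image_fix[OF fin(4) IB(2,3)]]) (auto simp: T_def)
    have "fm B * J = fm B" by (rule fm_cols) (use B in auto)
    then show "fB * J = fB" by (simp add: fB_def mult.assoc)
    show "tp fB * (?H * fB) = J" unfolding fB_def gram_y[OF B] BB fm_one ..
  qed
  let ?V0 = "E * V0"
  have b2: "2 \<le> 2 * M" using M by simp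
  have lam1: "lam \<le> 1"
  proof -
    have "1 * lam \<le> \<kappa> * lam" using \<kappa> l_props(5) by (intro mult_right_mono) auto
    then show ?thesis using l_props(4) by simp
  qed
  have \<tau>0: "0 \<le> \<tau>" using Iu(6) norm_ge_zero order_trans by blast
  have d\<tau>: "\<delta> \<le> \<tau>" using \<delta>(2) mult_right_mono[OF lam1 \<tau>0] by simp
  have sp: "sparse_perturbation fS ?H ?D T r (2 * M) \<delta> \<tau>"
    by (rule sparse_perturbation.intro) (rule finT pm(3) fS_sym sample_cov_gram oS b2 gT \<delta>(1) d\<tau> \<tau>)+
  have half: "(norm Y)\<^sup>2 / (2 * M) \<le> (norm Y)\<^sup>2 / M" for Y :: fmat
    using M by (intro divide_left_mono) auto
  have U1: "fm (first_cols r U) = fU * J" using UV_carrier(1) r_d0 by (simp add: fm_first_cols fU_def)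
  have V1: "fm (first_cols r V) = fm V * J" using UV_carrier(2) r_d0 by (simp add: fm_first_cols)
  have side_u: "cca_side fS ?H ?D T r (2 * M) \<delta> \<tau> {..<p} (fU * J) (fU * proj {r..<d0}) U0 {r..<d0}"
  proof (rule cca_side.intro[OF sp], rule cca_side_axioms.intro)
    show "(norm Y)\<^sup>2 / (2 * M) \<le> inner (fS * Y) Y" if "PX * Y = Y" for Y
      using half[of Y] coercive_x(1)[OF that] by linarith
    show "PX * (fU * J) = fU * J" "PX * (fU * proj {r..<d0}) = fU * proj {r..<d0}"
      by (rule proj_mult_fix[OF _ fU(1)], simp)+
    show "fU * J * J = fU * J" by (simp add: mult.assoc)
    show "tp (fU * J) * (fS * (fU * J)) = J" "tp (fU * proj {r..<d0}) * (fS * (fU * proj {r..<d0})) = proj {r..<d0}"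
      "tp (fU * proj {r..<d0}) * (fS * (fU * J)) = 0" by (rule split_gram[OF fU(3)])+
    show "PX * U0 = U0" by (rule proj_subset_fix[OF _ Iu(1,3)]) simp
    show "proj T * U0 = U0" by (rule proj_subset_fix[OF finT _ Iu(3)]) (auto simp: T_def)
    show "U0 * J = U0" by (rule Iu)
    show "norm (U0 - fU * J) \<le> \<tau>" using Iu(6) U1 by simp
  qed simp_all
  have side_v: "cca_side fS ?H ?D T r (2 * M) \<delta> \<tau> {p..<p + m} (fV * J) (fV * proj {r..<d0}) ?V0 {r..<d0}"
  proof (rule cca_side.intro[OF sp], rule cca_side_axioms.intro)
    show "(norm Y)\<^sup>2 / (2 * M) \<le> inner (fS * Y) Y" if "PY * Y = Y" for Y
      using half[of Y] coercive_y(1)[OF that] by linarith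
    show "PY * (fV * J) = fV * J" "PY * (fV * proj {r..<d0}) = fV * proj {r..<d0}"
      by (rule proj_mult_fix[OF _ fV(1)], simp)+
    show "fV * J * J = fV * J" by (simp add: mult.assoc)
    show "tp (fV * J) * (fS * (fV * J)) = J" "tp (fV * proj {r..<d0}) * (fS * (fV * proj {r..<d0})) = proj {r..<d0}"
      "tp (fV * proj {r..<d0}) * (fS * (fV * J)) = 0" by (rule split_gram[OF fV(3)])+
    show "PY * ?V0 = ?V0" by (rule proj_mult_fix[OF _ proj_shift]) simp
    show "proj T * ?V0 = ?V0"
      by (rule proj_subset_fix[OF finT _ shift_image_fix[OF fin(2) Iv(1,3)]]) (auto simp: T_def)
    show "?V0 * J = ?V0" using Iv(4) by (simp add: mult.assoc)
    have "?V0 - fV * J = E * (V0 - fm (first_cols r V))" by (simp add: V1 fV_def right_diff_distrib mult.assoc)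
    also have "norm \<dots> \<le> 1 * norm (V0 - fm (first_cols r V))"
      by (rule opbD[OF opb_orthonormal[OF _ shift_gram]]) simp
    finally show "norm (?V0 - fV * J) \<le> \<tau>" using Iv(6) by simp
  qed simp_all
  have fL: "PX * fS * PY = PX * (fS * (fU * J * diagm r l * tp (fV * J) + fU * proj {r..<d0} * L2 * tp (fV * proj {r..<d0})) * fS) * PY"
    using fSxy split_L by simp
  have orc: "cca_oracle fS ?H ?D T r (2 * M) \<delta> \<tau> {..<p} (fU * J) (fU * proj {r..<d0}) U0 {r..<d0}
    {p..<p + m} (fV * J) (fV * proj {r..<d0}) ?V0 {r..<d0} fA fB (diagm r l) L2 l lam \<kappa> c"
  proof (rule cca_oracle.intro[OF side_u side_v], rule cca_oracle_axioms.intro)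
    show "PX * fA = fA" "proj T * fA = fA" "fA * J = fA" "tp fA * (?H * fA) = J" by (rule fA)+
    show "PY * fB = fB" "proj T * fB = fB" "fB * J = fB" "tp fB * (?H * fB) = J" by (rule fB)+
    show "PX * fS * PY = PX * (fS * (fU * J * diagm r l * tp (fV * J) + fU * proj {r..<d0} * L2 * tp (fV * proj {r..<d0})) * fS) * PY"
      by (rule fL)
    show "lam \<le> l i \<and> l i \<le> \<kappa> * lam" if "i < r" for i by (rule l_props(3)[OF that])
    show "opb L2 (c * lam)" by (rule oL2[OF nc c(1)])
    fix G G' assume G: "J * G = G" "G * J = G" "norm (J - G) < 1" "tp (U0 * G) * (?H * (U0 * G)) = J"
      and G': "J * G' = G'" "G' * J = G'" "norm (J - G') < 1" "tp (?V0 * G') * (?H * (?V0 * G')) = J"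
    \<comment> \<open>Feasible competitors have the original sizes, so the surrogates are cut back
      and \<open>V0\<close> takes the place of its shifted copy.\<close>
    let ?A = "Matrix.mat p r (\<lambda>(i, j). ent (U0 * G) i j)"
    let ?B = "Matrix.mat m r (\<lambda>(i, j). ent (V0 * G') i j)"
    have XA: "proj Iu * (U0 * G) = U0 * G" "U0 * G * J = U0 * G" "proj Iv * (V0 * G') = V0 * G'" "V0 * G' * J = V0 * G'"
      using G(2) G'(2) fin by (auto simp: proj_mult_fix[OF _ Iu(3)] proj_mult_fix[OF _ Iv(3)] mult.assoc)
    have XP: "PX * (U0 * G) = U0 * G" "proj {..<m} * (V0 * G') = V0 * G'"
      by (rule proj_subset_fix[OF _ Iu(1) XA(1)], simp, rule proj_subset_fix[OF _ Iv(1) XA(3)], simp)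
    have fA': "fm ?A = U0 * G" by (rule fm_of_ent[OF XP(1) XA(2)])
    have fB': "fm ?B = V0 * G'" by (rule fm_of_ent[OF XP(2) XA(4)])
    have cA': "?A \<in> carrier_mat p r" and cB': "?B \<in> carrier_mat m r" by auto
    have "cca_feasible p m r ku kv ?S ?A ?B"
      unfolding cca_feasible_def
    proof (intro conjI cA' cB')
      note bd = block_dims[OF cS]
      show "?A\<^sup>T * block_x p ?S * ?A = 1\<^sub>m r"
      proof (rule fm_inject[of _ r r])
        show "?A\<^sup>T * block_x p ?S * ?A \<in> carrier_mat r r"
          by (rule mult_carrier_mat[OF mult_carrier_mat[OF _ bd(1)] cA']) simp
        show "fm (?A\<^sup>T * block_x p ?S * ?A) = fm (1\<^sub>m r)"
          unfolding gram_x[OF cA', symmetric] fA' G(4) fm_one ..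
      qed simp
      show "?B\<^sup>T * block_y p ?S * ?B = 1\<^sub>m r"
      proof (rule fm_inject[of _ r r])
        show "?B\<^sup>T * block_y p ?S * ?B \<in> carrier_mat r r"
          by (rule mult_carrier_mat[OF mult_carrier_mat[OF _ bd(3)] cB']) simp
        show "fm (?B\<^sup>T * block_y p ?S * ?B) = fm (1\<^sub>m r)"
          unfolding gram_y[OF cB', symmetric] fB' fm_one using G'(4) by (simp only: mult.assoc)
      qed simp
      show "weak_norm 0 ?A = real ku"
        by (rule weak_norm_0_of_ent[OF pm(1) Iu(1,2) XA(1,2)]) (use Iu(5) nonzero_rows_preserved[OF Iu(4) G(3)] in blast)
      show "weak_norm 0 ?B = real kv"
        by (rule weak_norm_0_of_ent[OF pm(2) Iv(1,2) XA(3,4)]) (use Iv(5) nonzero_rows_preserved[OF Iv(4) G'(3)] in blast)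
    qed
    from opt[OF this] show "inner ?H (U0 * G * tp (?V0 * G')) \<le> inner ?H (fA * tp fB)"
      unfolding trace_block_xy[OF cS cA' cB'] trace_block_xy[OF cS A B] fA' fB' fA_def fB_def by (simp only: mult.assoc)
  qed (use l_props \<kappa> c \<delta> in auto)
  have "norm (fA * tp fB - (fU * J) * tp (fV * J)) \<le> 6000 * \<kappa> * (2 * M) ^ 8 * \<tau>"
    by (rule cca_oracle.estimation_error[OF orc])
  also have "fA * tp fB - (fU * J) * tp (fV * J) = (fm A * tp (fm B) - fm (first_cols r U) * tp (fm (first_cols r V))) * tp E"
    by (simp add: fA_def fB_def U1 V1 fV_def left_diff_distrib mult.assoc)
  \<comment> \<open>Right multiplication by \<open>tp E\<close> only relocates columns, so the error
    in joint coordinates is the original Frobenius error.\<close>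
  also have "norm \<dots> = norm (fm A * tp (fm B) - fm (first_cols r U) * tp (fm (first_cols r V)))"
  proof (rule norm_mult_tp_shift)
    have "proj {..<m} * fm B = fm B" "proj {..<m} * fm V = fm V" by (rule fm_rows, simp, use B UV_carrier in simp)+
    then have "tp (fm B) * proj {..<m} = tp (fm B)" "tp (fm V) * proj {..<m} = tp (fm V)"
      by (metis tp_mult tp_proj)+
    then show "(fm A * tp (fm B) - fm (first_cols r U) * tp (fm (first_cols r V))) * proj {..<m}
      = fm A * tp (fm B) - fm (first_cols r U) * tp (fm (first_cols r V))"
      by (simp add: V1 left_diff_distrib mult.assoc)
  qed
  finally show ?thesis .
qed

text \<open>Each factor contributes \<open>sqrt M\<close> in operator norm and \<open>J\<close>
  contributes \<open>sqrt r\<close>. The result is half the truncation level, which is why cutting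
  off does no harm.\<close>

lemma truth_norm: "norm (fm (first_cols r U) * tp (fm (first_cols r V))) \<le> M * sqrt (real r)"
proof -
  have U1: "fm (first_cols r U) = fU * J" using UV_carrier(1) r_d0 by (simp add: fm_first_cols fU_def)
  have V1: "fm (first_cols r V) = fm V * J" using UV_carrier(2) r_d0 by (simp add: fm_first_cols)
  have bnd: "(norm (Q * J * X))\<^sup>2 \<le> M * (norm X)\<^sup>2"
    if Q: "tp Q * (fS * Q) = proj {..<d0}" "(norm (Q * J * X))\<^sup>2 / M \<le> inner (fS * (Q * J * X)) (Q * J * X)" for Q X
  proof -
    have "inner (fS * (Q * J * X)) (Q * J * X) = inner (tp (Q * J) * (fS * (Q * J)) * X) X"
      using inner_mult_left[of "Q * J" X "fS * (Q * J * X)"] by (simp add: inner_commute mult.assoc)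
    also have "\<dots> = inner (J * X) X" unfolding split_gram(1)[OF Q(1)] ..
    also have "\<dots> \<le> norm (J * X) * norm X" by (rule norm_cauchy_schwarz)
    also have "\<dots> \<le> norm X * norm X" by (intro mult_right_mono norm_proj_le) auto
    finally have "(norm (Q * J * X))\<^sup>2 / M \<le> (norm X)\<^sup>2" using Q(2) by (simp add: power2_eq_square)
    then show ?thesis using M by (simp add: pos_divide_le_eq mult.commute)
  qed
  have "(norm (fU * J * tp (fV * J)))\<^sup>2 \<le> M * (norm (tp (fV * J)))\<^sup>2"
    by (rule bnd[OF fU(3) coercive_x(1)]) (simp add: mult.assoc[symmetric] fU(1))
  also have "norm (tp (fV * J)) = norm (fV * J * J)" by (simp only: norm_tp mult.assoc proj_idem finite_lessThan)
  also have "M * (norm (fV * J * J))\<^sup>2 \<le> M * (M * (norm J)\<^sup>2)"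
    using M by (intro mult_left_mono bnd[OF fV(3) coercive_y(1)]) (simp_all add: mult.assoc[symmetric] fV(1))
  also have "(norm J)\<^sup>2 = real r" by (simp add: norm_power2_inner inner_proj)
  finally have "(norm (fU * J * tp (fV * J)))\<^sup>2 \<le> (M * sqrt (real r))\<^sup>2" by (simp add: power_mult_distrib power2_eq_square[of M])
  then have "norm (fU * J * tp (fV * J)) \<le> M * sqrt (real r)" by (rule power2_le_imp_le) (use M in simp)
  moreover have "fU * J * tp (fV * J) = (fm (first_cols r U) * tp (fm (first_cols r V))) * tp E"
    by (simp add: U1 V1 fV_def mult.assoc)
  moreover have "norm ((fm (first_cols r U) * tp (fm (first_cols r V))) * tp E) = norm (fm (first_cols r U) * tp (fm (first_cols r V)))"
  proof (rule norm_mult_tp_shift)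
    have "proj {..<m} * fm V = fm V" by (rule fm_rows, simp, use UV_carrier in simp)
    then have "tp (fm V) * proj {..<m} = tp (fm V)" by (metis tp_mult tp_proj)
    then show "fm (first_cols r U) * tp (fm (first_cols r V)) * proj {..<m} = fm (first_cols r U) * tp (fm (first_cols r V))"
      by (simp add: V1 mult.assoc)
  qed
  ultimately show ?thesis by simp
qed

end

section \<open>The risk bound\<close>

lemma power_le_exp_fact: "real k ^ k \<le> exp (real k) * fact k"
proof -
  have s: "summable (\<lambda>n. real k ^ n /\<^sub>R fact n)" and e: "exp (real k) = (\<Sum>n. real k ^ n /\<^sub>R fact n)"
    using exp_converges[of "real k"] by (auto simp: sums_iff)
  have "(\<Sum>n\<in>{k}. real k ^ n /\<^sub>R fact n) \<le> exp (real k)"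
    unfolding e by (rule sum_le_suminf[OF s]) auto
  then show ?thesis by (simp add: field_simps)
qed

text \<open>The right-hand side is \<open>(e p / k) ^ k\<close>, and \<open>k ^ k\<close> is at most
  \<open>exp k * fact k\<close> by the exponential series.\<close>

lemma binomial_le_exp:
  assumes "0 < k" "0 < p"
  shows "real (p choose k) \<le> exp (real k * ln (exp 1 * real p / real k))"
proof -
  have "real (p choose k) * fact k \<le> real p ^ k"
    using binomial_fact_pow[of p k] by (metis of_nat_fact of_nat_le_iff of_nat_mult of_nat_power)
  then have 1: "real (p choose k) * fact k * exp (real k) \<le> real p ^ k * exp (real k)" by (intro mult_right_mono) auto
  have "real (p choose k) * real k ^ k \<le> real (p choose k) * (exp (real k) * fact k)"
    by (intro mult_left_mono power_le_exp_fact) auto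
  also have "\<dots> = real (p choose k) * fact k * exp (real k)" by (simp only: mult_ac)
  also note 1
  finally have "real (p choose k) * real k ^ k \<le> real p ^ k * exp (real k)" .
  moreover have "exp (real k * ln (exp 1 * real p / real k)) = real p ^ k * exp (real k) / real k ^ k"
    using assms by (simp add: exp_of_nat_mult power_divide power_mult_distrib exp_of_nat_mult[of k 1, symmetric] mult.commute)
  ultimately show ?thesis using assms by (simp add: pos_le_divide_eq)
qed

lemma ln_ratio_ge_1: "0 < k \<Longrightarrow> k \<le> p \<Longrightarrow> 1 \<le> ln (exp 1 * real p / real k)"
  by (subst ln_ge_iff) (auto simp: field_simps)

text \<open>Without a nonzero row the factor would vanish, against its normalisation to the identity
  of size \<open>r\<close>.\<close>

lemma cca_solution_sparsity_pos:
  assumes sol: "cca_solution p m r ku kv S A B" and pm: "0 < p" "0 < m" "0 < r" and S: "S \<in> carrier_mat (p + m) (p + m)"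
  shows "0 < ku" "0 < kv"
proof -
  have *: "0 < k" if C: "C \<in> carrier_mat d r" "weak_norm 0 C = real k" "0 < d" "C\<^sup>T * Q * C = 1\<^sub>m r" "Q \<in> carrier_mat d d" for C Q d k
  proof (rule ccontr)
    assume "\<not> 0 < k"
    then have k: "k = 0" by simp
    let ?I = "{i. i < dim_row C \<and> row_norm C i \<noteq> 0}"
    have I0: "?I = {}" using weak_norm_0_fm(1)[of C k] C k by simp
    have "proj ?I * fm C = fm C" by (rule weak_norm_0_fm(3)[OF _ C(2)]) (use C in simp)
    then have "proj {} * fm C = fm C" unfolding I0 .
    moreover have "proj {} = 0" by (rule fmat_eqI) simp
    ultimately have "fm C = 0" by simp
    moreover have "fm (C\<^sup>T * Q * C) = fm (C\<^sup>T * Q) * fm C" by (rule fm_mult) (use C in auto)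
    ultimately have "fm (C\<^sup>T * Q * C) = 0" by simp
    then have "proj {..<r} = 0" using C(4) fm_one[of r] by simp
    then have "ent (proj {..<r}) 0 0 = 0" by simp
    then show False using pm by simp
  qed
  show "0 < ku" "0 < kv"
    using sol *[of A p ku "block_x p S"] *[of B m kv "block_y p S"] pm block_dims[OF S]
    by (auto simp: cca_solution_def cca_feasible_def)
qed

text \<open>When the product is cut off, its norm exceeds twice the bound on the truth, so the
  untruncated error is at least the norm of the truth, which is then the loss.\<close>

lemma truncated_loss:
  assumes A: "A \<in> carrier_mat p r" and B: "B \<in> carrier_mat m r" and M: "0 < M"
    and U: "U1 \<in> carrier_mat p r" "V1 \<in> carrier_mat m r"
    and tru: "norm (fm U1 * tp (fm V1)) \<le> M * sqrt (real r)"
  defines "loss \<equiv> frob_norm (truncated_product M r A B - U1 * V1\<^sup>T)"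
  shows "loss \<le> norm (fm A * tp (fm B) - fm U1 * tp (fm V1))" "loss \<le> 3 * M * sqrt (real r)"
proof -
  have AB: "fm (A * B\<^sup>T) = fm A * tp (fm B)" using A B by (simp add: fm_mult)
  have UV: "fm (U1 * V1\<^sup>T) = fm U1 * tp (fm V1)" using U by (simp add: fm_mult)
  have d: "dim_row (truncated_product M r A B) = p" "dim_col (truncated_product M r A B) = m"
    using A B by (auto simp: truncated_product_def)
  have l: "loss = norm (fm (truncated_product M r A B) - fm U1 * tp (fm V1))"
    unfolding loss_def frob_norm_fm using d U by (subst fm_diff) (auto simp: UV)
  let ?E = "fm A * tp (fm B)" and ?T = "fm U1 * tp (fm V1)"
  have t: "fm (truncated_product M r A B) = (if norm ?E \<le> 2 * M * sqrt (real r) then ?E else 0)"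
    by (simp add: truncated_product_def frob_norm_fm AB fm_zero)
  show "loss \<le> norm (?E - ?T)"
  proof (cases "norm ?E \<le> 2 * M * sqrt (real r)")
    case False
    have "norm ?E \<le> norm (?E - ?T) + norm ?T" using norm_triangle_ineq[of "?E - ?T" ?T] by simp
    then show ?thesis using False tru by (simp add: l t)
  qed (simp add: l t)
  show "loss \<le> 3 * M * sqrt (real r)"
  proof (cases "norm ?E \<le> 2 * M * sqrt (real r)")
    case True
    have "norm (?E - ?T) \<le> norm ?E + norm ?T" by (rule norm_triangle_ineq4)
    then show ?thesis using True tru by (simp add: l t)
  next
    case False
    have "0 \<le> M * sqrt (real r)" using M by simp
    then show ?thesis using False tru by (simp add: l t)
  qed
qed

text \<open>Everything is measured against \<open>N = \<epsilon> * n * lam\<^sup>2\<close>: the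
  entropy of the supports, that of the lattices up to 216, and the rank are all bounded by it, so a
  single constant \<open>D\<close> decides the probability.\<close>

lemma (in cca_model) risk:
  fixes n :: nat and C1 D c :: real and Uh Vh :: "(nat \<Rightarrow> nat \<Rightarrow> real) \<Rightarrow> real mat"
  defines "ku \<equiv> eff_k q s_u n p r lam" and "kv \<equiv> eff_k q s_v n m r lam"
    and "\<epsilon> \<equiv> eps_sq q s_u s_v n p m r lam" and "b \<equiv> 2 * M"
  assumes q: "0 \<le> q" "q < 2" and n: "0 < n" and C1: "0 < C1" and s: "0 < s_u" "0 < s_v" and \<kappa>: "1 \<le> \<kappa>"
    and D: "16 * b * sqrt (218 + C1) \<le> D" "sqrt (q / (2 - q)) + 1 \<le> D" and D\<epsilon>: "D * sqrt \<epsilon> \<le> 1 / (28 * b\<^sup>2)"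
    and c: "0 \<le> c" "c \<le> 1 / (128 * b ^ 8)" and nc: "next_corr p m r l \<le> c * lam"
    and tail: "real n * lam\<^sup>2 < exp (C1 * (real ku + ln (exp 1 * real p / real ku)))"
    and sol: "AE Z in sample_law n (p + m) S. cca_solution p m r ku kv (sample_cov n (p + m) Z) (Uh Z) (Vh Z)"
  shows "(\<integral>\<^sup>+ Z. ennreal ((frob_norm (truncated_product M r (Uh Z) (Vh Z) - first_cols r U * (first_cols r V)\<^sup>T))\<^sup>2) \<partial>sample_law n (p + m) S)
    \<le> ennreal (((6000 * \<kappa> * b ^ 8 * D)\<^sup>2 + 9 * M\<^sup>2) * \<epsilon>)"
proof -
  interpret g: gaussian "p + m" S b unfolding b_def by (rule gaussian)
  let ?P = "sample_law n (p + m) S"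
  interpret P: prob_space ?P by (rule g.prob_space_sample)
  have cS: "sample_cov n (p + m) Z \<in> carrier_mat (p + m) (p + m)" for Z by (simp add: sample_cov_def)
  have lam: "0 < lam" "lam < 1"
  proof -
    show l0: "0 < lam" by (rule l_props)
    have "1 * lam \<le> \<kappa> * lam" using \<kappa> l0 by (intro mult_right_mono) auto
    then show "lam < 1" using l_props(4) by simp
  qed
  have b: "2 < b" "1 < b" "0 < b" using M by (auto simp: b_def)
  \<comment> \<open>An almost sure event of a probability is nonempty; one solvable sample already
    rules out zero sparsity.\<close>
  obtain Z0 where "cca_solution p m r ku kv (sample_cov n (p + m) Z0) (Uh Z0) (Vh Z0)"
    using eventually_happens'[OF P.ae_filter_bot sol] by blast
  from cca_solution_sparsity_pos[OF this pm(1-3) cS] have k0: "0 < ku" "0 < kv" .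
  note ku = eff_k_props[OF q(1) s(1) pm(3) pm(1) n lam(1), folded ku_def]
  note kv = eff_k_props[OF q(1) s(2) pm(3) pm(2) n lam(1), folded kv_def]
  define lu where "lu = ln (exp 1 * real p / real ku)"
  define lv where "lv = ln (exp 1 * real m / real kv)"
  have l1: "1 \<le> lu" "1 \<le> lv" unfolding lu_def lv_def using ln_ratio_ge_1 k0 ku(1) kv(1) by auto
  define N where "N = real r * (real ku + real kv) + real ku * lu + real kv * lv"
  define x where "x = real n * lam\<^sup>2"
  have x: "0 < x" using n lam by (simp add: x_def)
  have \<epsilon>N: "\<epsilon> = N / x" by (simp add: \<epsilon>_def eps_sq_def Let_def ku_def[symmetric] kv_def[symmetric] N_def lu_def lv_def x_def)
  have r1: "1 \<le> real r" using pm by simp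
  have k1: "1 \<le> real ku" "1 \<le> real kv" using k0 by auto
  have parts: "0 \<le> real r * real ku" "0 \<le> real r * real kv" "0 \<le> real ku * lu" "0 \<le> real kv * lv"
    using l1 by auto
  have rku: "real r \<le> real r * real ku" "real ku \<le> real r * real ku" "lu \<le> real ku * lu"
    using mult_left_mono[OF k1(1), of "real r"] mult_right_mono[OF r1, of "real ku"] mult_right_mono[OF k1(1), of lu] l1 by auto
  have N0: "0 < N" and Nr: "real r \<le> N" and Nk: "real ku + lu \<le> N" and Nrk: "real r * (real ku + real kv) \<le> N"
    and Nl: "real ku * lu + real kv * lv \<le> N"
  proof -
    have e: "N = real r * real ku + real r * real kv + real ku * lu + real kv * lv" "real r * (real ku + real kv) = real r * real ku + real r * real kv"
      by (simp_all add: N_def distrib_left)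
    show "0 < N" "real r \<le> N" "real ku + lu \<le> N" "real r * (real ku + real kv) \<le> N" "real ku * lu + real kv * lv \<le> N"
      unfolding e using rku parts r1 by linarith+
  qed
  have \<epsilon>0: "0 < \<epsilon>" using N0 x by (simp add: \<epsilon>N)
  define \<tau> where "\<tau> = D * sqrt \<epsilon>"
  have D0: "0 < D" using D(2) q by (smt (verit) real_sqrt_ge_zero divide_nonneg_nonneg)
  have \<tau>0: "0 < \<tau>" using D0 \<epsilon>0 by (simp add: \<tau>_def)
  have sqrt_le: "(sqrt (q / (2 - q)) + 1) * sqrt (real k * ((real r + y) / x)) \<le> \<tau>"
    if "real k * (real r + y) \<le> N" "0 \<le> y" for k y
  proof -
    have "real k * ((real r + y) / x) \<le> \<epsilon>" using that x by (simp add: \<epsilon>N divide_right_mono)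
    moreover have "0 \<le> real k * ((real r + y) / x)" using that x by simp
    ultimately show ?thesis unfolding \<tau>_def using D(2) D0 q by (intro mult_mono real_sqrt_le_mono real_sqrt_ge_zero) auto
  qed
  have carr: "first_cols r U \<in> carrier_mat p r" "first_cols r V \<in> carrier_mat m r"
    using UV_carrier by (auto simp: first_cols_def)
  have aIu: "0 < (real r + lu) / x" using x l1 by simp
  have bIu: "ku = p \<or> s_u \<le> real ku * ((real r + lu) / x) powr (q / 2)"
    using ku(2)[OF k0(1)] by (simp add: lu_def x_def)
  obtain Iu U0 where Iu': "Iu \<subseteq> {..<p} \<and> card Iu = ku \<and> proj Iu * U0 = U0 \<and> U0 * J = U0 \<and>
    (\<forall>i\<in>Iu. \<exists>j. ent U0 i j \<noteq> 0) \<and>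
    norm (U0 - fm (first_cols r U)) \<le> (sqrt (q / (2 - q)) + 1) * sqrt (real ku * ((real r + lu) / x))"
    using truncation[OF carr(1) k0(1) ku(1) pm(3) q weak(1) aIu bIu] by (elim exE)
  note Iu = Iu'[THEN conjunct1] Iu'[THEN conjunct2, THEN conjunct1]
    Iu'[THEN conjunct2, THEN conjunct2, THEN conjunct1] Iu'[THEN conjunct2, THEN conjunct2, THEN conjunct2, THEN conjunct1]
    Iu'[THEN conjunct2, THEN conjunct2, THEN conjunct2, THEN conjunct2, THEN conjunct1, rule_format]
    Iu'[THEN conjunct2, THEN conjunct2, THEN conjunct2, THEN conjunct2, THEN conjunct2]
  have aIv: "0 < (real r + lv) / x" using x l1 by simp
  have bIv: "kv = m \<or> s_v \<le> real kv * ((real r + lv) / x) powr (q / 2)"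
    using kv(2)[OF k0(2)] by (simp add: lv_def x_def)
  obtain Iv V0 where Iv': "Iv \<subseteq> {..<m} \<and> card Iv = kv \<and> proj Iv * V0 = V0 \<and> V0 * J = V0 \<and>
    (\<forall>i\<in>Iv. \<exists>j. ent V0 i j \<noteq> 0) \<and>
    norm (V0 - fm (first_cols r V)) \<le> (sqrt (q / (2 - q)) + 1) * sqrt (real kv * ((real r + lv) / x))"
    using truncation[OF carr(2) k0(2) kv(1) pm(3) q weak(2) aIv bIv] by (elim exE)
  note Iv = Iv'[THEN conjunct1] Iv'[THEN conjunct2, THEN conjunct1]
    Iv'[THEN conjunct2, THEN conjunct2, THEN conjunct1] Iv'[THEN conjunct2, THEN conjunct2, THEN conjunct2, THEN conjunct1]
    Iv'[THEN conjunct2, THEN conjunct2, THEN conjunct2, THEN conjunct2, THEN conjunct1, rule_format]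
    Iv'[THEN conjunct2, THEN conjunct2, THEN conjunct2, THEN conjunct2, THEN conjunct2]
  have U\<tau>: "norm (U0 - fm (first_cols r U)) \<le> \<tau>"
    by (rule order_trans[OF Iu(6) sqrt_le]) (use parts l1 in \<open>simp_all add: N_def algebra_simps\<close>)
  have V\<tau>: "norm (V0 - fm (first_cols r V)) \<le> \<tau>"
    by (rule order_trans[OF Iv(6) sqrt_le]) (use parts l1 in \<open>simp_all add: N_def algebra_simps\<close>)
  \<comment> \<open>\<open>F\<close> lists the possible supports of the estimator; those of the
    surrogates are fixed, and their presence only doubles the size.\<close>
  define F where "F = {I2. I2 \<subseteq> {..<p} \<and> card I2 = ku} \<times> {J2. J2 \<subseteq> {..<m} \<and> card J2 = kv}"
  define sup where "sup = (\<lambda>(I2, J2). Iu \<union> I2 \<union> (\<lambda>j. j + p) ` (Iv \<union> J2))"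
  have finF: "finite F" by (simp add: F_def)
  have cardF: "real (card (sup ` F)) \<le> exp (real ku * lu + real kv * lv)"
  proof -
    have "real (card (sup ` F)) \<le> real (card F)" using card_image_le[OF finF] by simp
    also have "\<dots> = real (p choose ku) * real (m choose kv)"
      by (simp add: F_def card_cartesian_product n_subsets)
    also have "\<dots> \<le> exp (real ku * lu) * exp (real kv * lv)"
      unfolding lu_def lv_def using k0 pm by (intro mult_mono binomial_le_exp) auto
    finally show ?thesis by (simp add: exp_add)
  qed
  have supF: "T \<subseteq> {..<p + m} \<and> card T \<le> 2 * ku + 2 * kv" if T: "T \<in> sup ` F" for T
  proof -
    obtain I2 J2 where IJ: "I2 \<subseteq> {..<p}" "card I2 = ku" "J2 \<subseteq> {..<m}" "card J2 = kv" "T = Iu \<union> I2 \<union> (\<lambda>j. j + p) ` (Iv \<union> J2)"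
      using T by (auto simp: F_def sup_def)
    have "card T \<le> card (Iu \<union> I2) + card ((\<lambda>j. j + p) ` (Iv \<union> J2))" unfolding IJ(5) by (rule card_Un_le)
    also have "card ((\<lambda>j. j + p) ` (Iv \<union> J2)) = card (Iv \<union> J2)" by (rule card_image) (simp add: inj_on_def)
    also have "card (Iu \<union> I2) + card (Iv \<union> J2) \<le> (ku + ku) + (kv + kv)"
      using card_Un_le[of Iu I2] card_Un_le[of Iv J2] IJ Iu(2) Iv(2) by linarith
    finally have "card T \<le> 2 * ku + 2 * kv" by simp
    moreover have "T \<subseteq> {..<p + m}" using IJ Iu(1) Iv(1) by auto
    ultimately show ?thesis by simp
  qed
  \<comment> \<open>Half of \<open>lam * \<tau>\<close>, because passing from the net to all
    matrices doubles the bound.\<close>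
  define t where "t = lam * \<tau> / 2"
  have t0: "0 \<le> t" using lam \<tau>0 by (simp add: t_def)
  have tb: "t \<le> 2 * b"
  proof -
    have "\<tau> \<le> 1 / (28 * b\<^sup>2)" using D\<epsilon> by (simp add: \<tau>_def)
    also have "\<dots> \<le> 1"
    proof -
      have "1 \<le> b\<^sup>2" using b by (intro one_le_power) simp
      then have "0 < 28 * b\<^sup>2" "1 \<le> 28 * b\<^sup>2" by linarith+
      then show ?thesis by (simp only: divide_le_eq_1_pos)
    qed
    finally have "lam * \<tau> \<le> 1 * 1" using lam \<tau>0 by (intro mult_mono) auto
    then show ?thesis using b by (simp add: t_def)
  qed
  obtain bad where bad: "bad \<in> sets ?P"
    "emeasure ?P bad \<le> ennreal (real (card (sup ` F)) * exp (54 * real ((2 * ku + 2 * kv) * (2 * r))) * exp (- real n * t\<^sup>2 / (64 * b\<^sup>2)))"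
    "\<forall>Z\<in>space ?P - bad. \<forall>T\<in>sup ` F. sparse_small T (2 * r) (2 * t) (fm (sample_cov n (p + m) Z) - fm S)"
    using g.good_event[OF finite_imageI[OF finF] supF, of sup "2 * r" n t] pm(3) n t0 tb by auto
  \<comment> \<open>The half in \<open>t\<close> and the constant 64 combine to
    \<open>256 * b\<^sup>2\<close>, the square of \<open>16 * b\<close> in the lower bound for
    \<open>D\<close>.\<close>
  have nt: "real n * t\<^sup>2 / (64 * b\<^sup>2) \<ge> (218 + C1) * N"
  proof -
    have "real n * t\<^sup>2 = D\<^sup>2 * N / 4"
    proof -
      have "real n * t\<^sup>2 = x * D\<^sup>2 * \<epsilon> / 4" using \<epsilon>0 by (simp add: t_def \<tau>_def x_def power_mult_distrib power_divide)
      then show ?thesis using x by (simp add: \<epsilon>N)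
    qed
    moreover have "256 * b\<^sup>2 * (218 + C1) \<le> D\<^sup>2"
    proof -
      have "(16 * b * sqrt (218 + C1))\<^sup>2 \<le> D\<^sup>2" using D(1) b C1 by (intro power_mono) auto
      then show ?thesis using C1 by (simp add: power_mult_distrib)
    qed
    then have "256 * b\<^sup>2 * (218 + C1) * N \<le> D\<^sup>2 * N" using N0 by (intro mult_right_mono) auto
    ultimately show ?thesis using b by (simp add: field_simps)
  qed
  have Pbad: "emeasure ?P bad \<le> ennreal (1 / x)"
  proof -
    have "real (card (sup ` F)) * exp (54 * real ((2 * ku + 2 * kv) * (2 * r))) * exp (- real n * t\<^sup>2 / (64 * b\<^sup>2))
      \<le> exp (real ku * lu + real kv * lv) * exp (216 * (real r * (real ku + real kv))) * exp (- ((218 + C1) * N))"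
      using nt by (intro mult_mono cardF) (auto simp: algebra_simps)
    also have "\<dots> = exp ((real ku * lu + real kv * lv) + 216 * (real r * (real ku + real kv)) - (218 + C1) * N)"
      by (simp add: exp_add[symmetric])
    \<comment> \<open>Supports use \<open>N\<close> and lattices \<open>216 * N\<close>, since
      \<open>54 * 2 * 2 = 216\<close>; together they stay below \<open>218 * N\<close>.\<close>
    also have "\<dots> \<le> exp (- (C1 * N))"
    proof -
      have "(218 + C1) * N = 218 * N + C1 * N" by (rule distrib_right)
      then show ?thesis using Nl Nrk N0 by simp
    qed
    also have "\<dots> \<le> 1 / x"
    proof -
      have "C1 * (real ku + lu) \<le> C1 * N" using C1 Nk by (intro mult_left_mono) auto
      then have "exp (C1 * (real ku + lu)) \<le> exp (C1 * N)" by simp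
      then have "x \<le> exp (C1 * N)" using tail[folded lu_def x_def] by linarith
      then show ?thesis using x by (simp add: exp_minus field_simps)
    qed
    finally show ?thesis using bad(2) by (meson ennreal_leI order_trans)
  qed
  define K where "K = 6000 * \<kappa> * b ^ 8 * D"
  have K0: "0 \<le> K" using \<kappa> b D0 by (simp add: K_def)
  let ?loss = "\<lambda>Z. frob_norm (truncated_product M r (Uh Z) (Vh Z) - first_cols r U * (first_cols r V)\<^sup>T)"
  have loss: "(?loss Z)\<^sup>2 \<le> K\<^sup>2 * \<epsilon> + 9 * M\<^sup>2 * real r * indicator bad Z"
    if Z: "Z \<in> space ?P" and sZ: "cca_solution p m r ku kv (sample_cov n (p + m) Z) (Uh Z) (Vh Z)" for Z
  proof -
    have UZ: "Uh Z \<in> carrier_mat p r" "Vh Z \<in> carrier_mat m r"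
      using sZ by (auto simp: cca_solution_def cca_feasible_def)
    have M0: "0 < M" using M by simp
    note tl = truncated_loss[OF UZ M0 carr truth_norm]
    have l0: "0 \<le> ?loss Z" by (simp add: frob_norm_fm)
    show ?thesis
    proof (cases "Z \<in> bad")
      case True
      have "(?loss Z)\<^sup>2 \<le> (3 * M * sqrt (real r))\<^sup>2" by (intro power_mono tl(2) l0)
      also have "\<dots> = 9 * M\<^sup>2 * real r" by (simp add: power_mult_distrib)
      finally show ?thesis using True \<epsilon>0 by (simp add: add_increasing)
    next
      case False
      have "norm (fm (Uh Z) * tp (fm (Vh Z)) - fm (first_cols r U) * tp (fm (first_cols r V))) \<le> 6000 * \<kappa> * (2 * M) ^ 8 * \<tau>"
      proof (rule estimation[OF n sZ Iu(1-5) U\<tau> Iv(1-5) V\<tau>])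
        show "sparse_small (Iu \<union> I2 \<union> (\<lambda>j. j + p) ` (Iv \<union> J2)) (2 * r) (lam * \<tau>) (fm (sample_cov n (p + m) Z) - fm S)"
          if "I2 \<subseteq> {..<p}" "card I2 = ku" "J2 \<subseteq> {..<m}" "card J2 = kv" for I2 J2
        proof -
          have "(I2, J2) \<in> F" using that by (simp add: F_def)
          then have "sup (I2, J2) \<in> sup ` F" by (rule imageI)
          then have "sparse_small (sup (I2, J2)) (2 * r) (2 * t) (fm (sample_cov n (p + m) Z) - fm S)"
            using bad(3) Z False by blast
          then show ?thesis by (simp add: sup_def t_def)
        qed
        show "\<tau> \<le> 1 / (28 * (2 * M)\<^sup>2)" using D\<epsilon> by (simp add: \<tau>_def b_def)
        show "c \<le> 1 / (128 * (2 * M) ^ 8)" using c by (simp add: b_def)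
      qed (use lam \<tau>0 \<kappa> c nc in auto)
      also have "\<dots> = K * sqrt \<epsilon>" by (simp add: K_def b_def \<tau>_def)
      finally have "?loss Z \<le> K * sqrt \<epsilon>" using tl(1) by linarith
      then have "(?loss Z)\<^sup>2 \<le> (K * sqrt \<epsilon>)\<^sup>2" by (intro power_mono l0)
      also have "\<dots> = K\<^sup>2 * \<epsilon>" using \<epsilon>0 by (simp add: power_mult_distrib)
      finally show ?thesis using False by simp
    qed
  qed
  have "(\<integral>\<^sup>+ Z. ennreal ((?loss Z)\<^sup>2) \<partial>?P) \<le> (\<integral>\<^sup>+ Z. ennreal (K\<^sup>2 * \<epsilon>) + ennreal (9 * M\<^sup>2 * real r) * indicator bad Z \<partial>?P)"
  proof (rule nn_integral_mono_AE)
    show "AE Z in ?P. ennreal ((?loss Z)\<^sup>2) \<le> ennreal (K\<^sup>2 * \<epsilon>) + ennreal (9 * M\<^sup>2 * real r) * indicator bad Z"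
      using sol AE_space
    proof eventually_elim
      case (elim Z)
      have "ennreal ((?loss Z)\<^sup>2) \<le> ennreal (K\<^sup>2 * \<epsilon> + 9 * M\<^sup>2 * real r * indicator bad Z)"
        by (intro ennreal_leI loss elim)
      also have "\<dots> = ennreal (K\<^sup>2 * \<epsilon>) + ennreal (9 * M\<^sup>2 * real r) * indicator bad Z"
        using \<epsilon>0 by (cases "Z \<in> bad") (simp_all add: ennreal_plus)
      finally show ?case .
    qed
  qed
  also have "\<dots> = ennreal (K\<^sup>2 * \<epsilon>) + ennreal (9 * M\<^sup>2 * real r) * emeasure ?P bad"
    using bad(1) by (subst nn_integral_add) (auto simp: nn_integral_cmult P.emeasure_space_1)
  also have "\<dots> \<le> ennreal (K\<^sup>2 * \<epsilon>) + ennreal (9 * M\<^sup>2 * real r) * ennreal (1 / x)"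
    by (intro add_left_mono mult_left_mono Pbad) simp
  also have "\<dots> = ennreal (K\<^sup>2 * \<epsilon> + 9 * M\<^sup>2 * (real r / x))"
    using \<epsilon>0 x by (simp add: ennreal_mult[symmetric] ennreal_plus[symmetric] del: ennreal_plus)
  also have "\<dots> \<le> ennreal ((K\<^sup>2 + 9 * M\<^sup>2) * \<epsilon>)"
  proof (rule ennreal_leI)
    \<comment> \<open>The rank in the truncated loss is paid for by the term
      \<open>r * (ku + kv)\<close> of \<open>N\<close>.\<close>
    have "real r / x \<le> \<epsilon>" using Nr x by (simp add: \<epsilon>N divide_right_mono)
    then have "9 * M\<^sup>2 * (real r / x) \<le> 9 * M\<^sup>2 * \<epsilon>" by (intro mult_left_mono) auto
    then show "K\<^sup>2 * \<epsilon> + 9 * M\<^sup>2 * (real r / x) \<le> (K\<^sup>2 + 9 * M\<^sup>2) * \<epsilon>" by (simp add: distrib_right)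
  qed
  finally show ?thesis by (simp only: K_def)
qed

theorem theorem2:
  fixes q \<kappa> M c_star C1 :: real
  assumes "0 \<le> q" "q < 2" "1 < \<kappa>" "1 < M" "0 < c_star" "c_star < 1" "0 < C1"
  shows "\<exists>c C2. 0 < c \<and> c < 1 \<and> 0 < C2 \<and>
    (\<forall>(n::nat) (p::nat) (m::nat) (r::nat) (s_u::real) (s_v::real) (lam::real) Uh Vh.
      let k_u = eff_k q s_u n p r lam;
          k_v = eff_k q s_v n m r lam;
          F = {(S, U, V, l) \<in> param_space q s_u s_v p m r lam \<kappa> M.
                 next_corr p m r l \<le> c * lam}
      in
        0 < n \<and> 0 < p \<and> 0 < m \<and> 0 < r \<and> r \<le> min p m \<and> 0 < s_u \<and> 0 < s_v \<and> 0 < lam \<and>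
        \<kappa> * lam \<le> 1 - c_star \<and>
        eps_sq q s_u s_v n p m r lam \<le> c \<and>
        exp (C1 * (real k_u + ln (exp 1 * real p / real k_u))) > real n * lam\<^sup>2 \<and>
        exp (C1 * (real k_v + ln (exp 1 * real m / real k_v))) > real n * lam\<^sup>2 \<and>
        mat_statistic n (p + m) p r Uh \<and> mat_statistic n (p + m) m r Vh \<and>
        (\<forall>(S, U, V, l) \<in> F. AE Z in sample_law n (p + m) S.
           cca_solution p m r k_u k_v (sample_cov n (p + m) Z) (Uh Z) (Vh Z))
      \<longrightarrow>
        (SUP (S, U, V, l) \<in> F.
           \<integral>\<^sup>+ Z. ennreal ((frob_norm (truncated_product M r (Uh Z) (Vh Z)
                            - first_cols r U * (first_cols r V)\<^sup>T))\<^sup>2)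
             \<partial>(sample_law n (p + m) S))
        \<le> ennreal (C2 * eps_sq q s_u s_v n p m r lam))"
proof -
  define b where "b = 2 * M"
  \<comment> \<open>The first summand pays for the union bound, the second is the truncation
    constant.\<close>
  define D where "D = 16 * b * sqrt (218 + C1) + (sqrt (q / (2 - q)) + 1)"
  \<comment> \<open>The first bound keeps \<tau> in the range of the orthonormalisation, the second
    lets the curvature absorb the residual correlations.\<close>
  define c where "c = min ((1 / (28 * b\<^sup>2 * D))\<^sup>2) (1 / (128 * b ^ 8))"
  have b: "1 < b" using assms by (simp add: b_def)
  have sq: "0 \<le> sqrt (q / (2 - q))" using assms by simp
  have bs: "0 \<le> 16 * b * sqrt (218 + C1)" using b assms by simp
  have D: "16 * b * sqrt (218 + C1) \<le> D" "sqrt (q / (2 - q)) + 1 \<le> D" "0 < D"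
    using sq bs unfolding D_def by linarith+
  have c0: "0 < c" using b D by (simp add: c_def)
  have c1: "c < 1"
  proof -
    have "1 \<le> b ^ 8" using b by simp
    then have "1 < 128 * b ^ 8" by linarith
    then have "1 / (128 * b ^ 8) < 1" by (simp only: divide_less_eq_1_pos)
    then show ?thesis by (simp add: c_def)
  qed
  have cD: "D * sqrt e \<le> 1 / (28 * b\<^sup>2)" if "e \<le> c" for e
  proof -
    have "e \<le> (1 / (28 * b\<^sup>2 * D))\<^sup>2" using that by (simp add: c_def)
    then have "sqrt e \<le> sqrt ((1 / (28 * b\<^sup>2 * D))\<^sup>2)" by (rule real_sqrt_le_mono)
    also have "\<dots> = 1 / (28 * b\<^sup>2 * D)" using b D by simp
    finally have "D * sqrt e \<le> D * (1 / (28 * b\<^sup>2 * D))" using D by (intro mult_left_mono) auto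
    then show ?thesis using D by simp
  qed
  show ?thesis
    unfolding Let_def
  proof (rule exI[of _ c], rule exI[of _ "(6000 * \<kappa> * b ^ 8 * D)\<^sup>2 + 9 * M\<^sup>2"], intro conjI allI impI c0 c1, goal_cases)
    case 1
    show ?case using assms(4) by (intro add_nonneg_pos) auto
  next
    case (2 n p m r s_u s_v lam Uh Vh)
    note H = 2
    show ?case
    proof (rule SUP_least, clarify)
      fix S U V l
      assume P: "(S, U, V, l) \<in> param_space q s_u s_v p m r lam \<kappa> M" and nc: "next_corr p m r l \<le> c * lam"
      interpret cca_model p m r M q s_u s_v lam \<kappa> S U V l
        by unfold_locales (use H P assms in auto)
      show "(\<integral>\<^sup>+ Z. ennreal ((frob_norm (truncated_product M r (Uh Z) (Vh Z) - first_cols r U * (first_cols r V)\<^sup>T))\<^sup>2) \<partial>sample_law n (p + m) S)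
        \<le> ennreal (((6000 * \<kappa> * b ^ 8 * D)\<^sup>2 + 9 * M\<^sup>2) * eps_sq q s_u s_v n p m r lam)"
        unfolding b_def
      proof (rule risk[of n C1 D c Uh Vh])
        show "D * sqrt (eps_sq q s_u s_v n p m r lam) \<le> 1 / (28 * (2 * M)\<^sup>2)" using cD H by (simp add: b_def)
        show "c \<le> 1 / (128 * (2 * M) ^ 8)" by (simp add: c_def b_def)
        show "AE Z in sample_law n (p + m) S. cca_solution p m r (eff_k q s_u n p r lam) (eff_k q s_v n m r lam) (sample_cov n (p + m) Z) (Uh Z) (Vh Z)"
          using H P nc by blast
      qed (use H assms D c0 nc in \<open>auto simp: b_def\<close>)
    qed
  qed
qed

end
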